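(* Let $d\ge 1$ and $\rho\in(0,1]$. For every $t\ge 0$, $$V(t) \;=\; (1-\rho)\sum_{j\in\mathbb{Z}^d} |j|^2 p(j)\, t \;+\; 2\rho\sum_{j\in\mathbb{Z}^d} j\,p(j)\cdot\int_0^t \Big\{E_\rho[x(s)]-E_{-j,\rho}[x(s)]\Big\}\,ds .$$
   Context: Setting. $p:\mathbb{Z}^d\to[0,\infty)$ is a single-particle jump rate that is finite-range ($p(x)=0$ for $|x|>R$, for some integer $R<\infty$), with $p(0)=0$, and such that $s(i)=(p(i)+p(-i))/2$ is irreducible on $\mathbb{Z}^d$. Configurations are $\zeta=(\zeta_i)_{i\in\mathbb{Z}^d}\in\{0,1\}^{\mathbb{Z}^d}$; $\zeta^{i,j}$ is $\zeta$ with the values at $i$ and $j$ exchanged; $(\pi_k\zeta)_l=\zeta_{k+l}$; and $\tau_j\zeta=\pi_j(\zeta^{0,j})$. Tagged particle and reference-frame process. In the simple exclusion process on $\mathbb{Z}^d$ with rate $p$ (a particle at $i$ jumps to $j$ at rate $p(j-i)$ if $j$ is empty; jumps to occupied sites are suppressed), tag one particle, let $x(t)$ be its position at time $t$ with $x(0)=0$, and let $\zeta(t)$ be the configuration seen from the tagged particle, so $\zeta_0(t)\equiv 1$. The pair $(x(t),\zeta(t))$ is Markov: for $i,j\in\mathbb{Z}^d\setminus\{0\}$, $\zeta\to\zeta^{i,j}$ at rate $\zeta_i(1-\zeta_j)p(j-i)$ ($x$ unchanged); and for $j\in\mathbb{Z}^d\setminus\{0\}$, $(x,\zeta)\to(x+j,\tau_j\zeta)$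 at rate $(1-\zeta_j)p(j)$. Measures. $P_\rho$ is the Bernoulli product measure on $\{0,1\}^{\mathbb{Z}^d}$ with $P_\rho\{\eta_i=1\}=\rho$, and $Q_\rho=P_\rho(\cdot\mid\zeta_0=1)$, which is invariant for $\zeta(t)$. $E_\rho$ is expectation for the process with $x(0)=0$ and $\zeta(0)\sim Q_\rho$. For $k\in\mathbb{Z}^d\setminus\{0\}$, $d\mu_{k,\rho}=(\zeta_k/\rho)\,dQ_\rho$, and $E_{k,\rho}$ is expectation for the process with $x(0)=0$ and $\zeta(0)\sim\mu_{k,\rho}$. (The term $j=0$ in the sums is zero since $p(0)=0$.) Finally $V(t)=E_\rho\big[\,|x(t)-E_\rho[x(t)]|^2\,\big]$, with $|\cdot|$ the Euclidean norm and $\cdot$ the Euclidean inner product. *)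

theory Defs
  imports "HOL-Probability.Probability"
begin

(* The lattice Z^d is the type int^'d with d = CARD('d) >= 1; a configuration in {0,1}^(Z^d) is a
   function int^'d => bool, True meaning "occupied". *)

type_synonym 'd config = "int^'d \<Rightarrow> bool"
type_synonym 'd state = "(int^'d) \<times> 'd config"

definition rvec :: "int^'d \<Rightarrow> real^'d" where
  "rvec x = (\<chi> i. real_of_int (x $ i))"

abbreviation config_space :: "'d::finite config measure" where
  "config_space \<equiv> PiM UNIV (\<lambda>_. count_space UNIV)"

abbreviation state_space :: "'d::finite state measure" where
  "state_space \<equiv> count_space UNIV \<Otimes>\<^sub>M config_space"

definition irreducible_rate :: "(int^'d::finite \<Rightarrow> real) \<Rightarrow> bool" where
  "irreducible_rate s \<longleftrightarrow> (\<forall>x y. (\<lambda>a b. s (b - a) > 0)\<^sup>*\<^sup>* x y)"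

definition jump_rate :: "(int^'d::finite \<Rightarrow> real) \<Rightarrow> bool" where
  "jump_rate p \<longleftrightarrow>
     (\<forall>x. p x \<ge> 0) \<and>
     (\<exists>R::int. \<forall>x. norm (rvec x) > real_of_int R \<longrightarrow> p x = 0) \<and>
     p 0 = 0 \<and>
     irreducible_rate (\<lambda>i. (p i + p (- i)) / 2)"

definition exchange :: "int^'d \<Rightarrow> int^'d \<Rightarrow> 'd config \<Rightarrow> 'd config" where
  "exchange i j \<zeta> = \<zeta>(i := \<zeta> j, j := \<zeta> i)"

definition shift :: "int^'d \<Rightarrow> 'd config \<Rightarrow> 'd config" where
  "shift k \<zeta> = (\<lambda>l. \<zeta> (k + l))"

definition tagged_jump :: "int^'d \<Rightarrow> 'd config \<Rightarrow> 'd config" where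
  "tagged_jump j \<zeta> = shift j (exchange 0 j \<zeta>)"

(* Functions of the position and of finitely many coordinates of the configuration, vanishing
   outside a finite set of positions. Such a function is automatically bounded and measurable. *)
definition local_function :: "('d::finite state \<Rightarrow> real) \<Rightarrow> bool" where
  "local_function f \<longleftrightarrow>
     (\<exists>A. finite A \<and> (\<forall>x \<zeta> \<xi>. (\<forall>i\<in>A. \<zeta> i = \<xi> i) \<longrightarrow> f (x, \<zeta>) = f (x, \<xi>))) \<and>
     finite {x. \<exists>\<zeta>. f (x, \<zeta>) \<noteq> 0}"

(* For a local function and a finite-range rate only finitely many terms of both sums
   are nonzero. *)
definition generator :: "(int^'d::finite \<Rightarrow> real) \<Rightarrow> ('d state \<Rightarrow> real) \<Rightarrow> 'd state \<Rightarrow> real" where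
  "generator p f = (\<lambda>(x, \<zeta>).
     (\<Sum>\<^sub>\<infinity>(i, j)\<in>(- {0}) \<times> (- {0}).
        of_bool (\<zeta> i) * (1 - of_bool (\<zeta> j)) * p (j - i) * (f (x, exchange i j \<zeta>) - f (x, \<zeta>))) +
     (\<Sum>\<^sub>\<infinity>j\<in>- {0}.
        (1 - of_bool (\<zeta> j)) * p j * (f (x + j, tagged_jump j \<zeta>) - f (x, \<zeta>))))"

(* S t z is the law at time t >= 0 of the process started from z. The last condition says that the
   jumps occur at the prescribed rates. The dynamics preserves the occupation of the origin, so
   the states with empty origin, which the tagged particle process never visits, are harmless. *)
definition tagged_transition ::
    "(int^'d::finite \<Rightarrow> real) \<Rightarrow> (real \<Rightarrow> 'd state \<Rightarrow> 'd state measure) \<Rightarrow> bool" where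
  "tagged_transition p S \<longleftrightarrow>
     (\<forall>t\<ge>0. S t \<in> state_space \<rightarrow>\<^sub>M prob_algebra state_space) \<and>
     (\<forall>z. S 0 z = return state_space z) \<and>
     (\<forall>s\<ge>0. \<forall>t\<ge>0. \<forall>z. S (s + t) z = S s z \<bind> S t) \<and>
     (\<forall>f. local_function f \<longrightarrow>
        uniform_limit UNIV (\<lambda>h z. ((\<integral>w. f w \<partial>S h z) - f z) / h) (generator p f) (at_right 0))"

definition past :: "'w measure \<Rightarrow> 's measure \<Rightarrow> (real \<Rightarrow> 'w \<Rightarrow> 's) \<Rightarrow> real \<Rightarrow> 'w measure" where
  "past M K X s = sigma (space M) (\<Union>u\<in>{0..s}. {X u -` A \<inter> space M | A. A \<in> sets K})"

definition markov_process ::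
    "'w measure \<Rightarrow> 's measure \<Rightarrow> (real \<Rightarrow> 'w \<Rightarrow> 's) \<Rightarrow> (real \<Rightarrow> 's \<Rightarrow> 's measure) \<Rightarrow> bool" where
  "markov_process M K X S \<longleftrightarrow>
     prob_space M \<and>
     (\<forall>t\<ge>0. X t \<in> M \<rightarrow>\<^sub>M K) \<and>
     (\<forall>s\<ge>0. \<forall>t\<ge>0. \<forall>A\<in>sets K. AE \<omega> in M.
        real_cond_exp M (past M K X s) (indicator (X (s + t) -` A \<inter> space M)) \<omega>
          = measure (S t (X s \<omega>)) A)"

(* Pr \<nu> governs the process with x(0) = 0 and \<zeta>(0) distributed according to \<nu>; the Markov
   transition function is the same for all \<nu>. *)
definition tagged_exclusion ::
    "(int^'d::finite \<Rightarrow> real) \<Rightarrow> ('d config measure \<Rightarrow> 'w measure) \<Rightarrow>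
     (real \<Rightarrow> 'w \<Rightarrow> int^'d) \<Rightarrow> (real \<Rightarrow> 'w \<Rightarrow> 'd config) \<Rightarrow> bool" where
  "tagged_exclusion p Pr x \<zeta> \<longleftrightarrow>
     (\<exists>S. tagged_transition p S \<and>
        (\<forall>\<nu>. prob_space \<nu> \<and> sets \<nu> = sets config_space \<longrightarrow>
           markov_process (Pr \<nu>) state_space (\<lambda>t \<omega>. (x t \<omega>, \<zeta> t \<omega>)) S \<and>
           (AE \<omega> in Pr \<nu>. x 0 \<omega> = 0) \<and>
           distr (Pr \<nu>) config_space (\<zeta> 0) = \<nu>))"

definition bernoulli_measure :: "real \<Rightarrow> 'd::finite config measure" where
  "bernoulli_measure \<rho> = PiM UNIV (\<lambda>_. measure_pmf (bernoulli_pmf \<rho>))"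

definition Q_measure :: "real \<Rightarrow> 'd::finite config measure" where
  "Q_measure \<rho> = uniform_measure (bernoulli_measure \<rho>) {\<zeta>. \<zeta> 0}"

definition mu_measure :: "int^'d::finite \<Rightarrow> real \<Rightarrow> 'd config measure" where
  "mu_measure k \<rho> = density (Q_measure \<rho>) (\<lambda>\<zeta>. ennreal (of_bool (\<zeta> k) / \<rho>))"

definition mean_position :: "'w measure \<Rightarrow> (real \<Rightarrow> 'w \<Rightarrow> int^'d::finite) \<Rightarrow> real \<Rightarrow> real^'d" where
  "mean_position M x t = (\<integral>\<omega>. rvec (x t \<omega>) \<partial>M)"

definition position_variance :: "'w measure \<Rightarrow> (real \<Rightarrow> 'w \<Rightarrow> int^'d::finite) \<Rightarrow> real \<Rightarrow> real" where
  "position_variance M x t = (\<integral>\<omega>. (norm (rvec (x t \<omega>) - mean_position M x t))\<^sup>2 \<partial>M)"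

end

theory Submission
  imports Defs
begin

text \<open>
  The second moment of the position satisfies
  \[ d/dt\, E|x(t)|^2 = E \sum_j p(j) (1 - \zeta_j(t)) (|j|^2 + 2 j \cdot x(t)) , \]
  so everything hinges on the correlation of the position with the occupation of a site near the
  tagged particle. In equilibrium this correlation is found by reversing time: the reversed process
  is the exclusion process with rates \<open>p(-j)\<close>, the reversed displacement is \<open>-x(t)\<close>, and
  a reflection of the lattice turns this process back into the original one. Hence
  \[ E_\rho[\zeta_j(t) x(t)] = E_\rho[\zeta_{-j}(0) x(t)] = \rho E_{-j,\rho}[x(t)] , \]
  which is \<open>reversal_expectation\<close>. The same identity with the constant 1 in place of the
  position says that every site other than the origin stays occupied with probability \<open>\<rho>\<close>, so
  the mean position is \<open>(1 - \<rho>) t\<close> times the total drift (\<open>mean_eq\<close>). Writing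
  \[ E_\rho[(1 - \zeta_j) x] = (1 - \rho) E_\rho[x] + \rho (E_\rho[x] - E_{-j,\rho}[x]) , \]
  the first summand contributes exactly the squared mean, which the variance subtracts, and the
  second one is the integral term of the formula.

  The Markov process enters through the forward equation for the expectations of local functions
  (\<open>markov_process_forward\<close>). The time reversal is first an algebraic identity for powers of the
  generator on local functions (\<open>generator_duality\<close>, \<open>generator_power_reversal\<close>). It passes
  to the process by analyticity: one application of the generator to a function of \<open>m\<close> sites
  produces boundedly many times \<open>m + 1\<close> terms, each a function of at most \<open>m + 1\<close> sites, so
  the \<open>n\<close>-th power grows at most like \<open>K^n n!\<close> (\<open>tame_generator_power\<close>). The
  expectations to be compared are therefore determined by their derivatives at time 0, which are the
  expectations of the powers of the generator under the initial law (\<open>analytic_uniqueness\<close>).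

  The position and its square are not local functions, since a local function vanishes far from the
  starting point. They are reached by cutting them off at a large radius; an exponential moment
  bound that is uniform on bounded time intervals (\<open>expectation_weight\<close>) dominates the limit.
\<close>

section \<open>Configurations and the Bernoulli measure\<close>

lemma space_config [simp]: "space (config_space :: 'd::finite config measure) = UNIV"
  by (simp add: space_PiM)

lemma space_state [simp]: "space (state_space :: 'd::finite state measure) = UNIV"
  by (simp add: space_pair_measure)

lemma sets_bernoulli [measurable_cong]:
  "sets (bernoulli_measure \<rho> :: 'd::finite config measure) = sets config_space"
  unfolding bernoulli_measure_def by (intro sets_PiM_cong) auto

lemma space_bernoulli [simp]: "space (bernoulli_measure \<rho> :: 'd::finite config measure) = UNIV"
  using sets_eq_imp_space_eq[OF sets_bernoulli] by simp

lemma prob_space_bernoulli: "prob_space (bernoulli_measure \<rho> :: 'd::finite config measure)"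
  unfolding bernoulli_measure_def by (intro prob_space_PiM prob_space_measure_pmf)

lemma measurable_occupied [measurable]:
  "(\<lambda>\<zeta>. \<zeta> i) \<in> (config_space :: 'd::finite config measure) \<rightarrow>\<^sub>M count_space UNIV"
  by (rule measurable_component_singleton) simp

lemma measurable_coordinate_map:
  "(\<lambda>\<zeta> i. \<zeta> (\<pi> i)) \<in> (config_space :: 'd::finite config measure) \<rightarrow>\<^sub>M config_space"
  by (intro measurable_PiM_single') auto

definition config_depends_on :: "(int^'d) set \<Rightarrow> ('d::finite config \<Rightarrow> 'b) \<Rightarrow> bool" where
  "config_depends_on A h \<longleftrightarrow> (\<forall>\<zeta> \<xi>. (\<forall>i\<in>A. \<zeta> i = \<xi> i) \<longrightarrow> h \<zeta> = h \<xi>)"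

text \<open>A function of finitely many sites factors through the trace of the configuration on these sites,
  which is a measurable map to a finite set.\<close>

lemma config_depends_on_measurable:
  fixes h :: "'d::finite config \<Rightarrow> real"
  assumes "finite A" "config_depends_on A h"
  shows "h \<in> borel_measurable config_space"
proof -
  let ?r = "\<lambda>\<zeta>::'d config. {i\<in>A. \<zeta> i}"
  have "?r \<in> config_space \<rightarrow>\<^sub>M count_space (Pow A)"
  proof (subst measurable_count_space_eq2)
    show "finite (Pow A)" using assms by simp
    have "?r -` {B} \<inter> space config_space \<in> sets (config_space :: 'd config measure)" if "B \<in> Pow A" for B
    proof -
      have "?r -` {B} \<inter> space config_space
          = {\<zeta> \<in> space (config_space :: 'd config measure). \<forall>i\<in>A. \<zeta> i = (i \<in> B)}" using that by auto
      also have "\<dots> \<in> sets config_space" using assms(1) by measurable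
      finally show ?thesis .
    qed
    then show "?r \<in> space config_space \<rightarrow> Pow A \<and>
        (\<forall>a\<in>Pow A. ?r -` {a} \<inter> space config_space \<in> sets (config_space :: 'd config measure))" by auto
  qed
  moreover have "(\<lambda>B. h (\<lambda>i. i \<in> B)) \<in> count_space (Pow A) \<rightarrow>\<^sub>M borel" by simp
  ultimately have "(\<lambda>\<zeta>. h (\<lambda>i. i \<in> ?r \<zeta>)) \<in> borel_measurable config_space"
    by (rule measurable_compose)
  moreover have "h (\<lambda>i. i \<in> ?r \<zeta>) = h \<zeta>" for \<zeta>
    using assms(2) unfolding config_depends_on_def by auto
  ultimately show ?thesis by simp
qed

lemma config_depends_on_finite_range:
  assumes "finite A" "config_depends_on A h"
  shows "finite (range h)"
proof -
  have "h \<zeta> \<in> (\<lambda>B. h (\<lambda>i. i \<in> B)) ` Pow A" for \<zeta>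
  proof -
    have "h \<zeta> = h (\<lambda>i. i \<in> {i\<in>A. \<zeta> i})"
      using assms(2) unfolding config_depends_on_def by (smt (verit) mem_Collect_eq)
    then show ?thesis by (intro image_eqI[of _ _ "{i\<in>A. \<zeta> i}"]) auto
  qed
  then have "range h \<subseteq> (\<lambda>B. h (\<lambda>i. i \<in> B)) ` Pow A" by auto
  then show ?thesis using assms(1) finite_subset by blast
qed

lemma distr_bernoulli_permute:
  fixes \<pi> :: "int^'d::finite \<Rightarrow> int^'d"
  assumes "inj \<pi>"
  shows "distr (bernoulli_measure \<rho>) (bernoulli_measure \<rho>) (\<lambda>\<zeta> i. \<zeta> (\<pi> i)) = bernoulli_measure \<rho>"
  using distr_PiM_reindex[of UNIV "\<lambda>_. measure_pmf (bernoulli_pmf \<rho>)" \<pi> UNIV] assms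
  by (simp add: bernoulli_measure_def prob_space_measure_pmf restrict_def)

lemma bernoulli_integral_permute:
  fixes F :: "'d::finite config \<Rightarrow> real" and \<pi> :: "int^'d \<Rightarrow> int^'d"
  assumes "inj \<pi>" and F: "F \<in> borel_measurable config_space"
  shows "(\<integral>\<zeta>. F (\<lambda>i. \<zeta> (\<pi> i)) \<partial>bernoulli_measure \<rho>) = (\<integral>\<zeta>. F \<zeta> \<partial>bernoulli_measure \<rho>)"
proof -
  have m: "(\<lambda>\<zeta> i. \<zeta> (\<pi> i)) \<in> bernoulli_measure \<rho> \<rightarrow>\<^sub>M (bernoulli_measure \<rho> :: 'd config measure)"
    using measurable_coordinate_map[of \<pi>] by (simp cong: measurable_cong_sets add: sets_bernoulli)
  have F': "F \<in> borel_measurable (bernoulli_measure \<rho>)"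
    using F by (simp cong: measurable_cong_sets add: sets_bernoulli)
  show ?thesis
    using integral_distr[OF m F'] distr_bernoulli_permute[OF assms(1), of \<rho>] by simp
qed

text \<open>The site \<open>k\<close> can be redrawn independently of all others without affecting \<open>h\<close>, so that
  Fubini's theorem splits off the centred occupation variable.\<close>

lemma bernoulli_integral_independent:
  fixes h :: "'d::finite config \<Rightarrow> real"
  assumes \<rho>: "0 \<le> \<rho>" "\<rho> \<le> 1" and A: "finite A" "config_depends_on A h" "k \<notin> A"
  shows "(\<integral>\<zeta>. h \<zeta> * (of_bool (\<zeta> k) - \<rho>) \<partial>bernoulli_measure \<rho>) = 0"
proof -
  let ?B = "measure_pmf (bernoulli_pmf \<rho>)"
  let ?P = "PiM (UNIV - {k}) (\<lambda>_. ?B)"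
  let ?u = "\<lambda>(b, X). X(k := b)"
  have ins: "insert k (UNIV - {k}) = UNIV" by auto
  have eq: "distr (?B \<Otimes>\<^sub>M ?P) (bernoulli_measure \<rho>) ?u = bernoulli_measure \<rho>"
    using distr_pair_PiM_eq_PiM[of "UNIV - {k}" "\<lambda>_. ?B" k]
    by (simp add: ins bernoulli_measure_def prob_space_measure_pmf)
  have u: "?u \<in> ?B \<Otimes>\<^sub>M ?P \<rightarrow>\<^sub>M bernoulli_measure \<rho>"
    unfolding bernoulli_measure_def split_beta'
    by (rule measurable_fun_upd[where J="UNIV - {k}"]) auto
  have hm: "h \<in> borel_measurable config_space" by (rule config_depends_on_measurable[OF A(1,2)])
  then have hm' [measurable]: "h \<in> borel_measurable (bernoulli_measure \<rho>)"
    by (simp cong: measurable_cong_sets add: sets_bernoulli)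
  have G: "(\<lambda>\<zeta>. h \<zeta> * (of_bool (\<zeta> k) - \<rho>)) \<in> borel_measurable (bernoulli_measure \<rho>)"
    by measurable
  define c where "c X = h (X(k := True))" for X
  have hk: "h (X(k := b)) = c X" for X b
    using A unfolding c_def config_depends_on_def by (metis fun_upd_apply)
  have "\<exists>C. \<forall>\<zeta>. \<bar>h \<zeta>\<bar> \<le> C"
    using finite_imp_bounded[OF config_depends_on_finite_range[OF A(1,2)]] unfolding bounded_iff by auto
  then obtain C where C: "\<bar>h \<zeta>\<bar> \<le> C" for \<zeta> by blast
  interpret B: prob_space ?B by (rule prob_space_measure_pmf)
  interpret P: prob_space ?P by (intro prob_space_PiM prob_space_measure_pmf)
  interpret BP: pair_prob_space ?B ?P ..
  have meas: "(\<lambda>(b, X). h (X(k := b)) * (of_bool b - \<rho>)) \<in> borel_measurable (?B \<Otimes>\<^sub>M ?P)"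
    using measurable_compose[OF u G] by (simp add: split_beta')
  have int: "integrable (?B \<Otimes>\<^sub>M ?P) (\<lambda>(b, X). h (X(k := b)) * (of_bool b - \<rho>))"
  proof (rule BP.integrable_const_bound[where B=C])
    have "\<bar>h (X(k := b)) * (of_bool b - \<rho>)\<bar> \<le> C" for X b
      using mult_mono[OF C[of "X(k:=b)"], of "\<bar>of_bool b - \<rho>\<bar>" 1] \<rho> C[of "X(k:=b)"]
      by (cases b) (auto simp: abs_mult)
    then show "AE x in ?B \<Otimes>\<^sub>M ?P. norm (case x of (b, X) \<Rightarrow> h (X(k := b)) * (of_bool b - \<rho>)) \<le> C"
      by (auto simp: split_beta')
  qed (fact meas)
  have "(\<integral>\<zeta>. h \<zeta> * (of_bool (\<zeta> k) - \<rho>) \<partial>bernoulli_measure \<rho>)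
      = (\<integral>z. (case z of (b, X) \<Rightarrow> h (X(k := b)) * (of_bool b - \<rho>)) \<partial>(?B \<Otimes>\<^sub>M ?P))"
    using integral_distr[OF u G] unfolding eq by (simp add: split_beta')
  also have "\<dots> = (\<integral>X. (\<integral>b. h (X(k := b)) * (of_bool b - \<rho>) \<partial>?B) \<partial>?P)"
    using BP.integral_snd[OF int] by simp
  also have "\<dots> = (\<integral>X. c X * (\<integral>b. (of_bool b - \<rho>) \<partial>?B) \<partial>?P)"
    by (simp add: hk)
  also have "(\<integral>b. (of_bool b - \<rho>) \<partial>?B) = 0"
    using \<rho> by simp
  finally show ?thesis by simp
qed


lemma prob_origin_occupied:
  assumes "0 \<le> \<rho>" "\<rho> \<le> 1"
  shows "emeasure (bernoulli_measure \<rho> :: 'd::finite config measure) {\<zeta>. \<zeta> 0} = ennreal \<rho>"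
proof -
  let ?P = "bernoulli_measure \<rho> :: 'd config measure"
  interpret P: prob_space ?P by (rule prob_space_bernoulli)
  have S: "{\<zeta>. \<zeta> 0} \<in> sets ?P"
    using measurable_sets[OF measurable_occupied[of 0], of "{True}"]
    by (simp add: sets_bernoulli vimage_def)
  have "(\<integral>\<zeta>. 1 * (of_bool (\<zeta> 0) - \<rho>) \<partial>?P) = 0"
    using assms by (intro bernoulli_integral_independent[where A="{}"]) (auto simp: config_depends_on_def)
  also have "(\<lambda>\<zeta>::'d config. 1 * (of_bool (\<zeta> 0) - \<rho>)) = (\<lambda>\<zeta>. indicator {\<zeta>. \<zeta> 0} \<zeta> - \<rho>)"
    by (auto simp: indicator_def)
  finally have "measure ?P {\<zeta>. \<zeta> 0} = \<rho>"
    using S by (subst (asm) Bochner_Integration.integral_diff) (auto simp: P.prob_space[simplified] P.emeasure_eq_measure)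
  then show ?thesis by (simp add: P.emeasure_eq_measure)
qed

lemma Q_measure_eq_density:
  assumes "0 < \<rho>" "\<rho> \<le> 1"
  shows "(Q_measure \<rho> :: 'd::finite config measure)
    = density (bernoulli_measure \<rho>) (\<lambda>\<zeta>. ennreal (of_bool (\<zeta> 0) / \<rho>))"
  unfolding Q_measure_def uniform_measure_def using assms
  by (intro arg_cong[where f="density _"] ext)
    (auto simp: prob_origin_occupied indicator_def ennreal_1[symmetric] divide_ennreal simp del: ennreal_1)

lemma sets_Q [measurable_cong]: "sets (Q_measure \<rho> :: 'd::finite config measure) = sets config_space"
  by (simp add: Q_measure_def sets_bernoulli)

lemma space_Q [simp]: "space (Q_measure \<rho> :: 'd::finite config measure) = UNIV"
  using sets_eq_imp_space_eq[OF sets_Q] by simp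

lemma prob_space_Q:
  assumes "0 < \<rho>" "\<rho> \<le> 1"
  shows "prob_space (Q_measure \<rho> :: 'd::finite config measure)"
  unfolding Q_measure_def
  by (rule prob_space_uniform_measure) (use assms in \<open>auto simp: prob_origin_occupied\<close>)

lemma Q_integral:
  fixes F :: "'d::finite config \<Rightarrow> real"
  assumes "0 < \<rho>" "\<rho> \<le> 1" and [measurable]: "F \<in> borel_measurable config_space"
  shows "(\<integral>\<zeta>. F \<zeta> \<partial>Q_measure \<rho>) = (\<integral>\<zeta>. of_bool (\<zeta> 0) * F \<zeta> \<partial>bernoulli_measure \<rho>) / \<rho>"
  unfolding Q_measure_eq_density[OF assms(1,2)] using assms(1,2)
  by (subst integral_density) (auto)

text \<open>Conditioning on a particle at the origin puts a factor \<open>\<zeta> 0\<close> into the Bernoulli integral. The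
  permutation carries this factor to the site \<open>\<pi> 0\<close> and brings the one at \<open>k\<close> to the origin, so
  both factors have to be present. Exchanges away from the origin and the reflection of the lattice
  are the instances that fix the origin.\<close>

lemma Q_integral_permute:
  fixes F :: "'d::finite config \<Rightarrow> real" and \<pi> :: "int^'d \<Rightarrow> int^'d"
  assumes "0 < \<rho>" "\<rho> \<le> 1" "inj \<pi>" "\<pi> k = 0" and [measurable]: "F \<in> borel_measurable config_space"
  shows "(\<integral>\<zeta>. of_bool (\<zeta> (\<pi> 0)) * F (\<lambda>i. \<zeta> (\<pi> i)) \<partial>Q_measure \<rho>)
    = (\<integral>\<zeta>. of_bool (\<zeta> k) * F \<zeta> \<partial>Q_measure \<rho>)"
proof -
  have [measurable]: "(\<lambda>\<zeta>. F (\<lambda>i. \<zeta> (\<pi> i))) \<in> borel_measurable config_space"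
    by (rule measurable_compose[OF measurable_coordinate_map assms(5)])
  have "(\<integral>\<zeta>. of_bool (\<zeta> (\<pi> k)) * (of_bool (\<zeta> (\<pi> 0)) * F (\<lambda>i. \<zeta> (\<pi> i))) \<partial>bernoulli_measure \<rho>)
      = (\<integral>\<zeta>. of_bool (\<zeta> k) * (of_bool (\<zeta> 0) * F \<zeta>) \<partial>bernoulli_measure \<rho>)"
    using bernoulli_integral_permute[OF assms(3), of "\<lambda>\<zeta>. of_bool (\<zeta> k) * (of_bool (\<zeta> 0) * F \<zeta>)"]
    by simp
  then show ?thesis
    using assms(1,2) by (simp add: Q_integral assms(4) ac_simps)
qed

lemma Q_integral_origin:
  fixes F :: "'d::finite config \<Rightarrow> real"
  assumes "0 < \<rho>" "\<rho> \<le> 1" and [measurable]: "F \<in> borel_measurable config_space"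
  shows "(\<integral>\<zeta>. of_bool (\<zeta> 0) * F \<zeta> \<partial>Q_measure \<rho>) = (\<integral>\<zeta>. F \<zeta> \<partial>Q_measure \<rho>)"
proof -
  have "(\<lambda>\<zeta>::'d config. of_bool (\<zeta> 0) * (of_bool (\<zeta> 0) * F \<zeta>)) = (\<lambda>\<zeta>. of_bool (\<zeta> 0) * F \<zeta>)" by auto
  moreover have "(\<lambda>\<zeta>. of_bool (\<zeta> 0) * F \<zeta>) \<in> borel_measurable config_space" by measurable
  ultimately show ?thesis
    using Q_integral[OF assms(1,2), of "\<lambda>\<zeta>. of_bool (\<zeta> 0) * F \<zeta>"] Q_integral[OF assms] by metis
qed

lemma exchange_eq_transpose: "exchange i j \<zeta> = (\<lambda>l. \<zeta> (Transposition.transpose i j l))"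
  by (rule ext) (auto simp: exchange_def Transposition.transpose_def)

lemma tagged_jump_eq_transpose:
  "tagged_jump j \<zeta> = (\<lambda>l. \<zeta> (Transposition.transpose 0 j (j + l)))"
  by (simp add: tagged_jump_def shift_def exchange_eq_transpose)

lemma Q_integral_exchange:
  fixes F :: "'d::finite config \<Rightarrow> real"
  assumes "0 < \<rho>" "\<rho> \<le> 1" "i \<noteq> 0" "j \<noteq> 0" and [measurable]: "F \<in> borel_measurable config_space"
  shows "(\<integral>\<zeta>. F (exchange i j \<zeta>) \<partial>Q_measure \<rho>) = (\<integral>\<zeta>. F \<zeta> \<partial>Q_measure \<rho>)"
proof -
  have t: "Transposition.transpose i j 0 = 0" using assms by (simp add: transpose_apply_other)
  have [measurable]: "(\<lambda>\<zeta>. F (exchange i j \<zeta>)) \<in> borel_measurable config_space"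
    unfolding exchange_eq_transpose by (rule measurable_compose[OF measurable_coordinate_map assms(5)])
  show ?thesis
    using Q_integral_permute[where \<pi>="Transposition.transpose i j" and k=0 and F=F, OF assms(1,2) _ t assms(5)] assms(1,2)
    by (simp add: t Q_integral_origin exchange_eq_transpose[symmetric])
qed

lemma Q_integral_reflect:
  fixes F :: "'d::finite config \<Rightarrow> real"
  assumes "0 < \<rho>" "\<rho> \<le> 1" and [measurable]: "F \<in> borel_measurable config_space"
  shows "(\<integral>\<zeta>. F (\<lambda>i. \<zeta> (- i)) \<partial>Q_measure \<rho>) = (\<integral>\<zeta>. F \<zeta> \<partial>Q_measure \<rho>)"
proof -
  have [measurable]: "(\<lambda>\<zeta>. F (\<lambda>i. \<zeta> (- i))) \<in> borel_measurable config_space"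
    by (rule measurable_compose[OF measurable_coordinate_map assms(3)])
  show ?thesis
    using Q_integral_permute[of \<rho> uminus 0 F] assms by (simp add: Q_integral_origin)
qed

text \<open>The tagged particle that has jumped to the empty site \<open>j\<close> sees the site it left as an empty site
  at \<open>- j\<close>. The jump thus permutes the coordinates and carries the configurations with a particle
  at 0 and none at \<open>j\<close> to those with a particle at 0 and none at \<open>- j\<close>.\<close>

lemma Q_integral_tagged_jump:
  fixes F :: "'d::finite config \<Rightarrow> real"
  assumes "0 < \<rho>" "\<rho> \<le> 1" "j \<noteq> 0" and [measurable]: "F \<in> borel_measurable config_space"
  shows "(\<integral>\<zeta>. (1 - of_bool (\<zeta> j)) * F (tagged_jump j \<zeta>) \<partial>Q_measure \<rho>)
    = (\<integral>\<zeta>. (1 - of_bool (\<zeta> (- j))) * F \<zeta> \<partial>Q_measure \<rho>)"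
proof -
  let ?\<pi> = "\<lambda>l. Transposition.transpose 0 j (j + l)"
  have inj: "inj ?\<pi>" by (auto intro!: injI dest: injD[OF inj_transpose])
  have "(\<lambda>\<zeta>. F (tagged_jump j \<zeta>)) \<in> borel_measurable config_space"
    unfolding tagged_jump_eq_transpose by (rule measurable_compose[OF measurable_coordinate_map assms(4)])
  note [measurable] = this
  have "(\<integral>\<zeta>. of_bool (\<zeta> 0) * ((1 - of_bool (\<zeta> (- j))) * F \<zeta>) \<partial>bernoulli_measure \<rho>) =
       (\<integral>\<zeta>. of_bool (\<zeta> (?\<pi> 0)) * ((1 - of_bool (\<zeta> (?\<pi> (-j)))) * F (\<lambda>l. \<zeta> (?\<pi> l))) \<partial>bernoulli_measure \<rho>)"
    by (rule bernoulli_integral_permute[OF inj, symmetric]) measurable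
  moreover have "?\<pi> 0 = 0" "?\<pi> (-j) = j" by simp_all
  ultimately show ?thesis
    using assms(1,2) by (simp add: Q_integral tagged_jump_eq_transpose[symmetric])
qed

lemma Q_integral_independent:
  fixes h :: "'d::finite config \<Rightarrow> real"
  assumes \<rho>: "0 < \<rho>" "\<rho> \<le> 1" and A: "finite A" "config_depends_on A h" "k \<notin> A" "k \<noteq> 0"
  shows "(\<integral>\<zeta>. h \<zeta> * (of_bool (\<zeta> k) - \<rho>) \<partial>Q_measure \<rho>) = 0"
proof -
  have [measurable]: "h \<in> borel_measurable config_space" by (rule config_depends_on_measurable[OF A(1,2)])
  have "config_depends_on (insert 0 A) (\<lambda>\<zeta>. of_bool (\<zeta> 0) * h \<zeta>)"
    using A(2) by (auto simp: config_depends_on_def)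
  then have "(\<integral>\<zeta>. (of_bool (\<zeta> 0) * h \<zeta>) * (of_bool (\<zeta> k) - \<rho>) \<partial>bernoulli_measure \<rho>) = 0"
    using \<rho> A by (intro bernoulli_integral_independent[where A="insert 0 A"]) auto
  then show ?thesis using \<rho> by (simp add: Q_integral mult.assoc)
qed

lemma sets_mu [measurable_cong]: "sets (mu_measure k \<rho> :: 'd::finite config measure) = sets config_space"
  by (simp add: mu_measure_def sets_Q)

lemma mu_integral:
  fixes F :: "'d::finite config \<Rightarrow> real"
  assumes "0 < \<rho>" "\<rho> \<le> 1" and [measurable]: "F \<in> borel_measurable config_space"
  shows "\<rho> * (\<integral>\<zeta>. F \<zeta> \<partial>mu_measure k \<rho>) = (\<integral>\<zeta>. of_bool (\<zeta> k) * F \<zeta> \<partial>Q_measure \<rho>)"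
  unfolding mu_measure_def using assms(1,2) by (subst integral_density) auto

lemma prob_space_mu:
  assumes "0 < \<rho>" "\<rho> \<le> 1" "k \<noteq> 0"
  shows "prob_space (mu_measure k \<rho> :: 'd::finite config measure)"
proof -
  interpret Q: prob_space "Q_measure \<rho> :: 'd config measure" by (rule prob_space_Q[OF assms(1,2)])
  have m: "(\<lambda>\<zeta>. of_bool (\<zeta> k) / \<rho>) \<in> borel_measurable (Q_measure \<rho> :: 'd config measure)" by measurable
  have "(\<integral>\<zeta>. 1 * (of_bool (\<zeta> k) - \<rho>) \<partial>(Q_measure \<rho> :: 'd config measure)) = 0"
    using assms by (intro Q_integral_independent[where A="{}"]) (auto simp: config_depends_on_def)
  moreover have i: "integrable (Q_measure \<rho> :: 'd config measure) (\<lambda>\<zeta>. of_bool (\<zeta> k) :: real)"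
    by (rule Q.integrable_const_bound[where B=1]) auto
  ultimately have "(\<integral>\<zeta>. of_bool (\<zeta> k) \<partial>(Q_measure \<rho> :: 'd config measure)) = \<rho>"
    by (simp add: Q.prob_space[simplified])
  then have "(\<integral>\<zeta>. of_bool (\<zeta> k) / \<rho> \<partial>(Q_measure \<rho> :: 'd config measure)) = 1"
    using assms by simp
  moreover have "(\<integral>\<^sup>+\<zeta>. ennreal (of_bool (\<zeta> k) / \<rho>) \<partial>(Q_measure \<rho> :: 'd config measure))
     = ennreal (\<integral>\<zeta>. of_bool (\<zeta> k) / \<rho> \<partial>(Q_measure \<rho> :: 'd config measure))"
    using assms i by (intro nn_integral_eq_integral) auto
  ultimately show ?thesis
    unfolding mu_measure_def using m
    by (intro prob_spaceI) (simp add: emeasure_density space_Q[symmetric] del: space_Q)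
qed

section \<open>Local functions and the generator\<close>

definition depends_on :: "(int^'d) set \<Rightarrow> ('d::finite state \<Rightarrow> real) \<Rightarrow> bool" where
  "depends_on A f \<longleftrightarrow> (\<forall>x. config_depends_on A (\<lambda>\<zeta>. f (x, \<zeta>)))"

definition position_support :: "('d::finite state \<Rightarrow> real) \<Rightarrow> (int^'d) set" where
  "position_support f = {x. \<exists>\<zeta>. f (x, \<zeta>) \<noteq> 0}"

lemma local_function_iff:
  "local_function f \<longleftrightarrow> (\<exists>A. finite A \<and> depends_on A f) \<and> finite (position_support f)"
  unfolding local_function_def depends_on_def config_depends_on_def position_support_def by blast

lemma depends_onD: "depends_on A f \<Longrightarrow> (\<And>i. i \<in> A \<Longrightarrow> \<zeta> i = \<xi> i) \<Longrightarrow> f (x, \<zeta>) = f (x, \<xi>)"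
  unfolding depends_on_def config_depends_on_def by blast

lemma depends_on_mono: "depends_on A f \<Longrightarrow> A \<subseteq> B \<Longrightarrow> depends_on B f"
  unfolding depends_on_def config_depends_on_def by blast

lemma local_function_zero: "local_function (\<lambda>_. 0)"
  unfolding local_function_def by auto

lemma depends_on_add: "depends_on A f \<Longrightarrow> depends_on B g \<Longrightarrow> depends_on (A \<union> B) (\<lambda>z. f z + g z)"
  unfolding depends_on_def config_depends_on_def by (metis UnI1 UnI2)

lemma position_support_add: "position_support (\<lambda>z. f z + g z) \<subseteq> position_support f \<union> position_support g"
  unfolding position_support_def by auto

lemma local_function_add:
  assumes "local_function f" "local_function g"
  shows "local_function (\<lambda>z. f z + g z)"
proof -
  obtain A B where "finite A" "finite B" "depends_on A f" "depends_on B g"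
    using assms unfolding local_function_iff by blast
  then show ?thesis
    using assms depends_on_add[of A f B g] finite_subset[OF position_support_add[of f g]]
    unfolding local_function_iff by (metis finite_UnI)
qed

lemma local_function_finite_range:
  assumes "local_function f" shows "finite (range f)"
proof -
  obtain A where A: "finite A" "depends_on A f" using assms unfolding local_function_iff by blast
  have "range f \<subseteq> insert 0 (\<Union>x\<in>position_support f. range (\<lambda>\<zeta>. f (x, \<zeta>)))"
    unfolding position_support_def by auto
  moreover have "finite (range (\<lambda>\<zeta>. f (x, \<zeta>)))" for x
    using config_depends_on_finite_range A unfolding depends_on_def by blast
  ultimately show ?thesis using assms unfolding local_function_iff
    by (meson finite.insertI finite_UN finite_subset)
qed

lemma local_function_bounded:
  assumes "local_function f" shows "\<exists>C. \<forall>z. \<bar>f z\<bar> \<le> C"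
  using finite_imp_bounded[OF local_function_finite_range[OF assms]] unfolding bounded_iff by auto

lemma local_function_measurable_section:
  assumes "local_function f" shows "(\<lambda>\<zeta>. f (x, \<zeta>)) \<in> borel_measurable config_space"
  using assms config_depends_on_measurable unfolding local_function_iff depends_on_def by blast

lemma local_function_measurable:
  assumes "local_function f" shows "f \<in> borel_measurable state_space"
  by (rule measurable_pair_measure_countable1[OF countableI_type local_function_measurable_section[OF assms]])

text \<open>The gain and the loss part of each jump are kept apart because a gain term depends on a set of
  sites that is moved by the jump, so that gain minus loss would depend on twice as many sites.\<close>

definition bond_gain :: "(int^'d::finite \<Rightarrow> real) \<Rightarrow> int^'d \<Rightarrow> int^'d \<Rightarrow> ('d state \<Rightarrow> real) \<Rightarrow> 'd state \<Rightarrow> real" where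
  "bond_gain p i j f = (\<lambda>(x, \<zeta>). of_bool (\<zeta> i) * (1 - of_bool (\<zeta> j)) * p (j - i) * f (x, exchange i j \<zeta>))"

definition bond_loss :: "(int^'d::finite \<Rightarrow> real) \<Rightarrow> int^'d \<Rightarrow> int^'d \<Rightarrow> ('d state \<Rightarrow> real) \<Rightarrow> 'd state \<Rightarrow> real" where
  "bond_loss p i j f = (\<lambda>(x, \<zeta>). of_bool (\<zeta> i) * (1 - of_bool (\<zeta> j)) * p (j - i) * f (x, \<zeta>))"

definition tag_gain :: "(int^'d::finite \<Rightarrow> real) \<Rightarrow> int^'d \<Rightarrow> ('d state \<Rightarrow> real) \<Rightarrow> 'd state \<Rightarrow> real" where
  "tag_gain p j f = (\<lambda>(x, \<zeta>). (1 - of_bool (\<zeta> j)) * p j * f (x + j, tagged_jump j \<zeta>))"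

definition tag_loss :: "(int^'d::finite \<Rightarrow> real) \<Rightarrow> int^'d \<Rightarrow> ('d state \<Rightarrow> real) \<Rightarrow> 'd state \<Rightarrow> real" where
  "tag_loss p j f = (\<lambda>(x, \<zeta>). (1 - of_bool (\<zeta> j)) * p j * f (x, \<zeta>))"

lemma depends_on_bond_gain:
  "depends_on A f \<Longrightarrow> depends_on (insert i (insert j A)) (bond_gain p i j f)"
  unfolding bond_gain_def depends_on_def[of "insert i _"] config_depends_on_def
proof (intro allI impI)
  fix x and \<zeta> \<xi> :: "'a config"
  assume f: "depends_on A f" and eq: "\<forall>l\<in>insert i (insert j A). \<zeta> l = \<xi> l"
  have "f (x, exchange i j \<zeta>) = f (x, exchange i j \<xi>)"
    by (rule depends_onD[OF f]) (use eq in \<open>auto simp: exchange_def\<close>)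
  then show "(case (x, \<zeta>) of (x, \<zeta>) \<Rightarrow> of_bool (\<zeta> i) * (1 - of_bool (\<zeta> j)) * p (j - i) * f (x, exchange i j \<zeta>))
     = (case (x, \<xi>) of (x, \<zeta>) \<Rightarrow> of_bool (\<zeta> i) * (1 - of_bool (\<zeta> j)) * p (j - i) * f (x, exchange i j \<zeta>))"
    using eq by simp
qed

lemma depends_on_bond_loss:
  "depends_on A f \<Longrightarrow> depends_on (insert i (insert j A)) (bond_loss p i j f)"
  unfolding bond_loss_def depends_on_def[of "insert i _"] config_depends_on_def
  by (auto intro!: depends_onD)

lemma depends_on_tag_loss:
  "depends_on A f \<Longrightarrow> depends_on (insert j A) (tag_loss p j f)"
  unfolding tag_loss_def depends_on_def[of "insert j _"] config_depends_on_def
  by (auto intro!: depends_onD)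

lemma depends_on_tag_gain:
  "depends_on A f \<Longrightarrow> depends_on (insert j ((\<lambda>l. Transposition.transpose 0 j (j + l)) ` A)) (tag_gain p j f)"
  unfolding tag_gain_def depends_on_def[of "insert j _"] config_depends_on_def tagged_jump_eq_transpose
  by (auto intro!: depends_onD)

lemma position_support_bond:
  "position_support (bond_gain p i j f) \<subseteq> position_support f"
  "position_support (bond_loss p i j f) \<subseteq> position_support f"
  "position_support (tag_loss p j f) \<subseteq> position_support f"
  "position_support (tag_gain p j f) \<subseteq> (\<lambda>x. x - j) ` position_support f"
  unfolding position_support_def bond_gain_def bond_loss_def tag_loss_def tag_gain_def
  by (auto simp: image_iff) (metis add_diff_cancel_right')

lemma
  assumes "local_function f"
  shows local_bond_gain: "local_function (bond_gain p i j f)"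
    and local_bond_loss: "local_function (bond_loss p i j f)"
    and local_tag_gain: "local_function (tag_gain p j f)"
    and local_tag_loss: "local_function (tag_loss p j f)"
  using assms depends_on_bond_gain[of _ f] depends_on_bond_loss[of _ f] depends_on_tag_gain[of _ f]
    depends_on_tag_loss[of _ f] finite_subset[OF position_support_bond(1)]
    finite_subset[OF position_support_bond(2)] finite_subset[OF position_support_bond(3)]
    finite_subset[OF position_support_bond(4)]
  unfolding local_function_iff by (meson finite_imageI finite_insert)+

lemma local_function_sum:
  "(\<And>i. i \<in> I \<Longrightarrow> local_function (f i)) \<Longrightarrow> local_function (\<lambda>z. \<Sum>i\<in>I. f i z)"
proof (induction I rule: infinite_finite_induct)
  case (insert i I)
  then show ?case using local_function_add[of "f i" "\<lambda>z. \<Sum>i\<in>I. f i z"] by simp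
qed (simp_all add: local_function_zero)

lemma local_function_cmult:
  assumes "local_function f" shows "local_function (\<lambda>z. c * f z)"
proof -
  have "depends_on A f \<Longrightarrow> depends_on A (\<lambda>z. c * f z)" for A
    unfolding depends_on_def config_depends_on_def by metis
  moreover have "position_support (\<lambda>z. c * f z) \<subseteq> position_support f"
    unfolding position_support_def by auto
  ultimately show ?thesis using assms unfolding local_function_iff by (meson finite_subset)
qed

lemma local_function_diff:
  assumes "local_function f" "local_function g" shows "local_function (\<lambda>z. f z - g z)"
  using local_function_add[OF assms(1) local_function_cmult[OF assms(2), of "-1"]] by simp

text \<open>Finite sums of functions of at most \<open>m\<close> sites each, with sup-norms adding up to at most
  \<open>c\<close>. The powers of the generator applied to a local function depend on more and more sites,
  but they are sums of terms that individually depend on few, and the cost of one more application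
  is governed by the latter number.\<close>

inductive tame :: "nat \<Rightarrow> real \<Rightarrow> ('d::finite state \<Rightarrow> real) \<Rightarrow> bool" for m where
  tame_single: "finite A \<Longrightarrow> card A \<le> m \<Longrightarrow> depends_on A f \<Longrightarrow> finite (position_support f) \<Longrightarrow>
    (\<And>z. \<bar>f z\<bar> \<le> c) \<Longrightarrow> tame m c f"
| tame_add: "tame m c f \<Longrightarrow> tame m d g \<Longrightarrow> tame m (c + d) (\<lambda>z. f z + g z)"

lemma tame_local: "tame m c f \<Longrightarrow> local_function f"
proof (induction rule: tame.induct)
  case (tame_single A f c)
  then show ?case unfolding local_function_iff by blast
qed (rule local_function_add)

lemma tame_bound: "tame m c f \<Longrightarrow> \<bar>f z\<bar> \<le> c"
  by (induction rule: tame.induct) (auto intro: order_trans[OF abs_triangle_ineq add_mono])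

lemma tame_mono: "tame m c f \<Longrightarrow> c \<le> d \<Longrightarrow> tame m d f"
proof (induction arbitrary: d rule: tame.induct)
  case (tame_single A f c)
  then show ?case by (intro tame.tame_single[of A]) (auto intro: order_trans)
next
  case (tame_add c f e g)
  have "tame m ((d - e) + e) (\<lambda>z. f z + g z)"
    by (rule tame.tame_add[OF tame_add.IH(1)]) (use tame_add in auto)
  then show ?case by simp
qed

lemma tame_zero: "tame m 0 (\<lambda>_. 0)"
  by (rule tame_single[of "{}"]) (auto simp: depends_on_def config_depends_on_def position_support_def)

lemma tame_sum:
  "finite I \<Longrightarrow> (\<And>i. i \<in> I \<Longrightarrow> tame m (c i) (f i)) \<Longrightarrow> tame m (\<Sum>i\<in>I. c i) (\<lambda>z. \<Sum>i\<in>I. f i z)"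
proof (induction I rule: finite_induct)
  case (insert i I)
  then show ?case using tame_add[of m "c i" "f i" "\<Sum>i\<in>I. c i" "\<lambda>z. \<Sum>i\<in>I. f i z"] by simp
qed (simp add: tame_zero)

lemma tame_uminus: "tame m c f \<Longrightarrow> tame m c (\<lambda>z. - f z)"
proof (induction rule: tame.induct)
  case (tame_single A f c)
  then show ?case
    by (intro tame.tame_single[of A]) (auto simp: depends_on_def config_depends_on_def position_support_def)
next
  case (tame_add c f d g)
  then show ?case using tame.tame_add[OF tame_add.IH] by (simp add: add.commute)
qed

lemma local_function_tame: assumes "local_function f" obtains m c where "0 \<le> c" "tame m c f"
proof -
  obtain A where A: "finite A" "depends_on A f" "finite (position_support f)"
    using assms unfolding local_function_iff by blast
  obtain C where C: "\<bar>f z\<bar> \<le> C" for z using local_function_bounded[OF assms] by blast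
  have "tame (card A) C f" by (rule tame_single[OF A(1) order_refl A(2,3) C])
  moreover have "0 \<le> C" using C[of undefined] by linarith
  ultimately show ?thesis using that by blast
qed

locale finite_range_rate =
  fixes p :: "int^'d::finite \<Rightarrow> real"
  assumes rate_nonneg: "0 \<le> p j" and rate_zero: "p 0 = 0" and finite_rate_support: "finite {j. p j \<noteq> 0}"
begin

abbreviation J where "J \<equiv> {j. p j \<noteq> 0}"

definition total_rate :: real where "total_rate = (\<Sum>j\<in>J. p j)"

lemma rate_le_total: "p j \<le> total_rate"
  unfolding total_rate_def using member_le_sum[of j J p] rate_nonneg finite_rate_support
  by (cases "p j = 0") (auto simp: sum_nonneg)

lemma total_rate_nonneg: "0 \<le> total_rate"
  using rate_nonneg[of 0] rate_le_total[of 0] by linarith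

definition covers_bonds :: "(int^'d) set \<Rightarrow> ((int^'d) \<times> (int^'d)) set \<Rightarrow> bool" where
  "covers_bonds A D \<longleftrightarrow> finite D \<and> D \<subseteq> (- {0}) \<times> (- {0}) \<and>
     (\<forall>i j. i \<noteq> 0 \<longrightarrow> j \<noteq> 0 \<longrightarrow> p (j - i) \<noteq> 0 \<longrightarrow> i \<in> A \<or> j \<in> A \<longrightarrow> (i, j) \<in> D)"

text \<open>An exchange of two sites outside \<open>A\<close> leaves \<open>f\<close> unchanged, so only the bonds that meet
  \<open>A\<close> count. The set \<open>D\<close> may be any larger finite set, so that several generators and functions
  can share one.\<close>

lemma generator_eq_finite_sum:
  assumes "depends_on A f" "covers_bonds A D"
  shows "generator p f z = (\<Sum>(i, j)\<in>D. bond_gain p i j f z - bond_loss p i j f z)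
    + (\<Sum>j\<in>J. tag_gain p j f z - tag_loss p j f z)"
proof (cases z)
  case (Pair x \<zeta>)
  have D: "finite D" "D \<subseteq> (- {0}) \<times> (- {0})"
    "\<And>i j. i \<noteq> 0 \<Longrightarrow> j \<noteq> 0 \<Longrightarrow> p (j - i) \<noteq> 0 \<Longrightarrow> i \<in> A \<or> j \<in> A \<Longrightarrow> (i, j) \<in> D"
    using assms(2) unfolding covers_bonds_def by blast+
  have ex: "f (x, exchange i j \<zeta>) = f (x, \<zeta>)" if "i \<notin> A" "j \<notin> A" for i j
    using that by (intro depends_onD[OF assms(1)]) (auto simp: exchange_def)
  have zero: "(case b of (i, j) \<Rightarrow>
      of_bool (\<zeta> i) * (1 - of_bool (\<zeta> j)) * p (j - i) * (f (x, exchange i j \<zeta>) - f (x, \<zeta>))) = 0"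
    if b: "b \<in> (- {0}) \<times> (- {0}) - D" for b
  proof (cases b)
    case (Pair i j)
    show ?thesis
    proof (cases "p (j - i) = 0")
      case False
      then have "i \<notin> A" "j \<notin> A" using b Pair D(3) by blast+
      then show ?thesis using ex Pair by simp
    qed (simp add: Pair)
  qed
  have "(\<Sum>\<^sub>\<infinity>(i, j)\<in>(- {0}) \<times> (- {0}).
        of_bool (\<zeta> i) * (1 - of_bool (\<zeta> j)) * p (j - i) * (f (x, exchange i j \<zeta>) - f (x, \<zeta>)))
    = (\<Sum>\<^sub>\<infinity>(i, j)\<in>D. of_bool (\<zeta> i) * (1 - of_bool (\<zeta> j)) * p (j - i) * (f (x, exchange i j \<zeta>) - f (x, \<zeta>)))"
    by (rule infsum_cong_neutral) (use D(2) zero in blast)+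
  also have "\<dots> = (\<Sum>(i, j)\<in>D. bond_gain p i j f z - bond_loss p i j f z)"
    using D(1) by (simp add: Pair bond_gain_def bond_loss_def right_diff_distrib)
  finally have bonds: "(\<Sum>\<^sub>\<infinity>(i, j)\<in>(- {0}) \<times> (- {0}).
        of_bool (\<zeta> i) * (1 - of_bool (\<zeta> j)) * p (j - i) * (f (x, exchange i j \<zeta>) - f (x, \<zeta>))) = \<dots>" .
  have "(\<Sum>\<^sub>\<infinity>j\<in>- {0}. (1 - of_bool (\<zeta> j)) * p j * (f (x + j, tagged_jump j \<zeta>) - f (x, \<zeta>)))
     = (\<Sum>\<^sub>\<infinity>j\<in>J. (1 - of_bool (\<zeta> j)) * p j * (f (x + j, tagged_jump j \<zeta>) - f (x, \<zeta>)))"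
    using rate_zero by (intro infsum_cong_neutral) auto
  also have "\<dots> = (\<Sum>j\<in>J. tag_gain p j f z - tag_loss p j f z)"
    using finite_rate_support by (simp add: Pair tag_gain_def tag_loss_def right_diff_distrib)
  finally show ?thesis using bonds by (simp add: generator_def Pair)
qed

definition bonds :: "(int^'d) set \<Rightarrow> ((int^'d) \<times> (int^'d)) set" where
  "bonds A = ((\<lambda>(a, k). (a, a + k)) ` (A \<times> J) \<union> (\<lambda>(a, k). (a - k, a)) ` (A \<times> J)) \<inter> (- {0}) \<times> (- {0})"

lemma covers_bonds: "finite A \<Longrightarrow> covers_bonds A (bonds A)"
  unfolding covers_bonds_def bonds_def using finite_rate_support
  by (auto simp: image_iff Bex_def)
    (metis (no_types, lifting) add_diff_cancel_left' diff_add_cancel add.commute diff_diff_eq2)+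

lemma card_bonds: assumes "finite A" shows "card (bonds A) \<le> 2 * (card A * card J)"
proof -
  have f: "finite (A \<times> J)" using assms finite_rate_support by simp
  have "card (bonds A) \<le> card ((\<lambda>(a, k). (a, a + k)) ` (A \<times> J) \<union> (\<lambda>(a, k). (a - k, a)) ` (A \<times> J))"
    unfolding bonds_def using f by (intro card_mono) auto
  also have "\<dots> \<le> card ((\<lambda>(a, k). (a, a + k)) ` (A \<times> J)) + card ((\<lambda>(a, k). (a - k, a)) ` (A \<times> J))"
    by (rule card_Un_le)
  also have "\<dots> \<le> card (A \<times> J) + card (A \<times> J)"
    by (intro add_mono card_image_le f)
  finally show ?thesis by (simp add: card_cartesian_product)
qed

lemma bonds_touch: "(i, j) \<in> bonds A \<Longrightarrow> i \<in> A \<or> j \<in> A"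
  unfolding bonds_def by auto

lemma local_generator:
  assumes "local_function f" shows "local_function (generator p f)"
proof -
  obtain A where A: "finite A" "depends_on A f" using assms unfolding local_function_iff by blast
  have "local_function (\<lambda>z. (\<Sum>b\<in>bonds A. bond_gain p (fst b) (snd b) f z - bond_loss p (fst b) (snd b) f z)
      + (\<Sum>j\<in>J. tag_gain p j f z - tag_loss p j f z))"
    by (intro local_function_add local_function_sum local_function_diff local_bond_gain local_bond_loss
        local_tag_gain local_tag_loss assms)
  then show ?thesis
    by (simp add: generator_eq_finite_sum[OF A(2) covers_bonds[OF A(1)], abs_def] split_beta')
qed

lemma generator_add:
  assumes "local_function f" "local_function g"
  shows "generator p (\<lambda>z. f z + g z) = (\<lambda>z. generator p f z + generator p g z)"
proof
  fix z
  obtain A B where "finite A" "finite B" "depends_on A f" "depends_on B g"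
    using assms unfolding local_function_iff by blast
  then have C: "finite (A \<union> B)" "depends_on (A \<union> B) f" "depends_on (A \<union> B) g" "depends_on (A \<union> B) (\<lambda>z. f z + g z)"
    using depends_on_add[of A f B g] depends_on_mono[of A f] depends_on_mono[of B g] by auto
  note D = covers_bonds[OF C(1)]
  show "generator p (\<lambda>z. f z + g z) z = generator p f z + generator p g z"
    unfolding generator_eq_finite_sum[OF C(2) D] generator_eq_finite_sum[OF C(3) D] generator_eq_finite_sum[OF C(4) D]
    by (simp add: sum.distrib[symmetric] bond_gain_def bond_loss_def tag_gain_def tag_loss_def split_beta'
        distrib_left algebra_simps)
qed

text \<open>Each of the gain and loss terms sees at most one site more than \<open>f\<close>, since a contributing bond
  has one end among the sites of \<open>f\<close> already. There are at most twice \<open>m * card J\<close> such bonds and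
  \<open>card J\<close> jumps of the tagged particle, with two terms each.\<close>

lemma tame_generator:
  assumes "tame m c f"
  shows "tame (m + 1) (4 * real (card J) * total_rate * real (m + 1) * c) (generator p f)"
  using assms
proof (induction rule: tame.induct)
  case (tame_single A f c)
  have c: "0 \<le> c" using tame_single(5)[of undefined] by linarith
  let ?l = "total_rate * c"
  have l: "0 \<le> ?l" using c total_rate_nonneg by simp
  have b: "\<bar>of_bool P * (1 - of_bool Q) * p k * f z\<bar> \<le> ?l" for P Q k z
    using mult_mono[OF rate_le_total[of k] tame_single(5)[of z]] l rate_nonneg[of k] total_rate_nonneg
    by (cases P; cases Q) (auto simp: abs_mult)
  have b': "\<bar>(1 - of_bool Q) * p k * f z\<bar> \<le> ?l" for Q k z
    using b[of True Q k z] by simp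
  have bb: "\<bar>bond_gain p i j f z\<bar> \<le> ?l" "\<bar>bond_loss p i j f z\<bar> \<le> ?l"
    "\<bar>tag_gain p j f z\<bar> \<le> ?l" "\<bar>tag_loss p j f z\<bar> \<le> ?l" for i j z
    by (cases z; simp only: bond_gain_def bond_loss_def tag_gain_def tag_loss_def prod.case b b')+
  have t1: "tame (m + 1) ?l (bond_gain p i j f)" "tame (m + 1) ?l (bond_loss p i j f)" if "i \<in> A \<or> j \<in> A" for i j
  proof -
    have "card (insert i (insert j A)) \<le> m + 1"
      using that tame_single(1,2) by (auto simp: insert_absorb card_insert_if)
    then show "tame (m + 1) ?l (bond_gain p i j f)" "tame (m + 1) ?l (bond_loss p i j f)"
      using tame_single(1-4) bb
      by (auto intro!: tame.tame_single[of "insert i (insert j A)"] depends_on_bond_gain depends_on_bond_loss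
         finite_subset[OF position_support_bond(1)] finite_subset[OF position_support_bond(2)])
  qed
  have t2: "tame (m + 1) ?l (tag_loss p j f)" for j
    using tame_single(1-4) bb
    by (auto intro!: tame.tame_single[of "insert j A"] depends_on_tag_loss
         finite_subset[OF position_support_bond(3)] simp: card_insert_if)
  have t3: "tame (m + 1) ?l (tag_gain p j f)" for j
  proof (rule tame.tame_single[OF _ _ depends_on_tag_gain[OF tame_single(3)]])
    have "card ((\<lambda>l. Transposition.transpose 0 j (j + l)) ` A) \<le> m"
      using card_image_le[OF tame_single(1)] tame_single(2) by (rule order_trans)
    then show "card (insert j ((\<lambda>l. Transposition.transpose 0 j (j + l)) ` A)) \<le> m + 1"
      using tame_single(1) by (simp add: card_insert_if)
  qed (use tame_single(1,4) bb in \<open>auto intro: finite_subset[OF position_support_bond(4)]\<close>)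
  have t12: "tame (m + 1) (?l + ?l) (\<lambda>z. bond_gain p i j f z - bond_loss p i j f z)" if "i \<in> A \<or> j \<in> A" for i j
    using tame.tame_add[OF t1(1)[OF that] tame_uminus[OF t1(2)[OF that]]] by simp
  have t34: "tame (m + 1) (?l + ?l) (\<lambda>z. tag_gain p j f z - tag_loss p j f z)" for j
    using tame.tame_add[OF t3 tame_uminus[OF t2]] by simp
  have "tame (m + 1) ((\<Sum>b\<in>bonds A. ?l + ?l) + (\<Sum>j\<in>J. ?l + ?l))
    (\<lambda>z. (\<Sum>b\<in>bonds A. bond_gain p (fst b) (snd b) f z - bond_loss p (fst b) (snd b) f z)
      + (\<Sum>j\<in>J. tag_gain p j f z - tag_loss p j f z))"
    using covers_bonds[OF tame_single(1)] finite_rate_support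
    by (intro tame.tame_add tame_sum t12 t34) (auto simp: covers_bonds_def dest!: bonds_touch)
  also have "(\<lambda>z. (\<Sum>b\<in>bonds A. bond_gain p (fst b) (snd b) f z - bond_loss p (fst b) (snd b) f z)
      + (\<Sum>j\<in>J. tag_gain p j f z - tag_loss p j f z)) = generator p f"
    by (simp add: generator_eq_finite_sum[OF tame_single(3) covers_bonds[OF tame_single(1)], abs_def] split_beta')
  finally have g: "tame (m + 1) ((\<Sum>b\<in>bonds A. ?l + ?l) + (\<Sum>j\<in>J. ?l + ?l)) (generator p f)" .
  have "real (card (bonds A)) \<le> real (2 * (card A * card J))"
    using card_bonds[OF tame_single(1)] of_nat_mono by blast
  also have "\<dots> \<le> 2 * (real m * real (card J))"
    using tame_single(2) by (auto intro: mult_right_mono)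
  finally have "real (card (bonds A)) \<le> 2 * (real m * real (card J))" .
  then have "real (card (bonds A)) + real (card J) \<le> 2 * real (card J) * (real m + 1)"
    by (simp add: algebra_simps)
  then have "(real (card (bonds A)) + real (card J)) * (2 * ?l) \<le> 2 * real (card J) * (real m + 1) * (2 * ?l)"
    using l by (intro mult_right_mono) auto
  then show ?case
    using l by (intro tame_mono[OF g]) (simp add: algebra_simps)
next
  case (tame_add c f d g)
  show ?case
    using tame.tame_add[OF tame_add.IH]
    by (simp add: generator_add[OF tame_local[OF tame_add(1)] tame_local[OF tame_add(2)]] algebra_simps)
qed

text \<open>The \<open>n\<close>-th application multiplies the number of terms by a factor linear in \<open>n\<close>, whence a
  single factorial and a positive radius of convergence of the exponential series, in every
  dimension.\<close>

lemma tame_generator_power: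
  assumes "tame m c f" "0 \<le> c"
  shows "tame (m + n) (c * (4 * real (card J) * total_rate * real (m + 1)) ^ n * fact n) ((generator p ^^ n) f)"
proof (induction n)
  case (Suc n)
  let ?K = "4 * real (card J) * total_rate" and ?C = "c * (4 * real (card J) * total_rate * real (m + 1)) ^ n * fact n"
  have K: "0 \<le> ?K" using total_rate_nonneg by simp
  \<comment> \<open>turns the growing number of sites into one more factor of the factorial\<close>
  have "real (m + n + 1) \<le> (real m + 1) * (real n + 1)"
    by (simp add: algebra_simps)
  moreover have "0 \<le> ?K * ?C" using K assms(2) by simp
  ultimately have "(?K * ?C) * real (m + n + 1) \<le> (?K * ?C) * ((real m + 1) * (real n + 1))"
    by (rule mult_left_mono)
  moreover have "tame (m + n + 1) (?K * real (m + n + 1) * ?C) (generator p ((generator p ^^ n) f))"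
    by (rule tame_generator[OF Suc])
  ultimately have "tame (m + n + 1) ((?K * ?C) * ((real m + 1) * (real n + 1))) (generator p ((generator p ^^ n) f))"
    by (elim tame_mono) (simp add: mult_ac add_ac)
  moreover have "(?K * ?C) * ((real m + 1) * (real n + 1)) = c * (?K * real (m + 1)) ^ Suc n * fact (Suc n)"
    by (simp add: mult_ac add_ac)
  ultimately show ?case
    unfolding funpow.simps(2) o_apply add_Suc_right by (simp only: Suc_eq_plus1)
qed (use assms in simp)

lemma local_generator_power: "local_function f \<Longrightarrow> local_function ((generator p ^^ n) f)"
  by (induction n) (auto intro: local_generator)

end

section \<open>Duality of the generator under time reversal\<close>

text \<open>The inner product with respect to the counting measure on positions times \<^const>\<open>Q_measure\<close>,
  a measure that the dynamics preserves. It is used when one argument has finite position support.\<close>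

definition pairing :: "real \<Rightarrow> ('d::finite state \<Rightarrow> real) \<Rightarrow> ('d state \<Rightarrow> real) \<Rightarrow> real" where
  "pairing \<rho> f g = (\<Sum>\<^sub>\<infinity>x. \<integral>\<zeta>. f (x, \<zeta>) * g (x, \<zeta>) \<partial>Q_measure \<rho>)"

lemma pairing_commute: "pairing \<rho> f g = pairing \<rho> g f"
  by (simp add: pairing_def mult.commute)

lemma pairing_eq_sum:
  assumes "finite X" "position_support f \<subseteq> X"
  shows "pairing \<rho> f g = (\<Sum>x\<in>X. \<integral>\<zeta>. f (x, \<zeta>) * g (x, \<zeta>) \<partial>Q_measure \<rho>)"
proof -
  have "f (x, \<zeta>) = 0" if "x \<notin> X" for x \<zeta> using assms that unfolding position_support_def by blast
  then have "pairing \<rho> f g = (\<Sum>\<^sub>\<infinity>x\<in>X. \<integral>\<zeta>. f (x, \<zeta>) * g (x, \<zeta>) \<partial>Q_measure \<rho>)"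
    unfolding pairing_def by (intro infsum_cong_neutral) auto
  then show ?thesis using assms by simp
qed

context
  fixes \<rho> :: real
  assumes \<rho>: "0 < \<rho>" "\<rho> \<le> 1"
begin

lemma integrable_local_product:
  fixes f g :: "'d::finite state \<Rightarrow> real"
  assumes "local_function f" "local_function g"
  shows "integrable (Q_measure \<rho>) (\<lambda>\<zeta>. f (x, \<zeta>) * g (y, \<zeta>))"
proof -
  interpret Q: prob_space "Q_measure \<rho> :: 'd config measure" by (rule prob_space_Q[OF \<rho>])
  note [measurable] = local_function_measurable_section[OF assms(1)] local_function_measurable_section[OF assms(2)]
  obtain C where C: "\<bar>f z\<bar> \<le> C" for z using local_function_bounded[OF assms(1)] by blast
  obtain C' where C': "\<bar>g z\<bar> \<le> C'" for z using local_function_bounded[OF assms(2)] by blast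
  have "\<bar>f (x, \<zeta>) * g (y, \<zeta>)\<bar> \<le> C * C'" for \<zeta>
    unfolding abs_mult by (intro mult_mono C C') (use C[of undefined] in auto)
  then show ?thesis by (intro Q.integrable_const_bound[where B="C * C'"]) auto
qed

lemma pairing_add:
  fixes f g h :: "'d::finite state \<Rightarrow> real"
  assumes "local_function f" "local_function g" "local_function h"
  shows "pairing \<rho> f (\<lambda>z. g z + h z) = pairing \<rho> f g + pairing \<rho> f h"
proof -
  have fin: "finite (position_support f)" using assms(1) by (simp add: local_function_iff)
  show ?thesis
    unfolding pairing_eq_sum[OF fin order_refl]
    by (simp add: distrib_left sum.distrib integrable_local_product assms)
qed

lemma pairing_cmult:
  fixes f g :: "'d::finite state \<Rightarrow> real"
  shows "pairing \<rho> f (\<lambda>z. c * g z) = c * pairing \<rho> f g"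
  unfolding pairing_def by (simp add: mult.left_commute[of _ c] infsum_cmult_right')

lemma pairing_diff:
  fixes f g h :: "'d::finite state \<Rightarrow> real"
  assumes "local_function f" "local_function g" "local_function h"
  shows "pairing \<rho> f (\<lambda>z. g z - h z) = pairing \<rho> f g - pairing \<rho> f h"
  using pairing_add[OF assms(1,2) local_function_cmult[OF assms(3), of "-1"]] pairing_cmult[of f "-1" h]
  by simp

lemma pairing_sum:
  fixes f :: "'d::finite state \<Rightarrow> real"
  assumes "local_function f" "\<And>i. i \<in> I \<Longrightarrow> local_function (g i)"
  shows "pairing \<rho> f (\<lambda>z. \<Sum>i\<in>I. g i z) = (\<Sum>i\<in>I. pairing \<rho> f (g i))"
  using assms(2)
proof (induction I rule: infinite_finite_induct)
  case (insert i I)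
  then show ?case
    using pairing_add[OF assms(1), of "g i" "\<lambda>z. \<Sum>i\<in>I. g i z"] local_function_sum[of I g] by simp
qed (simp_all add: pairing_def)

lemma pairing_bond_gain:
  fixes f g :: "'d::finite state \<Rightarrow> real"
  assumes "local_function f" "local_function g" "i \<noteq> 0" "j \<noteq> 0"
  shows "pairing \<rho> f (bond_gain p i j g) = pairing \<rho> (bond_gain (\<lambda>k. p (- k)) j i f) g"
  unfolding pairing_def
proof (rule infsum_cong)
  fix x
  let ?F = "\<lambda>\<zeta>. bond_gain (\<lambda>k. p (- k)) j i f (x, \<zeta>) * g (x, \<zeta>)"
  have "?F \<in> borel_measurable config_space"
    by (intro borel_measurable_times local_function_measurable_section local_bond_gain assms)
  then have "(\<integral>\<zeta>. ?F (exchange i j \<zeta>) \<partial>Q_measure \<rho>) = (\<integral>\<zeta>. ?F \<zeta> \<partial>Q_measure \<rho>)"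
    by (rule Q_integral_exchange[OF \<rho> assms(3,4)])
  moreover have "exchange j i (exchange i j \<zeta>) = \<zeta>" for \<zeta> :: "'d config"
    by (auto simp: exchange_def)
  moreover have exchange_at: "exchange i j \<zeta> i = \<zeta> j" "exchange i j \<zeta> j = \<zeta> i" for \<zeta> :: "'d config"
    by (auto simp: exchange_def)
  ultimately show "(\<integral>\<zeta>. f (x, \<zeta>) * bond_gain p i j g (x, \<zeta>) \<partial>Q_measure \<rho>) = (\<integral>\<zeta>. ?F \<zeta> \<partial>Q_measure \<rho>)"
    using exchange_at by (simp add: bond_gain_def mult_ac)
qed

lemma tagged_jump_inverse: "tagged_jump (- j) (tagged_jump j \<zeta>) = \<zeta>"
proof
  fix l
  show "tagged_jump (- j) (tagged_jump j \<zeta>) l = \<zeta> l"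
    by (cases "l = j"; cases "l = 0") (simp_all add: tagged_jump_def shift_def exchange_def)
qed

text \<open>The change of variables moves the position by \<open>j\<close> together with the configuration; summing over
  all positions absorbs this shift.\<close>

lemma pairing_tag_gain:
  fixes f g :: "'d::finite state \<Rightarrow> real"
  assumes "local_function f" "local_function g" "j \<noteq> 0"
  shows "pairing \<rho> f (tag_gain p j g) = pairing \<rho> (tag_gain (\<lambda>k. p (- k)) (- j) f) g"
proof -
  let ?h = "\<lambda>x. \<integral>\<zeta>. tag_gain (\<lambda>k. p (- k)) (- j) f (x, \<zeta>) * g (x, \<zeta>) \<partial>Q_measure \<rho>"
  have "(\<integral>\<zeta>. f (x, \<zeta>) * tag_gain p j g (x, \<zeta>) \<partial>Q_measure \<rho>) = ?h (x + j)" for x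
  proof -
    let ?F = "\<lambda>\<zeta>. p j * f (x, tagged_jump (- j) \<zeta>) * g (x + j, \<zeta>)"
    have "(\<lambda>\<zeta>. f (x, tagged_jump (- j) \<zeta>)) \<in> borel_measurable config_space"
      unfolding tagged_jump_eq_transpose
      by (rule measurable_compose[OF measurable_coordinate_map local_function_measurable_section[OF assms(1)]])
    then have "?F \<in> borel_measurable config_space"
      by (intro borel_measurable_times local_function_measurable_section[OF assms(2)]) auto
    then have "(\<integral>\<zeta>. (1 - of_bool (\<zeta> j)) * ?F (tagged_jump j \<zeta>) \<partial>Q_measure \<rho>)
        = (\<integral>\<zeta>. (1 - of_bool (\<zeta> (- j))) * ?F \<zeta> \<partial>Q_measure \<rho>)"
      by (rule Q_integral_tagged_jump[OF \<rho> assms(3)])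
    then show ?thesis by (simp add: tag_gain_def tagged_jump_inverse mult_ac)
  qed
  moreover have "bij (\<lambda>x::int^'d. x + j)" by (rule bij_plus_right)
  ultimately show ?thesis
    unfolding pairing_def using infsum_reindex_bij_betw[of "\<lambda>x::int^'d. x + j" UNIV UNIV ?h] by simp
qed

text \<open>The loss rates of a jump and of its reversal differ by
  \<open>\<zeta>\<^sub>i (1 - \<zeta>\<^sub>j) - \<zeta>\<^sub>j (1 - \<zeta>\<^sub>i) = \<zeta>\<^sub>i - \<zeta>\<^sub>j\<close>. Subtracting the density does not change this
  difference, and it makes the contribution of every site vanish that neither function sees.\<close>

definition centred :: "int^'d \<Rightarrow> ('d::finite state \<Rightarrow> real) \<Rightarrow> 'd state \<Rightarrow> real" where
  "centred k g = (\<lambda>(x, \<zeta>). (of_bool (\<zeta> k) - \<rho>) * g (x, \<zeta>))"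

lemma local_centred: 
  fixes g :: "'d::finite state \<Rightarrow> real"
  assumes "local_function g" shows "local_function (centred k g)"
proof -
  have "depends_on A g \<Longrightarrow> depends_on (insert k A) (centred k g)" for A
    unfolding centred_def depends_on_def[of "insert k _"] config_depends_on_def by (auto intro!: depends_onD)
  moreover have "position_support (centred k g) \<subseteq> position_support g"
    unfolding position_support_def centred_def by auto
  ultimately show ?thesis
    using assms unfolding local_function_iff by (meson finite_insert finite_subset)
qed

lemma pairing_bond_loss:
  fixes f g :: "'d::finite state \<Rightarrow> real"
  assumes "local_function f" "local_function g"
  shows "pairing \<rho> f (bond_loss p i j g) - pairing \<rho> (bond_loss (\<lambda>k. p (- k)) j i f) g
     = p (j - i) * (pairing \<rho> f (centred i g) - pairing \<rho> f (centred j g))"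
proof -
  have "pairing \<rho> (bond_loss (\<lambda>k. p (- k)) j i f) g = pairing \<rho> f (bond_loss (\<lambda>k. p (- k)) j i g)"
    unfolding pairing_def bond_loss_def by (simp add: mult_ac)
  moreover have "bond_loss p i j g z - bond_loss (\<lambda>k. p (- k)) j i g z = p (j - i) * (centred i g z - centred j g z)" for z
    by (cases z) (auto simp: bond_loss_def centred_def algebra_simps)
  ultimately show ?thesis
    using pairing_diff[OF assms(1) local_bond_loss[OF assms(2)] local_bond_loss[OF assms(2)], of p i j "\<lambda>k. p (- k)" j i]
      pairing_diff[OF assms(1) local_centred[OF assms(2)] local_centred[OF assms(2)], of i j]
    by (simp add: pairing_cmult)
qed

lemma pairing_tag_loss:
  fixes f g :: "'d::finite state \<Rightarrow> real"
  assumes "local_function f" "local_function g"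
  shows "pairing \<rho> f (tag_loss p j g) - pairing \<rho> (tag_loss (\<lambda>k. p (- k)) (- j) f) g
     = p j * (pairing \<rho> f (centred (- j) g) - pairing \<rho> f (centred j g))"
proof -
  have "pairing \<rho> (tag_loss (\<lambda>k. p (- k)) (- j) f) g = pairing \<rho> f (tag_loss (\<lambda>k. p (- k)) (- j) g)"
    unfolding pairing_def tag_loss_def by (simp add: mult_ac)
  moreover have "tag_loss p j g z - tag_loss (\<lambda>k. p (- k)) (- j) g z = p j * (centred (- j) g z - centred j g z)" for z
    by (cases z) (auto simp: tag_loss_def centred_def algebra_simps)
  ultimately show ?thesis
    using pairing_diff[OF assms(1) local_tag_loss[OF assms(2)] local_tag_loss[OF assms(2)], of p j "\<lambda>k. p (- k)" "- j"]
      pairing_diff[OF assms(1) local_centred[OF assms(2)] local_centred[OF assms(2)], of "- j" j]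
    by (simp add: pairing_cmult)
qed

lemma pairing_centred_eq_0:
  fixes f g :: "'d::finite state \<Rightarrow> real"
  assumes "finite A" "depends_on A f" "depends_on A g" "k \<notin> A" "k \<noteq> 0"
  shows "pairing \<rho> f (centred k g) = 0"
proof -
  have "(\<integral>\<zeta>. f (x, \<zeta>) * g (x, \<zeta>) * (of_bool (\<zeta> k) - \<rho>) \<partial>Q_measure \<rho>) = 0" for x
  proof (rule Q_integral_independent[OF \<rho> assms(1) _ assms(4,5)])
    show "config_depends_on A (\<lambda>\<zeta>. f (x, \<zeta>) * g (x, \<zeta>))"
      using assms(2,3) unfolding depends_on_def config_depends_on_def by metis
  qed
  then show ?thesis unfolding pairing_def centred_def by (simp add: mult_ac)
qed

end

context finite_range_rate
begin

lemma support_reverse: "uminus ` J = {j. p (- j) \<noteq> 0}"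
  by (force simp: image_iff)

lemma finite_rate_support_reverse: "finite {j. p (- j) \<noteq> 0}"
  unfolding support_reverse[symmetric] using finite_rate_support by simp

lemma finite_range_rate_reverse: "finite_range_rate (\<lambda>k. p (- k))"
  by standard (simp_all add: rate_nonneg rate_zero finite_rate_support_reverse)

text \<open>Here \<open>E k\<close> is the pairing of \<open>f\<close> with \<open>centred k g\<close>. Summed over all bonds of the lattice,
  \<open>p (j - i) * (E i - E j)\<close> would cancel, because every site has the same total rate of jumps out of
  it and into it. The bonds at the origin are excluded, which leaves \<open>(p i - p (- i)) * E i\<close> at each
  site \<open>i\<close>; the jumps of the tagged particle cancel exactly this.\<close>

lemma telescoping_rates:
  fixes E :: "int^'d \<Rightarrow> real"
  assumes B: "finite B" "0 \<notin> B" and E: "\<And>k. k \<noteq> 0 \<Longrightarrow> k \<notin> A \<Longrightarrow> E k = 0"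
    and BA: "\<And>a k. a \<in> A \<Longrightarrow> p k \<noteq> 0 \<Longrightarrow> a + k \<noteq> 0 \<Longrightarrow> a + k \<in> B"
            "\<And>a k. a \<in> A \<Longrightarrow> p k \<noteq> 0 \<Longrightarrow> a - k \<noteq> 0 \<Longrightarrow> a - k \<in> B"
            "\<And>a. a \<in> A \<Longrightarrow> a \<noteq> 0 \<Longrightarrow> a \<in> B"
  shows "(\<Sum>i\<in>B. \<Sum>j\<in>B. p (j - i) * (E i - E j)) + (\<Sum>j\<in>J. p j * (E (- j) - E j)) = 0"
proof -
  have J: "(\<Sum>k\<in>J - {l}. p k) = total_rate - p l" for l
    using finite_rate_support by (simp add: total_rate_def sum_diff1)
  have out: "(\<Sum>j\<in>B. p (j - i)) = total_rate - p (- i)" if "i \<in> A" "i \<noteq> 0" for i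
  proof -
    have "(\<Sum>j\<in>B. p (j - i)) = (\<Sum>k\<in>(\<lambda>j. j - i) ` B. p k)"
      by (subst sum.reindex) (auto simp: inj_on_def)
    also have "\<dots> = (\<Sum>k\<in>J - {- i}. p k)"
    proof (rule sum.mono_neutral_right)
      show "J - {- i} \<subseteq> (\<lambda>j. j - i) ` B"
      proof
        fix k assume "k \<in> J - {- i}"
        then have "i + k \<in> B" using BA(1)[OF that(1), of k] by (auto simp: add_eq_0_iff)
        then show "k \<in> (\<lambda>j. j - i) ` B" by (intro image_eqI[of _ _ "i + k"]) auto
      qed
    qed (use B in auto)
    finally show ?thesis using J by simp
  qed
  have inn: "(\<Sum>i\<in>B. p (j - i)) = total_rate - p j" if "j \<in> A" "j \<noteq> 0" for j
  proof -
    have "(\<Sum>i\<in>B. p (j - i)) = (\<Sum>k\<in>(\<lambda>i. j - i) ` B. p k)"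
      by (subst sum.reindex) (auto simp: inj_on_def)
    also have "\<dots> = (\<Sum>k\<in>J - {j}. p k)"
    proof (rule sum.mono_neutral_right)
      show "J - {j} \<subseteq> (\<lambda>i. j - i) ` B"
      proof
        fix k assume "k \<in> J - {j}"
        then have "j - k \<in> B" using BA(2)[OF that(1), of k] by auto
        then show "k \<in> (\<lambda>i. j - i) ` B" by (intro image_eqI[of _ _ "j - k"]) auto
      qed
    qed (use B in auto)
    finally show ?thesis using J by simp
  qed
  have E0: "E k = 0 \<or> k \<in> A \<and> k \<noteq> 0" if "k \<in> B" for k using that B(2) E by metis
  have 1: "(\<Sum>i\<in>B. \<Sum>j\<in>B. p (j - i) * E i) = (\<Sum>i\<in>B. (total_rate - p (- i)) * E i)"
    using E0 out by (intro sum.cong refl) (force simp flip: sum_distrib_right)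
  have 2: "(\<Sum>i\<in>B. \<Sum>j\<in>B. p (j - i) * E j) = (\<Sum>j\<in>B. (total_rate - p j) * E j)"
    using E0 inn by (subst sum.swap, intro sum.cong refl) (force simp flip: sum_distrib_right)
  have EB: "E k = 0" if "k \<notin> B" "p k \<noteq> 0 \<or> p (- k) \<noteq> 0" for k
    using that E[of k] BA(3)[of k] rate_zero by (cases "k = 0") auto
  have 3: "(\<Sum>j\<in>J. p j * E j) = (\<Sum>j\<in>B. p j * E j)"
    using B(1) finite_rate_support EB by (intro sum.mono_neutral_cong) auto
  have "(\<Sum>j\<in>J. p j * E (- j)) = (\<Sum>i\<in>uminus ` J. p (- i) * E i)"
    by (subst sum.reindex) auto
  also have "\<dots> = (\<Sum>i\<in>B. p (- i) * E i)"
    unfolding support_reverse using B(1) finite_rate_support_reverse EB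
    by (intro sum.mono_neutral_cong) auto
  finally have 4: "(\<Sum>j\<in>J. p j * E (- j)) = (\<Sum>i\<in>B. p (- i) * E i)" .
  show ?thesis
    by (simp add: right_diff_distrib sum_subtractf 1 2 3 4 left_diff_distrib)
qed

text \<open>The gain terms match one by one, a jump over a bond with its reversal. The loss terms do not match
  individually, but their differences telescope.\<close>

lemma generator_duality:
  fixes f g :: "'d state \<Rightarrow> real"
  assumes \<rho>: "0 < \<rho>" "\<rho> \<le> 1" and f: "local_function f" and g: "local_function g"
  shows "pairing \<rho> f (generator p g) = pairing \<rho> (generator (\<lambda>k. p (- k)) f) g"
proof -
  let ?q = "\<lambda>k. p (- k)"
  interpret q: finite_range_rate ?q by (rule finite_range_rate_reverse)
  obtain A1 A2 where "finite A1" "finite A2" "depends_on A1 f" "depends_on A2 g"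
    using f g unfolding local_function_iff by blast
  then obtain A where A: "finite A" "depends_on A f" "depends_on A g"
    using depends_on_mono[of A1 f "A1 \<union> A2"] depends_on_mono[of A2 g "A1 \<union> A2"] by (meson Un_upper1 Un_upper2 finite_UnI)
  let ?N = "insert 0 (J \<union> uminus ` J)"
  \<comment> \<open>one set of bonds \<open>B \<times> B\<close> that serves both generators and is symmetric under reversal of bonds\<close>
  define B where "B = (\<lambda>(a, k). a + k) ` (A \<times> ?N) - {0}"
  have B: "finite B" "0 \<notin> B" using A(1) finite_rate_support by (auto simp: B_def)
  have BA: "a + k \<in> B" if "a \<in> A" "k \<in> ?N" "a + k \<noteq> 0" for a k
    unfolding B_def using that by (auto intro!: image_eqI[of _ _ "(a, k)"])
  have inB: "a \<in> B" if "a \<in> A" "a \<noteq> 0" for a using BA[OF that(1), of 0] that by simp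
  have nb1: "a + k \<in> B" if "a \<in> A" "p k \<noteq> 0 \<or> p (- k) \<noteq> 0" "a + k \<noteq> 0" for a k
  proof -
    have "k \<in> ?N" using that(2) by (metis (mono_tags, lifting) UnI1 UnI2 image_eqI insertI2 mem_Collect_eq minus_minus)
    then show ?thesis using BA that by blast
  qed
  have nb2: "a - k \<in> B" if "a \<in> A" "p k \<noteq> 0 \<or> p (- k) \<noteq> 0" "a - k \<noteq> 0" for a k
    using nb1[of a "- k"] that by auto
  have cover: "i \<in> B \<and> j \<in> B" if "i \<noteq> 0" "j \<noteq> 0" "p (j - i) \<noteq> 0 \<or> p (- (j - i)) \<noteq> 0" "i \<in> A \<or> j \<in> A" for i j
    using that inB nb1[of i "j - i"] nb2[of j "j - i"] by auto
  have D: "covers_bonds A (B \<times> B)" "q.covers_bonds A (B \<times> B)"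
    unfolding covers_bonds_def q.covers_bonds_def using B cover by auto
  define E where "E k = pairing \<rho> f (centred \<rho> k g)" for k
  note loc = local_function_add local_function_sum local_function_diff local_bond_gain local_bond_loss
        local_tag_gain local_tag_loss f g
  have "pairing \<rho> f (generator p g) = pairing \<rho> f (\<lambda>z.
        (\<Sum>b\<in>B \<times> B. bond_gain p (fst b) (snd b) g z - bond_loss p (fst b) (snd b) g z)
      + (\<Sum>j\<in>J. tag_gain p j g z - tag_loss p j g z))"
    by (simp add: generator_eq_finite_sum[OF A(3) D(1), abs_def] split_beta')
  also have "\<dots> = (\<Sum>b\<in>B \<times> B. pairing \<rho> f (bond_gain p (fst b) (snd b) g) - pairing \<rho> f (bond_loss p (fst b) (snd b) g))
      + (\<Sum>j\<in>J. pairing \<rho> f (tag_gain p j g) - pairing \<rho> f (tag_loss p j g))"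
    by (simp add: pairing_add[OF \<rho>] pairing_sum[OF \<rho>] pairing_diff[OF \<rho>] loc)
  finally have L: "pairing \<rho> f (generator p g) = \<dots>" .
  have "pairing \<rho> g (generator ?q f) = pairing \<rho> g (\<lambda>z.
        (\<Sum>b\<in>B \<times> B. bond_gain ?q (fst b) (snd b) f z - bond_loss ?q (fst b) (snd b) f z)
      + (\<Sum>j\<in>{j. p (- j) \<noteq> 0}. tag_gain ?q j f z - tag_loss ?q j f z))"
    by (simp add: q.generator_eq_finite_sum[OF A(2) D(2), abs_def] split_beta')
  also have "\<dots> = (\<Sum>b\<in>B \<times> B. pairing \<rho> g (bond_gain ?q (fst b) (snd b) f) - pairing \<rho> g (bond_loss ?q (fst b) (snd b) f))
      + (\<Sum>j\<in>{j. p (- j) \<noteq> 0}. pairing \<rho> g (tag_gain ?q j f) - pairing \<rho> g (tag_loss ?q j f))"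
    by (simp add: pairing_add[OF \<rho>] pairing_sum[OF \<rho>] pairing_diff[OF \<rho>] loc)
  also have "(\<Sum>b\<in>B \<times> B. pairing \<rho> g (bond_gain ?q (fst b) (snd b) f) - pairing \<rho> g (bond_loss ?q (fst b) (snd b) f))
     = (\<Sum>b\<in>B \<times> B. pairing \<rho> g (bond_gain ?q (snd b) (fst b) f) - pairing \<rho> g (bond_loss ?q (snd b) (fst b) f))"
    by (rule sum.reindex_bij_witness[of _ prod.swap prod.swap]) auto
  also have "(\<Sum>j\<in>{j. p (- j) \<noteq> 0}. pairing \<rho> g (tag_gain ?q j f) - pairing \<rho> g (tag_loss ?q j f))
     = (\<Sum>j\<in>J. pairing \<rho> g (tag_gain ?q (- j) f) - pairing \<rho> g (tag_loss ?q (- j) f))"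
    by (rule sum.reindex_bij_witness[of _ uminus uminus]) auto
  finally have R: "pairing \<rho> (generator ?q f) g =
     (\<Sum>b\<in>B \<times> B. pairing \<rho> g (bond_gain ?q (snd b) (fst b) f) - pairing \<rho> g (bond_loss ?q (snd b) (fst b) f))
     + (\<Sum>j\<in>J. pairing \<rho> g (tag_gain ?q (- j) f) - pairing \<rho> g (tag_loss ?q (- j) f))"
    by (simp only: pairing_commute[of \<rho> g])
  have "pairing \<rho> (generator ?q f) g - pairing \<rho> f (generator p g) =
      (\<Sum>b\<in>B \<times> B. p (snd b - fst b) * (E (fst b) - E (snd b))) + (\<Sum>j\<in>J. p j * (E (- j) - E j))"
    unfolding L R add_diff_add sum_subtractf[symmetric]
  proof (intro arg_cong2[where f="(+)"] sum.cong refl)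
    fix b assume "b \<in> B \<times> B"
    then have "fst b \<noteq> 0" "snd b \<noteq> 0" using B(2) by auto
    then show "pairing \<rho> g (bond_gain ?q (snd b) (fst b) f) - pairing \<rho> g (bond_loss ?q (snd b) (fst b) f) -
        (pairing \<rho> f (bond_gain p (fst b) (snd b) g) - pairing \<rho> f (bond_loss p (fst b) (snd b) g)) =
        p (snd b - fst b) * (E (fst b) - E (snd b))"
      using pairing_bond_gain[OF \<rho> f g, of "fst b" "snd b" p] pairing_bond_loss[OF \<rho> f g, of p "fst b" "snd b"]
      unfolding E_def pairing_commute[of \<rho> g] by linarith
  next
    fix j assume "j \<in> J"
    then have "j \<noteq> 0" using rate_zero by auto
    then show "pairing \<rho> g (tag_gain ?q (- j) f) - pairing \<rho> g (tag_loss ?q (- j) f) -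
        (pairing \<rho> f (tag_gain p j g) - pairing \<rho> f (tag_loss p j g)) = p j * (E (- j) - E j)"
      using pairing_tag_gain[OF \<rho> f g, of j p] pairing_tag_loss[OF \<rho> f g, of p j]
      unfolding E_def pairing_commute[of \<rho> g] by linarith
  qed
  also have "(\<Sum>b\<in>B \<times> B. p (snd b - fst b) * (E (fst b) - E (snd b))) = (\<Sum>i\<in>B. \<Sum>j\<in>B. p (j - i) * (E i - E j))"
    by (simp add: sum.cartesian_product split_beta')
  also have "\<dots> + (\<Sum>j\<in>J. p j * (E (- j) - E j)) = 0"
    using A nb1 nb2 inB
    by (intro telescoping_rates[OF B, of A]) (auto simp: E_def intro: pairing_centred_eq_0[OF \<rho>])
  finally show ?thesis by simp
qed

lemma generator_power_duality:
  fixes f g :: "'d state \<Rightarrow> real"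
  assumes \<rho>: "0 < \<rho>" "\<rho> \<le> 1" and f: "local_function f" and g: "local_function g"
  shows "pairing \<rho> f ((generator p ^^ n) g) = pairing \<rho> ((generator (\<lambda>k. p (- k)) ^^ n) f) g"
  using g
proof (induction n arbitrary: g)
  case (Suc n)
  interpret q: finite_range_rate "\<lambda>k. p (- k)" by (rule finite_range_rate_reverse)
  have "pairing \<rho> f ((generator p ^^ Suc n) g) = pairing \<rho> f ((generator p ^^ n) (generator p g))"
    by (simp add: funpow_swap1)
  also have "\<dots> = pairing \<rho> ((generator (\<lambda>k. p (- k)) ^^ n) f) (generator p g)"
    by (rule Suc.IH[OF local_generator[OF Suc.prems]])
  also have "\<dots> = pairing \<rho> (generator (\<lambda>k. p (- k)) ((generator (\<lambda>k. p (- k)) ^^ n) f)) g"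
    by (rule generator_duality[OF \<rho> q.local_generator_power[OF f] Suc.prems])
  finally show ?case by simp
qed simp

end

text \<open>The reflection intertwines the generators of the process and of its reversal.\<close>

definition reflect :: "('d::finite state \<Rightarrow> real) \<Rightarrow> 'd state \<Rightarrow> real" where
  "reflect f = (\<lambda>(x, \<zeta>). f (- x, \<lambda>i. \<zeta> (- i)))"

definition translate :: "int^'d \<Rightarrow> ('d::finite state \<Rightarrow> real) \<Rightarrow> 'd state \<Rightarrow> real" where
  "translate a f = (\<lambda>(x, \<zeta>). f (x + a, \<zeta>))"

lemma generator_translate: "generator p (translate a f) = translate a (generator p f)"
  by (rule ext) (simp add: generator_def translate_def split_beta' add_ac)

lemma exchange_reflect: "(\<lambda>l. exchange (- i) (- j) \<zeta> (- l)) = exchange i j (\<lambda>l. \<zeta> (- l))"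
  by (auto simp: exchange_def fun_eq_iff)

lemma tagged_jump_reflect: "(\<lambda>l. tagged_jump (- j) \<zeta> (- l)) = tagged_jump j (\<lambda>l. \<zeta> (- l))"
proof
  fix l
  have "- j + - l = - (j + l)" by simp
  then show "tagged_jump (- j) \<zeta> (- l) = tagged_jump j (\<lambda>l. \<zeta> (- l)) l"
    unfolding tagged_jump_def shift_def using exchange_reflect[of 0 j \<zeta>] by (metis neg_0_equal_iff_equal)
qed

lemma generator_reflect: "generator (\<lambda>k. p (- k)) (reflect f) = reflect (generator p f)"
proof
  fix z :: "'a state"
  obtain x \<zeta> where z: "z = (x, \<zeta>)" by (cases z)
  have "(\<Sum>\<^sub>\<infinity>(i, j)\<in>(- {0}) \<times> (- {0}). of_bool (\<zeta> i) * (1 - of_bool (\<zeta> j)) * p (- (j - i)) *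
          (f (- x, \<lambda>l. exchange i j \<zeta> (- l)) - f (- x, \<lambda>l. \<zeta> (- l))))
     = (\<Sum>\<^sub>\<infinity>(i, j)\<in>(- {0}) \<times> (- {0}). of_bool (\<zeta> (- i)) * (1 - of_bool (\<zeta> (- j))) * p (j - i) *
          (f (- x, exchange i j (\<lambda>l. \<zeta> (- l))) - f (- x, \<lambda>l. \<zeta> (- l))))"
    by (rule infsum_reindex_bij_witness[of _ "\<lambda>(i, j). (- i, - j)" "\<lambda>(i, j). (- i, - j)"])
      (auto simp: exchange_reflect[symmetric])
  moreover have "(\<Sum>\<^sub>\<infinity>j\<in>- {0}. (1 - of_bool (\<zeta> j)) * p (- j) *
          (f (- (x + j), \<lambda>l. tagged_jump j \<zeta> (- l)) - f (- x, \<lambda>l. \<zeta> (- l))))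
     = (\<Sum>\<^sub>\<infinity>j\<in>- {0}. (1 - of_bool (\<zeta> (- j))) * p j *
          (f (- x + j, tagged_jump j (\<lambda>l. \<zeta> (- l))) - f (- x, \<lambda>l. \<zeta> (- l))))"
    by (rule infsum_reindex_bij_witness[of _ uminus uminus])
      (auto simp: tagged_jump_reflect[symmetric])
  ultimately show "generator (\<lambda>k. p (- k)) (reflect f) z = reflect (generator p f) z"
    by (simp add: z generator_def reflect_def)
qed

definition at_site :: "int^'d \<Rightarrow> 'd::finite state \<Rightarrow> real" where
  "at_site a = (\<lambda>(x, \<zeta>). of_bool (x = a))"

definition at_site_occupied :: "int^'d \<Rightarrow> int^'d \<Rightarrow> 'd::finite state \<Rightarrow> real" where
  "at_site_occupied a j = (\<lambda>(x, \<zeta>). of_bool (x = a) * of_bool (\<zeta> j))"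

lemma local_at_site: "local_function (at_site a)"
  unfolding local_function_def at_site_def by (auto intro: exI[of _ "{}"])

lemma local_at_site_occupied: "local_function (at_site_occupied a j)"
proof -
  have "finite {x. \<exists>\<zeta>. at_site_occupied a j (x, \<zeta>) \<noteq> 0}"
    by (rule finite_subset[of _ "{a}"]) (auto simp: at_site_occupied_def)
  then show ?thesis
    unfolding local_function_def by (auto intro!: exI[of _ "{j}"] simp: at_site_occupied_def)
qed

text \<open>Both sides are values of the same pairing: on the left the generator acts on the event at the final
  time, on the right on the indicator of the starting position. The reversed generator acting there is
  turned into the original one by a reflection, and the starting point is moved from \<open>a\<close> to the
  origin by a translation.\<close>

lemma (in finite_range_rate) generator_power_reversal:
  assumes \<rho>: "0 < \<rho>" "\<rho> \<le> 1"
  shows "(\<integral>\<zeta>. (generator p ^^ n) (at_site_occupied a j) (0, \<zeta>) \<partial>Q_measure \<rho>)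
    = (\<integral>\<zeta>. of_bool (\<zeta> (- j)) * (generator p ^^ n) (at_site a) (0, \<zeta>) \<partial>Q_measure \<rho>)"
proof -
  let ?q = "\<lambda>k. p (- k)"
  let ?u = "(generator p ^^ n) (at_site a)"
  have r: "(generator ?q ^^ n) (reflect f) = reflect ((generator p ^^ n) f)" for f :: "'d state \<Rightarrow> real"
    by (induction n) (simp_all add: generator_reflect)
  have t: "(generator p ^^ n) (translate b f) = translate b ((generator p ^^ n) f)" for b and f :: "'d state \<Rightarrow> real"
    by (induction n) (simp_all add: generator_translate)
  have "at_site 0 = reflect (translate a (at_site a))"
    by (auto simp: at_site_def reflect_def translate_def fun_eq_iff)
  then have u: "(generator ?q ^^ n) (at_site 0) = reflect (translate a ?u)"
    by (simp add: r t)
  have "pairing \<rho> (at_site 0) ((generator p ^^ n) (at_site_occupied a j))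
      = (\<integral>\<zeta>. (generator p ^^ n) (at_site_occupied a j) (0, \<zeta>) \<partial>Q_measure \<rho>)"
    by (subst pairing_eq_sum[of "{0}"]) (auto simp: position_support_def at_site_def)
  moreover have "pairing \<rho> (reflect (translate a ?u)) (at_site_occupied a j)
      = (\<integral>\<zeta>. ?u (0, \<lambda>i. \<zeta> (- i)) * of_bool (\<zeta> j) \<partial>Q_measure \<rho>)"
    by (subst pairing_commute, subst pairing_eq_sum[of "{a}"])
      (auto simp: position_support_def at_site_occupied_def reflect_def translate_def mult_ac)
  moreover have "(\<integral>\<zeta>. ?u (0, \<lambda>i. \<zeta> (- i)) * of_bool (\<zeta> j) \<partial>Q_measure \<rho>)
      = (\<integral>\<zeta>. ?u (0, \<zeta>) * of_bool (\<zeta> (- j)) \<partial>Q_measure \<rho>)"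
    using Q_integral_reflect[OF \<rho>, of "\<lambda>\<zeta>. ?u (0, \<zeta>) * of_bool (\<zeta> (- j))"]
      local_function_measurable_section[OF local_generator_power[OF local_at_site]] by simp
  ultimately show ?thesis
    using generator_power_duality[OF \<rho> local_at_site local_at_site_occupied, of 0 n a j] u
    by (simp add: mult.commute)
qed

section \<open>Differential inequalities and analytic uniqueness\<close>

lemma derivative_comparison:
  fixes g h :: "real \<Rightarrow> real"
  assumes "a \<le> b"
    and g: "\<And>u. u \<in> {a..b} \<Longrightarrow> (g has_real_derivative g' u) (at u within {a..b})"
    and h: "\<And>u. u \<in> {a..b} \<Longrightarrow> (h has_real_derivative h' u) (at u within {a..b})"
    and le: "\<And>u. u \<in> {a..b} \<Longrightarrow> g' u \<le> h' u"
  shows "g b - g a \<le> h b - h a"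
proof (rule has_integral_le)
  show "(g' has_integral g b - g a) {a..b}" "(h' has_integral h b - h a) {a..b}"
    using g h assms(1) by (auto intro!: fundamental_theorem_of_calculus simp: has_real_derivative_iff_has_vector_derivative)
qed (use le in auto)

text \<open>Taylor's formula of order \<open>m\<close> at \<open>s\<close> leaves a remainder of at most a constant times
  \<open>binomial (n + m) m * (K (t - s))^m\<close>. As the binomial coefficient is at most \<open>2^(n + m)\<close>,
  a time step of \<open>1 / (4 K)\<close> makes it tend to 0.\<close>

lemma analytic_step:
  fixes F :: "nat \<Rightarrow> real \<Rightarrow> real"
  assumes der: "\<And>n t. 0 \<le> t \<Longrightarrow> (F n has_real_derivative F (Suc n) t) (at t within {0..})"
    and bd: "\<And>n t. 0 \<le> t \<Longrightarrow> \<bar>F n t\<bar> \<le> c * K ^ n * fact n"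
    and K: "0 \<le> c" "0 < K"
    and s: "0 \<le> s" "\<And>n. F n s = 0" and t: "s \<le> t" "t \<le> s + 1 / (4 * K)"
  shows "F n t = 0"
proof -
  have taylor: "\<bar>F n t\<bar> \<le> c * K ^ (n + m) * (fact (n + m) / fact m) * (t - s) ^ m" if "s \<le> t" for n m t
    using that
  proof (induction m arbitrary: n t)
    case 0
    then show ?case using bd[of t n] s by simp
  next
    case (Suc m)
    let ?C = "c * K ^ (Suc n + m) * (fact (Suc n + m) / fact m)"
    let ?h = "\<lambda>u. ?C * ((u - s) ^ Suc m / Suc m)"
    have dh: "(?h has_real_derivative ?C * (u - s) ^ m) (at u within {s..t})" for u
      by (rule derivative_eq_intros refl | simp)+
    have dF: "(F n has_real_derivative F (Suc n) u) (at u within {s..t})" if "u \<in> {s..t}" for u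
      using that s by (intro DERIV_subset[OF der]) auto
    have le: "\<bar>F (Suc n) u\<bar> \<le> ?C * (u - s) ^ m" if "u \<in> {s..t}" for u
      using Suc.IH[of u "Suc n"] that by simp
    have 1: "F n t - F n s \<le> ?h t - ?h s"
      by (rule derivative_comparison[OF Suc.prems dF dh]) (use le in \<open>auto simp: abs_le_iff\<close>)
    have dF': "((\<lambda>u. - F n u) has_real_derivative - F (Suc n) u) (at u within {s..t})" if "u \<in> {s..t}" for u
      by (rule DERIV_minus[OF dF[OF that]])
    have 2: "- F n t - - F n s \<le> ?h t - ?h s"
      by (rule derivative_comparison[OF Suc.prems dF' dh]) (use le in \<open>auto simp: abs_le_iff\<close>)
    have "?h t = c * K ^ (n + Suc m) * (fact (n + Suc m) / fact (Suc m)) * (t - s) ^ Suc m"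
      by (simp add: field_simps)
    moreover have "?h s = 0" by simp
    ultimately show ?case using 1 2 s(2)[of n] by linarith
  qed
  have "\<bar>F n t\<bar> \<le> c * K ^ n * fact n * 2 ^ n * (1 / 2) ^ m" for m
  proof -
    have "fact (n + m) / fact m = (of_nat ((n + m) choose m) * fact n :: real)"
      by (simp add: binomial_fact)
    also have "\<dots> \<le> 2 ^ (n + m) * fact n"
    proof -
      have "(n + m) choose m \<le> 2 ^ (n + m)" by (rule binomial_le_pow2)
      then have "real ((n + m) choose m) \<le> real (2 ^ (n + m))" by (rule of_nat_mono)
      then show ?thesis by (intro mult_right_mono) simp_all
    qed
    finally have f: "(fact (n + m) / fact m :: real) \<le> 2 ^ (n + m) * fact n" .
    have quarter: "(1 / 4 :: real) ^ m = (1 / 2) ^ m * (1 / 2) ^ m"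
      unfolding power_mult_distrib[symmetric] by simp
    have half: "(2 :: real) ^ m * (1 / 2) ^ m = 1"
      unfolding power_mult_distrib[symmetric] by simp
    have d: "K * (t - s) \<le> 1 / 4" "0 \<le> K * (t - s)" using t K by (auto simp: field_simps)
    have "\<bar>F n t\<bar> \<le> c * K ^ (n + m) * (fact (n + m) / fact m) * (t - s) ^ m"
      by (rule taylor[OF t(1)])
    also have "\<dots> = (c * K ^ n) * (fact (n + m) / fact m) * (K * (t - s)) ^ m"
      by (simp add: power_add power_mult_distrib)
    also have "\<dots> \<le> (c * K ^ n) * (2 ^ (n + m) * fact n) * (1 / 4) ^ m"
      using K d by (intro mult_mono mult_left_mono power_mono f) auto
    also have "\<dots> = (c * K ^ n * fact n * 2 ^ n * (1 / 2) ^ m) * (2 ^ m * (1 / 2) ^ m)"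
      unfolding quarter power_add by (simp only: mult_ac)
    finally show ?thesis unfolding half by simp
  qed
  moreover have "(\<lambda>m. c * K ^ n * fact n * 2 ^ n * (1 / 2) ^ m) \<longlonglongrightarrow> c * K ^ n * fact n * 2 ^ n * 0"
    by (intro tendsto_intros LIMSEQ_power_zero) auto
  ultimately have "\<bar>F n t\<bar> \<le> c * K ^ n * fact n * 2 ^ n * 0"
    by (intro LIMSEQ_le_const) auto
  then show ?thesis by simp
qed

text \<open>The bound on the derivatives is uniform in time, so the step of fixed length can be repeated.\<close>

lemma analytic_uniqueness:
  fixes F :: "nat \<Rightarrow> real \<Rightarrow> real"
  assumes der: "\<And>n t. 0 \<le> t \<Longrightarrow> (F n has_real_derivative F (Suc n) t) (at t within {0..})"
    and bd: "\<And>n t. 0 \<le> t \<Longrightarrow> \<bar>F n t\<bar> \<le> c * K ^ n * fact n"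
    and K: "0 \<le> c" "0 < K" and zero: "\<And>n. F n 0 = 0" and t: "0 \<le> t"
  shows "F n t = 0"
proof -
  let ?d = "1 / (4 * K)"
  have d: "0 < ?d" using K by simp
  have all: "\<forall>n. \<forall>t\<in>{0..real m * ?d}. F n t = 0" for m
  proof (induction m)
    case (Suc m)
    show ?case
    proof (intro allI ballI)
      fix n t assume t: "t \<in> {0..real (Suc m) * ?d}"
      show "F n t = 0"
      proof (cases "t \<le> real m * ?d")
        case True
        then show ?thesis using Suc t by auto
      next
        case False
        show ?thesis
        proof (rule analytic_step[where s="real m * ?d" and F=F, OF der bd K])
          show "F n (real m * ?d) = 0" for n using Suc d by auto
        qed (use False t d in \<open>auto simp: distrib_right add_divide_distrib\<close>)
      qed
    qed
  qed (use zero in simp)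
  obtain m where "t / ?d \<le> real m" using real_arch_simple by blast
  then have "t \<le> real m * ?d" using K by (simp add: field_simps)
  then show ?thesis using all t by auto
qed

text \<open>A uniform bound on the error of the right difference quotients suffices for two-sided
  differentiability once the candidate derivative is itself continuous.\<close>

lemma uniform_right_derivative:
  fixes F G H :: "real \<Rightarrow> real"
  assumes F: "\<And>e. 0 < e \<Longrightarrow> \<exists>d>0. \<forall>h s. 0 < h \<longrightarrow> h < d \<longrightarrow> 0 \<le> s \<longrightarrow> \<bar>(F (s + h) - F s) / h - G s\<bar> \<le> e"
    and G: "\<And>e. 0 < e \<Longrightarrow> \<exists>d>0. \<forall>h s. 0 < h \<longrightarrow> h < d \<longrightarrow> 0 \<le> s \<longrightarrow> \<bar>(G (s + h) - G s) / h - H s\<bar> \<le> e"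
    and H: "\<And>s. 0 \<le> s \<Longrightarrow> \<bar>H s\<bar> \<le> B" and t: "0 \<le> t"
  shows "(F has_real_derivative G t) (at t within {0..})"
  unfolding has_field_derivative_iff Lim_within
proof (intro allI impI)
  fix e :: real assume e: "0 < e"
  have B: "0 \<le> B" using H[of 0] by simp
  obtain d1 where d1: "0 < d1" "\<And>h s. 0 < h \<Longrightarrow> h < d1 \<Longrightarrow> 0 \<le> s \<Longrightarrow> \<bar>(F (s + h) - F s) / h - G s\<bar> \<le> e / 3"
    using F[of "e / 3"] e by auto
  obtain d2 where d2: "0 < d2" "\<And>h s. 0 < h \<Longrightarrow> h < d2 \<Longrightarrow> 0 \<le> s \<Longrightarrow> \<bar>(G (s + h) - G s) / h - H s\<bar> \<le> 1"
    using G[of 1] by auto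
  let ?d = "min d1 (min d2 (e / (3 * (B + 1))))"
  have "dist ((F y - F t) / (y - t)) (G t) < e" if y: "0 \<le> y" "0 < dist y t" "dist y t < ?d" for y
  proof (cases "t < y")
    case True
    then have "\<bar>(F (t + (y - t)) - F t) / (y - t) - G t\<bar> \<le> e / 3"
      using y t by (intro d1(2)) (auto simp: dist_real_def)
    then show ?thesis using e by (simp add: dist_real_def)
  next
    case False
    define h where "h = t - y"
    have h: "0 < h" "h < d1" "h < d2" "h * (B + 1) < e / 3" "t = y + h"
      using False y B by (auto simp: dist_real_def h_def field_simps)
    have 1: "\<bar>(F (y + h) - F y) / h - G y\<bar> \<le> e / 3" by (rule d1(2)) (use h y in auto)
    have "\<bar>(G (y + h) - G y) / h\<bar> \<le> B + 1"
      using d2(2)[OF h(1,3) y(1)] H[OF y(1)] by linarith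
    then have "\<bar>G (y + h) - G y\<bar> \<le> h * (B + 1)"
      using h(1) by (simp add: abs_divide pos_divide_le_eq mult.commute)
    then have "\<bar>(F (y + h) - F y) / h - G (y + h)\<bar> < e"
      using 1 h(4) e by linarith
    moreover have "(F y - F t) / (y - t) = (F (y + h) - F y) / h"
      using h by (simp add: field_simps)
    ultimately show ?thesis by (simp add: dist_real_def h(5))
  qed
  moreover have "0 < ?d" using d1(1) d2(1) e B by simp
  ultimately show "\<exists>d>0. \<forall>y\<in>{0..}. 0 < dist y t \<and> dist y t < d \<longrightarrow> dist ((F y - F t) / (y - t)) (G t) < e"
    by (intro exI[of _ ?d]) auto
qed

section \<open>The forward equation\<close>

text \<open>The expectation of a conditional probability is the probability, here given the past up to \<open>s\<close>.\<close>

lemma (in prob_space) markov_process_transition: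
  assumes markov: "markov_process M K X S" and s: "0 \<le> s" "0 \<le> h" and A: "A \<in> sets K"
    and meas: "(\<lambda>z. measure (S h z) A) \<in> borel_measurable K"
  shows "measure M (X (s + h) -` A \<inter> space M) = (\<integral>\<omega>. measure (S h (X s \<omega>)) A \<partial>M)"
proof -
  let ?F = "past M K X s" and ?E = "X (s + h) -` A \<inter> space M"
  have X: "\<And>t. 0 \<le> t \<Longrightarrow> X t \<in> M \<rightarrow>\<^sub>M K"
    and ce: "AE \<omega> in M. real_cond_exp M ?F (indicator ?E) \<omega> = measure (S h (X s \<omega>)) A"
    using markov s A unfolding markov_process_def by blast+
  have E: "?E \<in> sets M" using measurable_sets[OF X A] s by simp
  have gen: "(\<Union>u\<in>{0..s}. {X u -` A \<inter> space M | A. A \<in> sets K}) \<subseteq> sets M"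
    using measurable_sets[OF X] by auto
  then have "(\<Union>u\<in>{0..s}. {X u -` A \<inter> space M | A. A \<in> sets K}) \<subseteq> Pow (space M)"
    using sets.sets_into_space by blast
  then have "subalgebra M ?F"
    unfolding subalgebra_def past_def using sets.sigma_sets_subset[OF gen] by simp
  then interpret F: finite_measure_subalgebra M ?F
    by unfold_locales
  have int: "integrable M (indicator ?E :: _ \<Rightarrow> real)"
    using E by (simp add: emeasure_eq_measure)
  have "measure M ?E = (\<integral>\<omega>. real_cond_exp M ?F (indicator ?E) \<omega> \<partial>M)"
    using F.real_cond_exp_int(2)[OF int] E by simp
  also have "\<dots> = (\<integral>\<omega>. measure (S h (X s \<omega>)) A \<partial>M)"
    using ce measurable_compose[OF X[OF s(1)] meas]
    by (intro integral_cong_AE) auto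
  finally show ?thesis .
qed

lemma (in finite_measure) integral_finite_range:
  fixes f :: "'a \<Rightarrow> real"
  assumes f: "f \<in> borel_measurable M" "finite R" "range f \<subseteq> R"
  shows "(\<integral>z. f z \<partial>M) = (\<Sum>c\<in>R. c * measure M (f -` {c} \<inter> space M))"
proof -
  have sets: "f -` {c} \<inter> space M \<in> sets M" for c using f(1) by (rule measurable_sets) simp
  have "(\<integral>z. f z \<partial>M) = (\<integral>z. (\<Sum>c\<in>R. c * indicator (f -` {c} \<inter> space M) z) \<partial>M)"
  proof (rule Bochner_Integration.integral_cong)
    fix z assume "z \<in> space M"
    then have "(\<Sum>c\<in>R. c * indicator (f -` {c} \<inter> space M) z) = (\<Sum>c\<in>R. if c = f z then c else 0)"
      by (intro sum.cong) (auto simp: indicator_def)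
    also have "\<dots> = f z" using f(2,3) by (auto simp: sum.delta')
    finally show "f z = (\<Sum>c\<in>R. c * indicator (f -` {c} \<inter> space M) z)" by simp
  qed simp
  also have "\<dots> = (\<Sum>c\<in>R. c * measure M (f -` {c} \<inter> space M))"
    using sets by (subst Bochner_Integration.integral_sum) (auto simp: emeasure_eq_measure)
  finally show ?thesis .
qed

lemma (in prob_space) markov_process_expectation:
  fixes X :: "real \<Rightarrow> 'a \<Rightarrow> 'd::finite state"
  assumes markov: "markov_process M state_space X S" and s: "0 \<le> s" "0 \<le> h"
    and S: "S h \<in> state_space \<rightarrow>\<^sub>M prob_algebra state_space" and f: "local_function f"
  shows "(\<integral>\<omega>. f (X (s + h) \<omega>) \<partial>M) = (\<integral>\<omega>. (\<integral>w. f w \<partial>S h (X s \<omega>)) \<partial>M)"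
    and "(\<lambda>\<omega>. \<integral>w. f w \<partial>S h (X s \<omega>)) \<in> borel_measurable M"
proof -
  let ?R = "range f"
  have X: "\<And>t. 0 \<le> t \<Longrightarrow> X t \<in> M \<rightarrow>\<^sub>M state_space"
    using markov unfolding markov_process_def by blast
  have fin: "finite ?R" by (rule local_function_finite_range[OF f])
  have fm: "f \<in> borel_measurable state_space" by (rule local_function_measurable[OF f])
  have sets: "f -` {c} \<in> sets state_space" for c using measurable_sets[OF fm, of "{c}"] by simp
  have Sz: "prob_space (S h z)" "sets (S h z) = sets state_space" for z
    using measurable_space[OF S, of z] by (auto simp: space_prob_algebra)
  have spz: "space (S h z) = UNIV" for z using sets_eq_imp_space_eq[OF Sz(2)] by simp
  have meas: "(\<lambda>z. measure (S h z) (f -` {c})) \<in> borel_measurable state_space" for c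
    using measurable_compose[OF S measurable_measure_prob_algebra[OF sets]] by simp
  have inner: "(\<integral>w. f w \<partial>S h z) = (\<Sum>c\<in>?R. c * measure (S h z) (f -` {c}))" for z
  proof -
    have "f \<in> borel_measurable (S h z)" using fm Sz(2) by (simp cong: measurable_cong_sets)
    then show ?thesis
      using finite_measure.integral_finite_range[OF prob_space.axioms(1)[OF Sz(1)] _ fin order_refl] by (simp add: spz)
  qed
  show "(\<lambda>\<omega>. \<integral>w. f w \<partial>S h (X s \<omega>)) \<in> borel_measurable M"
    unfolding inner using measurable_compose[OF X[OF s(1)] meas] by simp
  have int: "integrable M (\<lambda>\<omega>. measure (S h (X s \<omega>)) (f -` {c}))" for c
    using measurable_compose[OF X[OF s(1)] meas] Sz(1)
    by (intro integrable_const_bound[where B=1]) (auto simp: prob_space.prob_le_1)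
  have "(\<integral>\<omega>. f (X (s + h) \<omega>) \<partial>M) = (\<Sum>c\<in>?R. c * measure M ((\<lambda>\<omega>. f (X (s + h) \<omega>)) -` {c} \<inter> space M))"
    using s by (intro integral_finite_range measurable_compose[OF X fm] fin) auto
  also have "\<dots> = (\<Sum>c\<in>?R. c * (\<integral>\<omega>. measure (S h (X s \<omega>)) (f -` {c}) \<partial>M))"
    using markov_process_transition[OF markov s sets meas] by (simp add: vimage_def)
  also have "\<dots> = (\<integral>\<omega>. (\<integral>w. f w \<partial>S h (X s \<omega>)) \<partial>M)"
    unfolding inner using int by (subst Bochner_Integration.integral_sum) auto
  finally show "(\<integral>\<omega>. f (X (s + h) \<omega>) \<partial>M) = (\<integral>\<omega>. (\<integral>w. f w \<partial>S h (X s \<omega>)) \<partial>M)" .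
qed

lemma (in prob_space) abs_expectation_le:
  fixes f :: "'a \<Rightarrow> real"
  assumes "f \<in> borel_measurable M" "\<And>\<omega>. \<omega> \<in> space M \<Longrightarrow> \<bar>f \<omega>\<bar> \<le> B"
  shows "\<bar>\<integral>\<omega>. f \<omega> \<partial>M\<bar> \<le> B"
proof -
  have int: "integrable M f" using assms by (intro integrable_const_bound[where B=B]) auto
  have "\<bar>\<integral>\<omega>. f \<omega> \<partial>M\<bar> \<le> (\<integral>\<omega>. \<bar>f \<omega>\<bar> \<partial>M)" by (rule integral_abs_bound)
  also have "\<dots> \<le> B" using int assms(2) by (intro integral_le_const) auto
  finally show ?thesis .
qed

text \<open>The properties of the laws at fixed times from which the moments of the position and the time
  reversal are derived.\<close>

locale forward_process = finite_range_rate p + prob_space M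
  for p :: "int^'d::finite \<Rightarrow> real" and M :: "'w measure" +
  fixes X :: "real \<Rightarrow> 'w \<Rightarrow> 'd state"
  assumes state_measurable: "0 \<le> t \<Longrightarrow> X t \<in> M \<rightarrow>\<^sub>M state_space"
    and start_origin: "AE \<omega> in M. fst (X 0 \<omega>) = 0"
    and forward_equation: "local_function f \<Longrightarrow> 0 \<le> t \<Longrightarrow>
      ((\<lambda>s. \<integral>\<omega>. f (X s \<omega>) \<partial>M) has_real_derivative (\<integral>\<omega>. generator p f (X t \<omega>) \<partial>M)) (at t within {0..})"

text \<open>The generator is a uniform limit of difference quotients over all states, so the error of the
  right difference quotient of an expectation is uniform over all times. The generator of a local
  function is local again, which gives the continuity of the candidate derivative.\<close>

lemma markov_process_forward:
  fixes X :: "real \<Rightarrow> 'w \<Rightarrow> 'd::finite state"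
  assumes p: "finite_range_rate p" and S: "tagged_transition p S"
    and markov: "markov_process M state_space X S" and start: "AE \<omega> in M. fst (X 0 \<omega>) = 0"
  shows "forward_process p M X"
proof -
  interpret p: finite_range_rate p by (rule p)
  interpret prob_space M using markov unfolding markov_process_def by blast
  have X: "\<And>t. 0 \<le> t \<Longrightarrow> X t \<in> M \<rightarrow>\<^sub>M state_space"
    using markov unfolding markov_process_def by blast
  have Sm: "\<And>t. 0 \<le> t \<Longrightarrow> S t \<in> state_space \<rightarrow>\<^sub>M prob_algebra state_space"
    using S unfolding tagged_transition_def by blast
  have bound: "\<bar>\<integral>\<omega>. f (X s \<omega>) \<partial>M\<bar> \<le> C" if "local_function f" "\<And>z. \<bar>f z\<bar> \<le> C" "0 \<le> s" for f C s
    using that measurable_compose[OF X local_function_measurable] by (intro abs_expectation_le) auto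
  have rate: "\<exists>d>0. \<forall>h s. 0 < h \<longrightarrow> h < d \<longrightarrow> 0 \<le> s \<longrightarrow>
      \<bar>((\<integral>\<omega>. f (X (s + h) \<omega>) \<partial>M) - (\<integral>\<omega>. f (X s \<omega>) \<partial>M)) / h - (\<integral>\<omega>. generator p f (X s \<omega>) \<partial>M)\<bar> \<le> e"
    if f: "local_function f" and e: "0 < e" for f e
  proof -
    have "uniform_limit UNIV (\<lambda>h z. ((\<integral>w. f w \<partial>S h z) - f z) / h) (generator p f) (at_right 0)"
      using S f unfolding tagged_transition_def by blast
    then have "\<forall>\<^sub>F h in at_right 0. \<forall>z. dist (((\<integral>w. f w \<partial>S h z) - f z) / h) (generator p f z) < e"
      using e by (auto dest: uniform_limitD)
    then obtain d where d: "0 < d" "\<And>h z. 0 < h \<Longrightarrow> h < d \<Longrightarrow> \<bar>((\<integral>w. f w \<partial>S h z) - f z) / h - generator p f z\<bar> < e"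
      unfolding eventually_at_right_field dist_real_def by blast
    have "\<bar>((\<integral>\<omega>. f (X (s + h) \<omega>) \<partial>M) - (\<integral>\<omega>. f (X s \<omega>) \<partial>M)) / h - (\<integral>\<omega>. generator p f (X s \<omega>) \<partial>M)\<bar> \<le> e"
      if h: "0 < h" "h < d" and s: "0 \<le> s" for h s
    proof -
      let ?u = "\<lambda>\<omega>. \<integral>w. f w \<partial>S h (X s \<omega>)"
      have h0: "0 \<le> h" using h by simp
      note E = markov_process_expectation[OF markov s h0 Sm[OF h0] f]
      have Lf: "local_function (generator p f)" by (rule p.local_generator[OF f])
      have m: "(\<lambda>\<omega>. f (X s \<omega>)) \<in> borel_measurable M" "(\<lambda>\<omega>. generator p f (X s \<omega>)) \<in> borel_measurable M"
        by (rule measurable_compose[OF X[OF s] local_function_measurable], fact)+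
      obtain C where C: "\<And>z. \<bar>f z\<bar> \<le> C" using local_function_bounded[OF f] by blast
      obtain C' where C': "\<And>z. \<bar>generator p f z\<bar> \<le> C'" using local_function_bounded[OF Lf] by blast
      have i1: "integrable M (\<lambda>\<omega>. f (X s \<omega>))" using m C by (intro integrable_const_bound[where B=C]) auto
      have i2: "integrable M (\<lambda>\<omega>. generator p f (X s \<omega>))" using m C' by (intro integrable_const_bound[where B=C']) auto
      have i3: "integrable M ?u"
      proof (rule integrable_const_bound[where B=C])
        have "\<bar>?u \<omega>\<bar> \<le> C" for \<omega>
        proof -
          have Sz: "prob_space (S h (X s \<omega>))" "sets (S h (X s \<omega>)) = sets state_space"
            using measurable_space[OF Sm[OF h0], of "X s \<omega>"] by (auto simp: space_prob_algebra)
          show ?thesis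
            using local_function_measurable[OF f] Sz(2) C
            by (intro prob_space.abs_expectation_le[OF Sz(1)]) (simp_all cong: measurable_cong_sets)
        qed
        then show "AE \<omega> in M. norm (?u \<omega>) \<le> C" by simp
      qed (rule E(2))
      have "((\<integral>\<omega>. f (X (s + h) \<omega>) \<partial>M) - (\<integral>\<omega>. f (X s \<omega>) \<partial>M)) / h - (\<integral>\<omega>. generator p f (X s \<omega>) \<partial>M)
         = (\<integral>\<omega>. (?u \<omega> - f (X s \<omega>)) / h - generator p f (X s \<omega>) \<partial>M)"
        unfolding E(1) using i1 i2 i3 by simp
      also have "\<bar>\<dots>\<bar> \<le> e"
        by (rule abs_expectation_le[OF _ less_imp_le[OF d(2)[OF h]]]) (use E(2) m in simp)
      finally show ?thesis .
    qed
    then show ?thesis using d(1) by blast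
  qed
  show ?thesis
  proof
    fix f :: "'d state \<Rightarrow> real" and t :: real assume f: "local_function f" and t: "0 \<le> t"
    have 1: "local_function (generator p f)" by (rule p.local_generator[OF f])
    have 2: "local_function (generator p (generator p f))" by (rule p.local_generator[OF 1])
    obtain B where B: "\<And>z. \<bar>generator p (generator p f) z\<bar> \<le> B" using local_function_bounded[OF 2] by blast
    show "((\<lambda>s. \<integral>\<omega>. f (X s \<omega>) \<partial>M) has_real_derivative (\<integral>\<omega>. generator p f (X t \<omega>) \<partial>M)) (at t within {0..})"
      by (rule uniform_right_derivative[OF rate[OF f] rate[OF 1] bound[OF 2 B] t])
  qed (use X start in auto)
qed

section \<open>Exponential moments and integrated drift of the position\<close>

lemma finite_rvec_ball: "finite {x :: int^'d::finite. norm (rvec x) \<le> r}"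
proof -
  let ?B = "{x :: int^'d. \<forall>i. x $ i \<in> {- \<lceil>r\<rceil>..\<lceil>r\<rceil>}}"
  have "?B \<subseteq> vec_lambda ` (UNIV \<rightarrow>\<^sub>E {- \<lceil>r\<rceil>..\<lceil>r\<rceil>})"
  proof
    fix x assume "x \<in> ?B"
    then have "vec_nth x \<in> UNIV \<rightarrow>\<^sub>E {- \<lceil>r\<rceil>..\<lceil>r\<rceil>}" by auto
    then show "x \<in> vec_lambda ` (UNIV \<rightarrow>\<^sub>E {- \<lceil>r\<rceil>..\<lceil>r\<rceil>})"
      by (intro image_eqI[of _ _ "vec_nth x"]) (auto simp: vec_nth_inverse)
  qed
  moreover have "finite ((UNIV :: 'd set) \<rightarrow>\<^sub>E {- \<lceil>r\<rceil>..\<lceil>r\<rceil>})" by (intro finite_PiE) auto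
  ultimately have "finite ?B" using finite_surj by blast
  moreover have "{x :: int^'d. norm (rvec x) \<le> r} \<subseteq> ?B"
  proof safe
    fix x :: "int^'d" and i assume "norm (rvec x) \<le> r"
    then have "\<bar>rvec x $ i\<bar> \<le> r" using component_le_norm_cart[of "rvec x" i] by linarith
    then have "\<bar>real_of_int (x $ i)\<bar> \<le> r" by (simp add: rvec_def)
    then show "x $ i \<in> {- \<lceil>r\<rceil>..\<lceil>r\<rceil>}" by simp linarith
  qed
  ultimately show ?thesis by (rule finite_subset[rotated])
qed

lemma rvec_add: "rvec (x + y) = rvec x + rvec y"
  by (simp add: rvec_def vec_eq_iff)

lemma rvec_zero [simp]: "rvec 0 = 0"
  by (simp add: rvec_def vec_eq_iff)

lemma jump_rate_finite_range:
  assumes "jump_rate p" shows "finite_range_rate p"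
proof
  obtain R :: int where "\<And>x. norm (rvec x) > real_of_int R \<Longrightarrow> p x = 0"
    using assms unfolding jump_rate_def by blast
  then have "{j. p j \<noteq> 0} \<subseteq> {x. norm (rvec x) \<le> real_of_int R}" by force
  then show "finite {j. p j \<noteq> 0}" using finite_rvec_ball finite_subset by blast
qed (use assms in \<open>auto simp: jump_rate_def\<close>)

text \<open>The exponential grows by at most a fixed factor with every jump, and it dominates all polynomials.\<close>

definition weight :: "int^'d::finite \<Rightarrow> real" where
  "weight x = exp (norm (rvec x))"

lemma weight_pos: "0 < weight x"
  by (simp add: weight_def)

lemma weight_ge_1: "1 \<le> weight x"
  by (simp add: weight_def)

definition on_position :: "(int^'d::finite \<Rightarrow> real) \<Rightarrow> 'd state \<Rightarrow> real" where
  "on_position g = (\<lambda>(x, \<zeta>). g x)"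

lemma on_position_apply: "on_position g z = g (fst z)"
  by (simp add: on_position_def split_beta')

lemma depends_on_on_position: "depends_on {} (on_position g)"
  by (simp add: depends_on_def config_depends_on_def on_position_def)

lemma position_support_on_position: "position_support (on_position g) = {x. g x \<noteq> 0}"
  by (simp add: position_support_def on_position_def)

lemma local_on_position: "finite {x. g x \<noteq> 0} \<Longrightarrow> local_function (on_position g)"
  unfolding local_function_iff position_support_on_position using depends_on_on_position by blast

definition cutoff :: "nat \<Rightarrow> (int^'d::finite \<Rightarrow> real) \<Rightarrow> int^'d \<Rightarrow> real" where
  "cutoff N h x = (if norm (rvec x) \<le> real N then h x else 0)"

lemma finite_support_cutoff: "finite {x. cutoff N h x \<noteq> 0}"
  by (rule finite_subset[OF _ finite_rvec_ball[of "real N"]]) (auto simp: cutoff_def)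

lemma cutoff_eventually: "\<forall>\<^sub>F N in sequentially. cutoff N h x = h x"
proof -
  obtain N0 where "norm (rvec x) \<le> real N0" using real_arch_simple by blast
  then show ?thesis unfolding eventually_sequentially cutoff_def
    by (intro exI[of _ N0]) (auto intro: order_trans)
qed

context finite_range_rate
begin

text \<open>The generator applied to a function of the position alone, in a form that makes sense for functions
  of unbounded support too.\<close>

definition mean_drift :: "(int^'d \<Rightarrow> real) \<Rightarrow> 'd state \<Rightarrow> real" where
  "mean_drift h = (\<lambda>(x, \<zeta>). \<Sum>j\<in>J. (1 - of_bool (\<zeta> j)) * p j * (h (x + j) - h x))"

lemma generator_on_position: "generator p (on_position g) = mean_drift g"
proof
  fix z :: "'d state"
  have "covers_bonds {} {}" by (simp add: covers_bonds_def)
  from generator_eq_finite_sum[OF depends_on_on_position this, of g z]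
  show "generator p (on_position g) z = mean_drift g z"
    by (cases z) (simp add: mean_drift_def tag_gain_def tag_loss_def on_position_def right_diff_distrib)
qed

text \<open>An upper bound for the drift of a nonnegative function that ignores both the exclusion rule and the
  losses, and hence is again a function of the position alone.\<close>

definition free_growth :: "(int^'d \<Rightarrow> real) \<Rightarrow> int^'d \<Rightarrow> real" where
  "free_growth g x = (\<Sum>j\<in>J. p j * g (x + j))"

definition growth_rate :: real where
  "growth_rate = free_growth weight 0"

lemma growth_rate_nonneg: "0 \<le> growth_rate"
  unfolding growth_rate_def free_growth_def
  by (intro sum_nonneg mult_nonneg_nonneg rate_nonneg less_imp_le[OF weight_pos])

lemma free_growth_weight_le: "free_growth weight x \<le> growth_rate * weight x"
proof -
  have "p j * weight (x + j) \<le> p j * weight j * weight x" for j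
  proof -
    have "weight (x + j) \<le> weight j * weight x"
      unfolding weight_def rvec_add exp_add[symmetric] exp_le_cancel_iff
      using norm_triangle_ineq[of "rvec x" "rvec j"] by (simp add: add.commute)
    then show ?thesis using rate_nonneg[of j] by (simp add: mult.assoc mult_left_mono)
  qed
  then show ?thesis
    unfolding growth_rate_def free_growth_def sum_distrib_right by (auto intro!: sum_mono)
qed

lemma free_growth_mono: "(\<And>x. g x \<le> h x) \<Longrightarrow> free_growth g x \<le> free_growth h x"
  unfolding free_growth_def by (intro sum_mono mult_left_mono rate_nonneg)

lemma finite_support_free_growth:
  assumes "finite {x. g x \<noteq> 0}" shows "finite {x. free_growth g x \<noteq> 0}"
proof (rule finite_subset)
  show "{x. free_growth g x \<noteq> 0} \<subseteq> (\<Union>j\<in>J. (\<lambda>x. x - j) ` {x. g x \<noteq> 0})"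
  proof
    fix x assume "x \<in> {x. free_growth g x \<noteq> 0}"
    then obtain j where "j \<in> J" "p j * g (x + j) \<noteq> 0"
      unfolding free_growth_def using sum.neutral by (metis (mono_tags, lifting) mem_Collect_eq)
    then show "x \<in> (\<Union>j\<in>J. (\<lambda>x. x - j) ` {x. g x \<noteq> 0})"
      by (auto intro!: bexI[of _ j] image_eqI[of _ _ "x + j"])
  qed
qed (use assms finite_rate_support in auto)

lemma mean_drift_le_free_growth:
  assumes "\<And>x. 0 \<le> g x" shows "mean_drift g (x, \<zeta>) \<le> free_growth g x"
  unfolding mean_drift_def free_growth_def prod.case
  using assms rate_nonneg by (intro sum_mono) (auto simp: mult_left_mono)

lemma abs_mean_drift_le:
  assumes h: "\<And>x. \<bar>h x\<bar> \<le> c * weight x"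
  shows "\<bar>mean_drift h (x, \<zeta>)\<bar> \<le> c * (growth_rate + total_rate) * weight x"
proof -
  have c: "0 \<le> c" using h[of 0] abs_ge_zero[of "h 0"] weight_pos[of "0 :: int^'d"]
    by (metis order_trans zero_le_mult_iff less_le_not_le)
  have "\<bar>mean_drift h (x, \<zeta>)\<bar> \<le> (\<Sum>j\<in>J. p j * (c * weight (x + j)) + p j * (c * weight x))"
    unfolding mean_drift_def prod.case
  proof (rule order_trans[OF sum_abs sum_mono])
    fix j
    have "\<bar>(1 - of_bool (\<zeta> j)) * p j * (h (x + j) - h x)\<bar> \<le> p j * \<bar>h (x + j) - h x\<bar>"
      using rate_nonneg[of j] by (auto simp: abs_mult)
    also have "\<dots> \<le> p j * (c * weight (x + j) + c * weight x)"
      using h[of "x + j"] h[of x] by (intro mult_left_mono rate_nonneg) linarith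
    finally show "\<bar>(1 - of_bool (\<zeta> j)) * p j * (h (x + j) - h x)\<bar> \<le> p j * (c * weight (x + j)) + p j * (c * weight x)"
      by (simp add: distrib_left)
  qed
  also have "\<dots> = c * free_growth weight x + c * total_rate * weight x"
    unfolding sum.distrib free_growth_def total_rate_def sum_distrib_left sum_distrib_right
    by (simp add: mult_ac)
  also have "\<dots> \<le> c * (growth_rate * weight x) + c * total_rate * weight x"
    using free_growth_weight_le c by (intro add_right_mono mult_left_mono)
  finally show ?thesis by (simp add: algebra_simps)
qed

lemma mean_drift_cutoff_tendsto: "(\<lambda>N. mean_drift (cutoff N h) z) \<longlonglongrightarrow> mean_drift h z"
proof (cases z)
  case (Pair x \<zeta>)
  have "(\<lambda>N. cutoff N h y) \<longlonglongrightarrow> h y" for y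
    by (rule tendsto_eventually[OF cutoff_eventually])
  then show ?thesis unfolding mean_drift_def Pair prod.case by (intro tendsto_intros)
qed

end

lemma abs_cutoff_le:
  assumes "\<And>x. \<bar>h x\<bar> \<le> c * weight x" shows "\<bar>cutoff N h x\<bar> \<le> c * weight x"
  using assms[of x] abs_ge_zero[of "h x"] by (auto simp: cutoff_def)

lemma measurable_fst_state: "h \<circ> fst \<in> borel_measurable state_space"
  for h :: "int^'d::finite \<Rightarrow> real"
  by (rule measurable_comp[of _ _ "count_space UNIV"]) auto

context forward_process
begin

lemma measurable_position: "0 \<le> t \<Longrightarrow> (\<lambda>\<omega>. h (fst (X t \<omega>))) \<in> borel_measurable M" for h :: "int^'d \<Rightarrow> real"
  using measurable_compose[OF state_measurable measurable_fst_state[of h]] by (simp add: o_def)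

lemma integrable_local:
  assumes "local_function f" "0 \<le> t"
  shows "integrable M (\<lambda>\<omega>. f (X t \<omega>))"
proof -
  obtain C where "\<And>z. \<bar>f z\<bar> \<le> C" using local_function_bounded[OF assms(1)] by blast
  then show ?thesis
    using measurable_compose[OF state_measurable[OF assms(2)] local_function_measurable[OF assms(1)]]
    by (intro integrable_const_bound[where B=C]) auto
qed

lemma start_expectation: "(\<integral>\<omega>. h (fst (X 0 \<omega>)) \<partial>M) = h 0" for h :: "int^'d \<Rightarrow> real"
proof -
  have "(\<integral>\<omega>. h (fst (X 0 \<omega>)) \<partial>M) = (\<integral>\<omega>. h 0 \<partial>M)"
    using start_origin measurable_position[of 0 h] by (intro integral_cong_AE) auto
  then show ?thesis by (simp add: prob_space)
qed

lemma forward_equation_interval: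
  assumes "local_function f" "u \<in> {0..t}"
  shows "((\<lambda>s. \<integral>\<omega>. f (X s \<omega>) \<partial>M) has_real_derivative (\<integral>\<omega>. generator p f (X u \<omega>) \<partial>M)) (at u within {0..t})"
  using assms by (intro DERIV_subset[OF forward_equation]) auto

text \<open>Iterating the differential inequality \<open>u_g' \<le> u_(free_growth g)\<close> for the expectations
  \<open>u_g\<close> produces the exponential series of the growth rate of the weight, with a remainder that
  involves only the sup-norm \<open>b\<close> and vanishes for large \<open>n\<close>. The bound for the weight itself is
  out of reach of Gronwall's lemma directly, as its expectation might be infinite.\<close>

lemma expectation_position_bound:
  fixes g :: "int^'d \<Rightarrow> real"
  assumes "finite {x. g x \<noteq> 0}" "\<And>x. 0 \<le> g x" "\<And>x. g x \<le> c * weight x" "\<And>x. g x \<le> b" "0 \<le> t"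
  shows "(\<integral>\<omega>. g (fst (X t \<omega>)) \<partial>M) \<le> c * exp (growth_rate * t) + (total_rate * t) ^ n / fact n * b"
  using assms
proof (induction n arbitrary: g c b t)
  case 0
  have c: "0 \<le> c" using order_trans[OF 0(2)[of 0] 0(3)] by (simp add: weight_def)
  have "(\<integral>\<omega>. g (fst (X t \<omega>)) \<partial>M) \<le> b"
    using 0(4) integrable_local[OF local_on_position[OF 0(1)] 0(5)]
    by (intro integral_le_const) (auto simp: on_position_apply)
  then show ?case using c by (simp add: add_increasing)
next
  case (Suc n)
  have c: "0 \<le> c" using order_trans[OF Suc.prems(2)[of 0] Suc.prems(3)] by (simp add: weight_def)
  have loc: "local_function (on_position g)" by (rule local_on_position[OF Suc.prems(1)])
  let ?u = "\<lambda>s. \<integral>\<omega>. on_position g (X s \<omega>) \<partial>M"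
  let ?h = "\<lambda>s. c * exp (growth_rate * s) + (total_rate * s) ^ Suc n / fact (Suc n) * b"
  let ?h' = "\<lambda>s. c * growth_rate * exp (growth_rate * s) + (total_rate * s) ^ n / fact n * (total_rate * b)"
  have "?u t - ?u 0 \<le> ?h t - ?h 0"
  proof (rule derivative_comparison[OF Suc.prems(5) forward_equation_interval[OF loc]])
    fix s assume s: "s \<in> {0..t}"
    have "(?h has_real_derivative c * (exp (growth_rate * s) * growth_rate) + (real (Suc n) * (total_rate * s) ^ n * total_rate) / fact (Suc n) * b) (at s within {0..t})"
      by (rule derivative_eq_intros refl | simp)+
    also have "c * (exp (growth_rate * s) * growth_rate) + (real (Suc n) * (total_rate * s) ^ n * total_rate) / fact (Suc n) * b = ?h' s"
    proof -
      have "(real (Suc n) * y) / fact (Suc n) = y / fact n" for y :: real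
        by (simp del: of_nat_Suc)
      from this[of "(total_rate * s) ^ n * total_rate"] show ?thesis by (simp only: mult.assoc) (simp add: mult_ac)
    qed
    finally show "(?h has_real_derivative ?h' s) (at s within {0..t})" .
    have fin: "finite {x. free_growth g x \<noteq> 0}" by (rule finite_support_free_growth[OF Suc.prems(1)])
    have "(\<integral>\<omega>. generator p (on_position g) (X s \<omega>) \<partial>M) \<le> (\<integral>\<omega>. on_position (free_growth g) (X s \<omega>) \<partial>M)"
    proof (rule integral_mono)
      show "integrable M (\<lambda>\<omega>. generator p (on_position g) (X s \<omega>))"
        "integrable M (\<lambda>\<omega>. on_position (free_growth g) (X s \<omega>))"
        using s by (auto intro!: integrable_local local_generator loc local_on_position fin)
      show "generator p (on_position g) (X s \<omega>) \<le> on_position (free_growth g) (X s \<omega>)" for \<omega>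
        using mean_drift_le_free_growth[of g, OF Suc.prems(2)] by (cases "X s \<omega>") (simp add: generator_on_position on_position_apply)
    qed
    also have "\<dots> = (\<integral>\<omega>. free_growth g (fst (X s \<omega>)) \<partial>M)" by (simp add: on_position_apply)
    also have "\<dots> \<le> ?h' s"
    proof (rule Suc.IH[OF fin])
      show "0 \<le> free_growth g x" for x
        unfolding free_growth_def by (intro sum_nonneg mult_nonneg_nonneg rate_nonneg Suc.prems(2))
      have "free_growth g x \<le> free_growth (\<lambda>x. c * weight x) x" for x by (rule free_growth_mono[OF Suc.prems(3)])
      also have "free_growth (\<lambda>x. c * weight x) x = c * free_growth weight x" for x
        by (simp add: free_growth_def sum_distrib_left mult_ac)
      also have "c * free_growth weight x \<le> c * (growth_rate * weight x)" for x
        by (rule mult_left_mono[OF free_growth_weight_le c])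
      finally show "free_growth g x \<le> c * growth_rate * weight x" for x by (simp add: mult_ac)
      have "free_growth g x \<le> free_growth (\<lambda>x. b) x" for x by (rule free_growth_mono[OF Suc.prems(4)])
      then show "free_growth g x \<le> total_rate * b" for x
        by (simp add: free_growth_def total_rate_def sum_distrib_right)
    qed (use s in auto)
    finally show "(\<integral>\<omega>. generator p (on_position g) (X s \<omega>) \<partial>M) \<le> ?h' s" .
  qed
  moreover have "?u 0 = g 0" using start_expectation[of g] by (simp add: on_position_apply)
  moreover have "g 0 \<le> c" using Suc.prems(3)[of 0] by (simp add: weight_def)
  ultimately show ?case by (simp add: on_position_apply)
qed

lemma expectation_weight_cutoff:
  assumes "0 \<le> t"
  shows "(\<integral>\<omega>. cutoff N weight (fst (X t \<omega>)) \<partial>M) \<le> exp (growth_rate * t)"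
proof -
  have b: "cutoff N weight x \<le> exp (real N)" for x :: "int^'d" by (auto simp: cutoff_def weight_def)
  have w: "cutoff N weight x \<le> 1 * weight x" "0 \<le> cutoff N weight x" for x :: "int^'d"
    using weight_pos[of x] by (auto simp: cutoff_def)
  have "(\<lambda>n. 1 * exp (growth_rate * t) + (total_rate * t) ^ n / fact n * exp (real N)) \<longlonglongrightarrow> 1 * exp (growth_rate * t) + 0 * exp (real N)"
    using summable_LIMSEQ_zero[OF summable_exp[of "total_rate * t"]]
    by (intro tendsto_intros) (simp add: field_simps)
  from LIMSEQ_le_const[OF this] expectation_position_bound[OF finite_support_cutoff w(2,1) b assms]
  show ?thesis by simp
qed

lemma
  assumes t: "0 \<le> t"
  shows integrable_weight: "integrable M (\<lambda>\<omega>. weight (fst (X t \<omega>)))"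
    and expectation_weight: "(\<integral>\<omega>. weight (fst (X t \<omega>)) \<partial>M) \<le> exp (growth_rate * t)"
proof -
  let ?f = "\<lambda>N \<omega>. cutoff N weight (fst (X t \<omega>))"
  have int: "integrable M (?f N)" for N
    using integrable_local[OF local_on_position[OF finite_support_cutoff] t, of N weight]
    by (simp add: on_position_apply)
  have mono: "mono (\<lambda>N. ?f N \<omega>)" for \<omega>
    using weight_pos[of "fst (X t \<omega>)"] by (auto simp: mono_def cutoff_def)
  have "incseq (\<lambda>N. \<integral>\<omega>. ?f N \<omega> \<partial>M)"
    using mono by (auto simp: incseq_def mono_def intro!: integral_mono int)
  then obtain L where L: "(\<lambda>N. \<integral>\<omega>. ?f N \<omega> \<partial>M) \<longlonglongrightarrow> L"
    using incseq_convergent[of _ "exp (growth_rate * t)"] expectation_weight_cutoff[OF t] by metis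
  have lim: "AE \<omega> in M. (\<lambda>N. ?f N \<omega>) \<longlonglongrightarrow> weight (fst (X t \<omega>))"
    by (intro AE_I2 tendsto_eventually cutoff_eventually)
  have pos: "AE \<omega> in M. 0 \<le> ?f N \<omega>" for N
    by (simp add: cutoff_def less_imp_le[OF weight_pos])
  have mono': "AE \<omega> in M. mono (\<lambda>N. ?f N \<omega>)" by (intro AE_I2 mono)
  note * = integral_monotone_convergence_nonneg[OF int mono' pos lim L measurable_position[OF t]]
  show "integrable M (\<lambda>\<omega>. weight (fst (X t \<omega>)))" by (rule *(1))
  show "(\<integral>\<omega>. weight (fst (X t \<omega>)) \<partial>M) \<le> exp (growth_rate * t)"
    unfolding *(2) using expectation_weight_cutoff[OF t] by (intro LIMSEQ_le_const2[OF L]) auto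
qed

lemma integrable_dominated:
  fixes u :: "'d state \<Rightarrow> real"
  assumes "u \<in> borel_measurable state_space" "\<And>x \<zeta>. \<bar>u (x, \<zeta>)\<bar> \<le> c * weight x" "0 \<le> t"
  shows "integrable M (\<lambda>\<omega>. u (X t \<omega>))"
proof (rule Bochner_Integration.integrable_bound)
  show "integrable M (\<lambda>\<omega>. c * weight (fst (X t \<omega>)))" by (intro integrable_mult_right integrable_weight assms)
  show "(\<lambda>\<omega>. u (X t \<omega>)) \<in> borel_measurable M" by (rule measurable_compose[OF state_measurable[OF assms(3)] assms(1)])
  have "\<bar>u (X t \<omega>)\<bar> \<le> c * weight (fst (X t \<omega>))" for \<omega> using assms(2)[of "fst (X t \<omega>)" "snd (X t \<omega>)"] by simp
  then show "AE \<omega> in M. norm (u (X t \<omega>)) \<le> norm (c * weight (fst (X t \<omega>)))"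
    by (auto intro: order_trans[OF _ abs_ge_self])
qed

lemma expectation_dominated_tendsto:
  fixes u :: "nat \<Rightarrow> 'd state \<Rightarrow> real"
  assumes "\<And>N. u N \<in> borel_measurable state_space" "\<And>N x \<zeta>. \<bar>u N (x, \<zeta>)\<bar> \<le> c * weight x" "0 \<le> t"
    and lim: "\<And>z. (\<lambda>N. u N z) \<longlonglongrightarrow> v z"
  shows "(\<lambda>N. \<integral>\<omega>. u N (X t \<omega>) \<partial>M) \<longlonglongrightarrow> (\<integral>\<omega>. v (X t \<omega>) \<partial>M)"
proof (rule integral_dominated_convergence)
  show "integrable M (\<lambda>\<omega>. c * weight (fst (X t \<omega>)))" by (intro integrable_mult_right integrable_weight assms)
  show "(\<lambda>\<omega>. u N (X t \<omega>)) \<in> borel_measurable M" for N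
    by (rule measurable_compose[OF state_measurable[OF assms(3)] assms(1)])
  have "v \<in> borel_measurable state_space" by (rule borel_measurable_LIMSEQ_real[OF lim assms(1)])
  then show "(\<lambda>\<omega>. v (X t \<omega>)) \<in> borel_measurable M"
    by (rule measurable_compose[OF state_measurable[OF assms(3)]])
  have "\<bar>u N (X t \<omega>)\<bar> \<le> c * weight (fst (X t \<omega>))" for N \<omega> using assms(2)[of N "fst (X t \<omega>)" "snd (X t \<omega>)"] by simp
  then show "AE \<omega> in M. norm (u N (X t \<omega>)) \<le> c * weight (fst (X t \<omega>))" for N by simp
  show "AE \<omega> in M. (\<lambda>N. u N (X t \<omega>)) \<longlonglongrightarrow> v (X t \<omega>)" using lim by simp
qed

text \<open>The sharp cutoff of \<open>h\<close> at radius \<open>N\<close> is local, and its drift is dominated by the weight with a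
  constant that does not depend on \<open>N\<close>, so the forward equation survives the limit.\<close>

lemma
  fixes h :: "int^'d \<Rightarrow> real"
  assumes h: "\<And>x. \<bar>h x\<bar> \<le> c * weight x" and t: "0 \<le> t"
  shows drift_integrable: "(\<lambda>s. \<integral>\<omega>. mean_drift h (X s \<omega>) \<partial>M) integrable_on {0..t}"
    and expectation_eq_integral_drift:
      "(\<integral>\<omega>. h (fst (X t \<omega>)) \<partial>M) = h 0 + integral {0..t} (\<lambda>s. \<integral>\<omega>. mean_drift h (X s \<omega>) \<partial>M)"
proof -
  let ?g = "\<lambda>N s. \<integral>\<omega>. mean_drift (cutoff N h) (X s \<omega>) \<partial>M"
  let ?c = "c * (growth_rate + total_rate)"
  have c: "0 \<le> c" using order_trans[OF abs_ge_zero h, of 0] by (simp add: weight_def)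
  have loc: "local_function (on_position (cutoff N h))" for N
    by (rule local_on_position[OF finite_support_cutoff])
  have ftc: "(?g N has_integral (\<integral>\<omega>. cutoff N h (fst (X t \<omega>)) \<partial>M) - cutoff N h 0) {0..t}" for N
  proof -
    have "((\<lambda>s. \<integral>\<omega>. generator p (on_position (cutoff N h)) (X s \<omega>) \<partial>M) has_integral
       (\<integral>\<omega>. on_position (cutoff N h) (X t \<omega>) \<partial>M) - (\<integral>\<omega>. on_position (cutoff N h) (X 0 \<omega>) \<partial>M)) {0..t}"
      by (rule fundamental_theorem_of_calculus[OF t])
        (simp add: forward_equation_interval[OF loc] flip: has_real_derivative_iff_has_vector_derivative)
    then show ?thesis
      using start_expectation[of "cutoff N h"] by (simp add: generator_on_position on_position_apply)
  qed
  have meas: "mean_drift (cutoff N h) \<in> borel_measurable state_space" for N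
    unfolding generator_on_position[symmetric] by (rule local_function_measurable[OF local_generator[OF loc]])
  have hN: "\<bar>mean_drift (cutoff N h) (x, \<zeta>)\<bar> \<le> ?c * weight x" for N x \<zeta>
    by (intro abs_mean_drift_le abs_cutoff_le h)
  have gN: "\<bar>?g N s\<bar> \<le> ?c * exp (growth_rate * t)" if "s \<in> {0..t}" for N s
  proof -
    have c': "0 \<le> ?c" using c growth_rate_nonneg total_rate_nonneg by simp
    have s: "0 \<le> s" using that by simp
    have "\<bar>?g N s\<bar> \<le> (\<integral>\<omega>. \<bar>mean_drift (cutoff N h) (X s \<omega>)\<bar> \<partial>M)" by (rule integral_abs_bound)
    also have "\<dots> \<le> (\<integral>\<omega>. ?c * weight (fst (X s \<omega>)) \<partial>M)"
    proof (rule integral_mono)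
      show "integrable M (\<lambda>\<omega>. \<bar>mean_drift (cutoff N h) (X s \<omega>)\<bar>)"
        by (intro integrable_abs integrable_dominated[OF meas hN s])
      show "\<bar>mean_drift (cutoff N h) (X s \<omega>)\<bar> \<le> ?c * weight (fst (X s \<omega>))" for \<omega>
        using hN[of N "fst (X s \<omega>)" "snd (X s \<omega>)"] by simp
    qed (intro integrable_mult_right integrable_weight s)
    also have "\<dots> = ?c * (\<integral>\<omega>. weight (fst (X s \<omega>)) \<partial>M)" by simp
    also have "\<dots> \<le> ?c * exp (growth_rate * s)" by (rule mult_left_mono[OF expectation_weight[OF s] c'])
    also have "\<dots> \<le> ?c * exp (growth_rate * t)"
      using that growth_rate_nonneg by (intro mult_left_mono[OF _ c']) (auto intro: mult_left_mono)
    finally show ?thesis .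
  qed
  have conv: "(\<lambda>N. ?g N s) \<longlonglongrightarrow> (\<integral>\<omega>. mean_drift h (X s \<omega>) \<partial>M)" if "s \<in> {0..t}" for s
    using that by (intro expectation_dominated_tendsto[OF meas hN _ mean_drift_cutoff_tendsto]) auto
  note dc = dominated_convergence[of ?g "{0..t}" "\<lambda>_. ?c * exp (growth_rate * t)", OF has_integral_integrable[OF ftc] _ _ conv]
  show "(\<lambda>s. \<integral>\<omega>. mean_drift h (X s \<omega>) \<partial>M) integrable_on {0..t}"
    by (rule dc(1)) (use gN in auto)
  have "(\<lambda>N. integral {0..t} (?g N)) \<longlonglongrightarrow> integral {0..t} (\<lambda>s. \<integral>\<omega>. mean_drift h (X s \<omega>) \<partial>M)"
    by (rule dc(2)) (use gN in auto)
  moreover have "(\<lambda>N. integral {0..t} (?g N)) \<longlonglongrightarrow> (\<integral>\<omega>. h (fst (X t \<omega>)) \<partial>M) - h 0"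
  proof -
    have "(\<lambda>N. \<integral>\<omega>. on_position (cutoff N h) (X t \<omega>) \<partial>M) \<longlonglongrightarrow> (\<integral>\<omega>. on_position h (X t \<omega>) \<partial>M)"
    proof (rule expectation_dominated_tendsto[OF local_function_measurable[OF loc] _ t])
      show "\<bar>on_position (cutoff N h) (x, \<zeta>)\<bar> \<le> c * weight x" for N x \<zeta>
        using abs_cutoff_le[OF h] by (simp add: on_position_def)
      show "(\<lambda>N. on_position (cutoff N h) z) \<longlonglongrightarrow> on_position h z" for z
        unfolding on_position_apply by (rule tendsto_eventually[OF cutoff_eventually])
    qed
    moreover have "(\<lambda>N. cutoff N h 0) \<longlonglongrightarrow> h 0" by (rule tendsto_eventually[OF cutoff_eventually])
    ultimately show ?thesis
      unfolding integral_unique[OF ftc] by (intro tendsto_diff) (simp_all add: on_position_apply)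
  qed
  ultimately have "(\<integral>\<omega>. h (fst (X t \<omega>)) \<partial>M) - h 0 = integral {0..t} (\<lambda>s. \<integral>\<omega>. mean_drift h (X s \<omega>) \<partial>M)"
    using LIMSEQ_unique by blast
  then show "(\<integral>\<omega>. h (fst (X t \<omega>)) \<partial>M) = h 0 + integral {0..t} (\<lambda>s. \<integral>\<omega>. mean_drift h (X s \<omega>) \<partial>M)"
    by simp
qed

end

section \<open>Time reversal of the equilibrium process\<close>

context forward_process
begin

lemma start_expectation_local:
  assumes law: "distr M config_space (\<lambda>\<omega>. snd (X 0 \<omega>)) = \<nu>" and f: "local_function f"
  shows "(\<integral>\<omega>. f (X 0 \<omega>) \<partial>M) = (\<integral>\<zeta>. f (0, \<zeta>) \<partial>\<nu>)"
proof -
  have snd: "(\<lambda>\<omega>. snd (X 0 \<omega>)) \<in> M \<rightarrow>\<^sub>M config_space"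
    by (rule measurable_compose[OF state_measurable measurable_snd]) simp
  note sec = local_function_measurable_section[OF f, of 0]
  have "(\<integral>\<omega>. f (X 0 \<omega>) \<partial>M) = (\<integral>\<omega>. f (0, snd (X 0 \<omega>)) \<partial>M)"
  proof (rule integral_cong_AE)
    show "AE \<omega> in M. f (X 0 \<omega>) = f (0, snd (X 0 \<omega>))"
      using start_origin by eventually_elim (metis prod.collapse)
    show "(\<lambda>\<omega>. f (0, snd (X 0 \<omega>))) \<in> borel_measurable M" by (rule measurable_compose[OF snd sec])
    show "(\<lambda>\<omega>. f (X 0 \<omega>)) \<in> borel_measurable M"
      by (rule measurable_compose[OF state_measurable local_function_measurable[OF f]]) simp
  qed
  also have "\<dots> = (\<integral>\<zeta>. f (0, \<zeta>) \<partial>\<nu>)"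
    unfolding law[symmetric] by (rule integral_distr[OF snd sec, symmetric])
  finally show ?thesis .
qed

lemma forward_equation_power:
  assumes "local_function f" "0 \<le> t"
  shows "((\<lambda>s. \<integral>\<omega>. (generator p ^^ n) f (X s \<omega>) \<partial>M) has_real_derivative
    (\<integral>\<omega>. (generator p ^^ Suc n) f (X t \<omega>) \<partial>M)) (at t within {0..})"
  using forward_equation[OF local_generator_power[OF assms(1)] assms(2)] by simp

lemma abs_expectation_tame_le:
  assumes "tame m c f" "0 \<le> t"
  shows "\<bar>\<integral>\<omega>. f (X t \<omega>) \<partial>M\<bar> \<le> c"
  using measurable_compose[OF state_measurable[OF assms(2)] local_function_measurable[OF tame_local[OF assms(1)]]]
    tame_bound[OF assms(1)]
  by (intro abs_expectation_le) auto

end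

text \<open>The two sides, as functions of time, have the same derivatives of all orders at time 0 by the
  algebraic identity for the powers of the generator.\<close>

lemma reversal_at_site:
  fixes p :: "int^'d::finite \<Rightarrow> real"
  assumes \<rho>: "0 < \<rho>" "\<rho> \<le> 1"
    and M: "forward_process p M X" "distr M config_space (\<lambda>\<omega>. snd (X 0 \<omega>)) = Q_measure \<rho>"
    and M': "forward_process p M' X'" "distr M' config_space (\<lambda>\<omega>. snd (X' 0 \<omega>)) = mu_measure (- j) \<rho>"
    and t: "0 \<le> t"
  shows "(\<integral>\<omega>. at_site_occupied a j (X t \<omega>) \<partial>M) = \<rho> * (\<integral>\<omega>. at_site a (X' t \<omega>) \<partial>M')"
proof -
  interpret A: forward_process p M X by (rule M)
  interpret B: forward_process p M' X' by (rule M')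
  let ?f = "at_site_occupied a j" and ?g = "at_site a :: 'd state \<Rightarrow> real"
  define F where "F n s = (\<integral>\<omega>. (generator p ^^ n) ?f (X s \<omega>) \<partial>M) - \<rho> * (\<integral>\<omega>. (generator p ^^ n) ?g (X' s \<omega>) \<partial>M')" for n s
  obtain m1 c1 where f: "0 \<le> c1" "tame m1 c1 ?f" using local_function_tame[OF local_at_site_occupied] .
  obtain m2 c2 where g: "0 \<le> c2" "tame m2 c2 ?g" using local_function_tame[OF local_at_site] .
  let ?k = "\<lambda>m. 4 * real (card A.J) * A.total_rate * real (m + 1)"
  \<comment> \<open>one rate for both families of derivatives; the 1 makes it positive when there are no jumps\<close>
  define K where "K = ?k m1 + ?k m2 + 1"
  have k: "0 \<le> ?k m" for m using A.total_rate_nonneg by simp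
  have K: "0 < K" "?k m1 \<le> K" "?k m2 \<le> K" using k[of m1] k[of m2] unfolding K_def by linarith+
  have "F 0 t = 0"
  proof (rule analytic_uniqueness[where F=F and K=K and c="c1 + c2", OF _ _ _ K(1) _ t])
    show "(F n has_real_derivative F (Suc n) s) (at s within {0..})" if "0 \<le> s" for n s
      unfolding F_def
      by (intro DERIV_diff DERIV_cmult A.forward_equation_power B.forward_equation_power
          local_at_site local_at_site_occupied that)
    show "\<bar>F n s\<bar> \<le> (c1 + c2) * K ^ n * fact n" if s: "0 \<le> s" for n s
    proof -
      have 1: "\<bar>\<integral>\<omega>. (generator p ^^ n) ?f (X s \<omega>) \<partial>M\<bar> \<le> c1 * ?k m1 ^ n * fact n"
        by (rule A.abs_expectation_tame_le[OF A.tame_generator_power[OF f(2,1)] s])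
      have 2: "\<bar>\<integral>\<omega>. (generator p ^^ n) ?g (X' s \<omega>) \<partial>M'\<bar> \<le> c2 * ?k m2 ^ n * fact n"
        by (rule B.abs_expectation_tame_le[OF A.tame_generator_power[OF g(2,1)] s])
      have "\<bar>\<rho> * (\<integral>\<omega>. (generator p ^^ n) ?g (X' s \<omega>) \<partial>M')\<bar> \<le> 1 * (c2 * ?k m2 ^ n * fact n)"
        unfolding abs_mult using \<rho> 2 by (intro mult_mono) auto
      moreover have "c1 * ?k m1 ^ n * fact n \<le> c1 * K ^ n * fact n" "c2 * ?k m2 ^ n * fact n \<le> c2 * K ^ n * fact n"
        using f(1) g(1) k K by (auto intro!: mult_right_mono mult_left_mono power_mono)
      ultimately show ?thesis using 1 unfolding F_def distrib_right by linarith
    qed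
    show "F n 0 = 0" for n
    proof -
      have m: "(\<lambda>\<zeta>. (generator p ^^ n) ?g (0, \<zeta>)) \<in> borel_measurable config_space"
        by (intro local_function_measurable_section A.local_generator_power local_at_site)
      show ?thesis
        unfolding F_def A.start_expectation_local[OF M(2) A.local_generator_power[OF local_at_site_occupied]]
          B.start_expectation_local[OF M'(2) A.local_generator_power[OF local_at_site]]
          A.generator_power_reversal[OF \<rho>] mu_integral[OF \<rho> m] by simp
    qed
  qed (use f g in simp)
  then show ?thesis by (simp add: F_def)
qed

text \<open>With \<open>h\<close> a coordinate of the position this is
  the correlation of the position with the occupation of \<open>j\<close>, expressed by the mean position of
  the process that starts with a particle at \<open>- j\<close>.\<close>

lemma reversal_expectation:
  fixes p :: "int^'d::finite \<Rightarrow> real" and h :: "int^'d \<Rightarrow> real"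
  assumes \<rho>: "0 < \<rho>" "\<rho> \<le> 1"
    and M: "forward_process p M X" "distr M config_space (\<lambda>\<omega>. snd (X 0 \<omega>)) = Q_measure \<rho>"
    and M': "forward_process p M' X'" "distr M' config_space (\<lambda>\<omega>. snd (X' 0 \<omega>)) = mu_measure (- j) \<rho>"
    and h: "\<And>x. \<bar>h x\<bar> \<le> c * weight x" and t: "0 \<le> t"
  shows "(\<integral>\<omega>. h (fst (X t \<omega>)) * of_bool (snd (X t \<omega>) j) \<partial>M) = \<rho> * (\<integral>\<omega>. h (fst (X' t \<omega>)) \<partial>M')"
proof -
  interpret A: forward_process p M X by (rule M)
  interpret B: forward_process p M' X' by (rule M')
  let ?B = "\<lambda>N. {x :: int^'d. norm (rvec x) \<le> real N}"
  let ?u = "\<lambda>N z. \<Sum>a\<in>?B N. h a * at_site_occupied a j z"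
  let ?w = "\<lambda>N z. \<Sum>a\<in>?B N. h a * at_site a z"
  have u: "?u N z = cutoff N h (fst z) * of_bool (snd z j)" for N z
    by (cases z) (auto simp: finite_rvec_ball at_site_occupied_def cutoff_def of_bool_def if_distrib[of "\<lambda>b. _ * b"] sum.delta' cong: if_cong)
  have w: "?w N z = cutoff N h (fst z)" for N z
    by (cases z) (auto simp: finite_rvec_ball at_site_def cutoff_def of_bool_def if_distrib[of "\<lambda>b. _ * b"] sum.delta' cong: if_cong)
  have loc: "local_function (?u N)" "local_function (?w N)" for N
    by (intro local_function_sum local_function_cmult local_at_site local_at_site_occupied)+
  have eq: "(\<integral>\<omega>. ?u N (X t \<omega>) \<partial>M) = \<rho> * (\<integral>\<omega>. ?w N (X' t \<omega>) \<partial>M')" for N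
  proof -
    have "(\<integral>\<omega>. ?u N (X t \<omega>) \<partial>M) = (\<Sum>a\<in>?B N. h a * (\<integral>\<omega>. at_site_occupied a j (X t \<omega>) \<partial>M))"
      by (subst Bochner_Integration.integral_sum)
        (auto intro!: integrable_mult_right A.integrable_local local_at_site_occupied t)
    also have "\<dots> = \<rho> * (\<Sum>a\<in>?B N. h a * (\<integral>\<omega>. at_site a (X' t \<omega>) \<partial>M'))"
      unfolding reversal_at_site[OF \<rho> M M' t] by (simp add: sum_distrib_left mult_ac)
    also have "(\<Sum>a\<in>?B N. h a * (\<integral>\<omega>. at_site a (X' t \<omega>) \<partial>M')) = (\<integral>\<omega>. ?w N (X' t \<omega>) \<partial>M')"
      by (subst Bochner_Integration.integral_sum)
        (auto intro!: integrable_mult_right B.integrable_local local_at_site t)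
    finally show ?thesis .
  qed
  have c: "0 \<le> c" using order_trans[OF abs_ge_zero h, of 0] by (simp add: weight_def)
  have hN: "\<bar>cutoff N h x\<bar> \<le> c * weight x" for N x by (rule abs_cutoff_le[OF h])
  have "(\<lambda>N. \<integral>\<omega>. ?u N (X t \<omega>) \<partial>M) \<longlonglongrightarrow> (\<integral>\<omega>. (\<lambda>z. h (fst z) * of_bool (snd z j)) (X t \<omega>) \<partial>M)"
  proof (rule A.expectation_dominated_tendsto[OF local_function_measurable[OF loc(1)] _ t])
    show "\<bar>?u N (x, \<zeta>)\<bar> \<le> c * weight x" for N x \<zeta>
      unfolding u using hN[of N x] c weight_pos[of x] by auto
    show "(\<lambda>N. ?u N z) \<longlonglongrightarrow> h (fst z) * of_bool (snd z j)" for z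
      unfolding u by (intro tendsto_intros tendsto_eventually[OF cutoff_eventually])
  qed
  moreover have "(\<lambda>N. \<integral>\<omega>. ?w N (X' t \<omega>) \<partial>M') \<longlonglongrightarrow> (\<integral>\<omega>. (\<lambda>z. h (fst z)) (X' t \<omega>) \<partial>M')"
  proof (rule B.expectation_dominated_tendsto[OF local_function_measurable[OF loc(2)] _ t])
    show "\<bar>?w N (x, \<zeta>)\<bar> \<le> c * weight x" for N x \<zeta>
      unfolding w using hN[of N x] by simp
    show "(\<lambda>N. ?w N z) \<longlonglongrightarrow> h (fst z)" for z
      unfolding w by (intro tendsto_eventually[OF cutoff_eventually])
  qed
  then have "(\<lambda>N. \<rho> * (\<integral>\<omega>. ?w N (X' t \<omega>) \<partial>M')) \<longlonglongrightarrow> \<rho> * (\<integral>\<omega>. h (fst (X' t \<omega>)) \<partial>M')"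
    by (intro tendsto_mult_left) simp
  ultimately show ?thesis unfolding eq using LIMSEQ_unique by blast
qed

section \<open>The mean and the variance of the position\<close>

lemma norm_rvec_le_weight: "norm (rvec x) \<le> weight x"
  unfolding weight_def using exp_ge_add_one_self[of "norm (rvec x)"] by linarith

lemma norm_square_le_weight: "(norm (rvec x))\<^sup>2 \<le> 2 * weight x"
  unfolding weight_def
  using exp_lower_Taylor_quadratic[OF norm_ge_zero, of "rvec x"] norm_ge_zero[of "rvec x"] by linarith

lemma abs_inner_le_weight: "\<bar>u \<bullet> rvec x\<bar> \<le> norm u * weight x"
  using Cauchy_Schwarz_ineq2[of u "rvec x"] mult_left_mono[OF norm_rvec_le_weight[of x], of "norm u"] by force

context forward_process
begin

lemma integrable_position:
  fixes h :: "int^'d \<Rightarrow> real"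
  assumes "\<And>x. \<bar>h x\<bar> \<le> c * weight x" "0 \<le> t"
  shows "integrable M (\<lambda>\<omega>. h (fst (X t \<omega>)))"
  using integrable_dominated[of "h \<circ> fst" c t] measurable_fst_state[of h] assms by simp

lemma integrable_rvec:
  assumes "0 \<le> t" shows "integrable M (\<lambda>\<omega>. rvec (fst (X t \<omega>)))"
proof (rule Bochner_Integration.integrable_bound[OF integrable_weight[OF assms]])
  have "(\<lambda>\<omega>. fst (X t \<omega>)) \<in> M \<rightarrow>\<^sub>M count_space UNIV"
    by (rule measurable_compose[OF state_measurable[OF assms] measurable_fst])
  then show "(\<lambda>\<omega>. rvec (fst (X t \<omega>))) \<in> borel_measurable M"
    by (rule measurable_compose) simp
qed (simp add: abs_of_pos weight_pos norm_rvec_le_weight)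

definition mean :: "real \<Rightarrow> real^'d" where
  "mean t = (\<integral>\<omega>. rvec (fst (X t \<omega>)) \<partial>M)"

lemma inner_mean: "0 \<le> t \<Longrightarrow> u \<bullet> mean t = (\<integral>\<omega>. u \<bullet> rvec (fst (X t \<omega>)) \<partial>M)"
  unfolding mean_def using integrable_rvec by (subst integral_inner_right) auto

lemma continuous_on_mean: "continuous_on {0..t} mean"
proof (subst continuous_on_componentwise, intro ballI)
  fix u :: "real^'d"
  let ?h = "\<lambda>x. u \<bullet> rvec x"
  let ?d = "\<lambda>s. \<integral>\<omega>. mean_drift ?h (X s \<omega>) \<partial>M"
  have eq: "integral {0..s} ?d = mean s \<bullet> u" if "s \<in> {0..t}" for s
    using that expectation_eq_integral_drift[of ?h "norm u" s, OF abs_inner_le_weight]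
    by (simp add: inner_commute[of "mean s"] inner_mean)
  have cont: "continuous_on {0..t} (\<lambda>s. integral {0..s} ?d)"
  proof (cases "0 \<le> t")
    case True
    then show ?thesis
      by (intro indefinite_integral_continuous_1 drift_integrable[OF abs_inner_le_weight])
  qed simp
  show "continuous_on {0..t} (\<lambda>s. mean s \<bullet> u)" by (rule continuous_on_eq[OF cont eq])
qed

end

text \<open>The process started from \<^const>\<open>Q_measure\<close> together with the processes that start with one
  further particle at a given site.\<close>

locale equilibrium = forward_process p M X
  for p :: "int^'d::finite \<Rightarrow> real" and M :: "'w measure" and X :: "real \<Rightarrow> 'w \<Rightarrow> 'd state" +
  fixes \<rho> :: real and M' :: "int^'d \<Rightarrow> 'w measure"
  assumes density: "0 < \<rho>" "\<rho> \<le> 1"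
    and law: "distr M config_space (\<lambda>\<omega>. snd (X 0 \<omega>)) = Q_measure \<rho>"
    and forward': "k \<noteq> 0 \<Longrightarrow> forward_process p (M' k) X"
    and law': "k \<noteq> 0 \<Longrightarrow> distr (M' k) config_space (\<lambda>\<omega>. snd (X 0 \<omega>)) = mu_measure k \<rho>"
begin

definition mean' :: "int^'d \<Rightarrow> real \<Rightarrow> real^'d" where
  "mean' k t = (\<integral>\<omega>. rvec (fst (X t \<omega>)) \<partial>M' k)"

lemma expectation_drift:
  fixes h :: "int^'d \<Rightarrow> real"
  assumes "\<And>j x. \<bar>h (x + j) - h x\<bar> \<le> c j * weight x" and t: "0 \<le> t"
  shows "(\<integral>\<omega>. mean_drift h (X t \<omega>) \<partial>M) = (\<Sum>j\<in>J. p j *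
    ((\<integral>\<omega>. h (fst (X t \<omega>) + j) - h (fst (X t \<omega>)) \<partial>M)
     - \<rho> * (\<integral>\<omega>. h (fst (X t \<omega>) + j) - h (fst (X t \<omega>)) \<partial>M' (- j))))"
proof -
  let ?D = "\<lambda>j x. h (x + j) - h x"
  have occ: "(\<lambda>z::'d state. of_bool (snd z j) :: real) \<in> borel_measurable state_space" for j
    by measurable
  have i1: "integrable M (\<lambda>\<omega>. ?D j (fst (X t \<omega>)))" for j
    by (rule integrable_position[OF assms])
  have i2: "integrable M (\<lambda>\<omega>. ?D j (fst (X t \<omega>)) * of_bool (snd (X t \<omega>) j))" for j
  proof (rule Bochner_Integration.integrable_bound[OF i1[of j]])
    show "(\<lambda>\<omega>. ?D j (fst (X t \<omega>)) * of_bool (snd (X t \<omega>) j)) \<in> borel_measurable M"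
      using measurable_compose[OF state_measurable[OF t] occ] measurable_position[OF t, of "?D j"] by simp
  qed (auto simp: abs_mult)
  have "(\<integral>\<omega>. mean_drift h (X t \<omega>) \<partial>M)
      = (\<integral>\<omega>. (\<Sum>j\<in>J. p j * (?D j (fst (X t \<omega>)) - ?D j (fst (X t \<omega>)) * of_bool (snd (X t \<omega>) j))) \<partial>M)"
    unfolding mean_drift_def split_beta' by (simp add: algebra_simps)
  also have "\<dots> = (\<Sum>j\<in>J. p j * ((\<integral>\<omega>. ?D j (fst (X t \<omega>)) \<partial>M) - (\<integral>\<omega>. ?D j (fst (X t \<omega>)) * of_bool (snd (X t \<omega>) j) \<partial>M)))"
    using i1 i2 by (subst Bochner_Integration.integral_sum) (auto simp del: right_diff_distrib)
  also have "\<dots> = (\<Sum>j\<in>J. p j * ((\<integral>\<omega>. ?D j (fst (X t \<omega>)) \<partial>M) - \<rho> * (\<integral>\<omega>. ?D j (fst (X t \<omega>)) \<partial>M' (- j))))"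
  proof (intro sum.cong refl)
    fix j assume "j \<in> J"
    then have j: "- j \<noteq> 0" using rate_zero by auto
    show "p j * ((\<integral>\<omega>. ?D j (fst (X t \<omega>)) \<partial>M) - (\<integral>\<omega>. ?D j (fst (X t \<omega>)) * of_bool (snd (X t \<omega>) j) \<partial>M))
      = p j * ((\<integral>\<omega>. ?D j (fst (X t \<omega>)) \<partial>M) - \<rho> * (\<integral>\<omega>. ?D j (fst (X t \<omega>)) \<partial>M' (- j)))"
      using reversal_expectation[OF density forward_process_axioms law forward'[OF j] law'[OF j], of "?D j" "c j" t] assms
      by simp
  qed
  finally show ?thesis .
qed

definition drift :: "real^'d" where
  "drift = (\<Sum>j\<in>J. p j *\<^sub>R rvec j)"

text \<open>By reversal, applied to the constant increments of a linear function, the target site \<open>j\<close> is empty with probability \<open>1 - \<rho>\<close> at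
  all times.\<close>

lemma mean_eq: assumes t: "0 \<le> t" shows "mean t = ((1 - \<rho>) * t) *\<^sub>R drift"
proof (rule vector_eq_ldot[THEN iffD1, rule_format])
  fix u :: "real^'d"
  let ?h = "\<lambda>x. u \<bullet> rvec x"
  have d: "(\<integral>\<omega>. mean_drift ?h (X s \<omega>) \<partial>M) = (1 - \<rho>) * (u \<bullet> drift)" if s: "0 \<le> s" for s
  proof -
    have "(\<integral>\<omega>. mean_drift ?h (X s \<omega>) \<partial>M) = (\<Sum>j\<in>J. p j *
      ((\<integral>\<omega>. ?h (fst (X s \<omega>) + j) - ?h (fst (X s \<omega>)) \<partial>M)
       - \<rho> * (\<integral>\<omega>. ?h (fst (X s \<omega>) + j) - ?h (fst (X s \<omega>)) \<partial>M' (- j))))"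
    proof (rule expectation_drift[OF _ s])
      show "\<bar>?h (x + j) - ?h x\<bar> \<le> \<bar>?h j\<bar> * weight x" for j x
        using mult_left_mono[OF weight_ge_1[of x], of "\<bar>?h j\<bar>"] by (simp add: rvec_add inner_add_right)
    qed
    also have "\<dots> = (\<Sum>j\<in>J. p j * ((1 - \<rho>) * (u \<bullet> rvec j)))"
    proof (intro sum.cong refl)
      fix j assume "j \<in> J"
      then have "- j \<noteq> 0" using rate_zero by auto
      then interpret B: forward_process p "M' (- j)" X by (rule forward')
      show "p j * ((\<integral>\<omega>. ?h (fst (X s \<omega>) + j) - ?h (fst (X s \<omega>)) \<partial>M)
       - \<rho> * (\<integral>\<omega>. ?h (fst (X s \<omega>) + j) - ?h (fst (X s \<omega>)) \<partial>M' (- j))) = p j * ((1 - \<rho>) * (u \<bullet> rvec j))"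
        by (simp add: rvec_add inner_add_right prob_space B.prob_space algebra_simps)
    qed
    also have "\<dots> = (1 - \<rho>) * (u \<bullet> drift)"
      by (simp add: drift_def inner_sum_right sum_distrib_left mult_ac)
    finally show ?thesis .
  qed
  have "u \<bullet> mean t = integral {0..t} (\<lambda>s. \<integral>\<omega>. mean_drift ?h (X s \<omega>) \<partial>M)"
    using expectation_eq_integral_drift[of ?h "norm u" t, OF abs_inner_le_weight t] t by (simp add: inner_mean)
  also have "\<dots> = integral {0..t} (\<lambda>s. (1 - \<rho>) * (u \<bullet> drift))"
    by (rule integral_cong) (simp add: d)
  finally show "u \<bullet> mean t = u \<bullet> (((1 - \<rho>) * t) *\<^sub>R drift)"
    using t by simp
qed

text \<open>The increment \<open>|x + j|\<^sup>2 - |x|\<^sup>2 = |j|\<^sup>2 + 2 j \<bullet> x\<close> is correlated with the occupation of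
  \<open>j\<close>; reversal expresses this correlation by the mean position of the process with a particle at
  \<open>- j\<close>. The linear mean position accounts for the term proportional to \<open>s\<close>.\<close>

lemma second_moment_drift:
  assumes s: "0 \<le> s"
  shows "(\<integral>\<omega>. mean_drift (\<lambda>x. (norm (rvec x))\<^sup>2) (X s \<omega>) \<partial>M) =
    (\<Sum>j\<in>J. p j * ((1 - \<rho>) * (norm (rvec j))\<^sup>2 + 2 * (1 - \<rho>)\<^sup>2 * (rvec j \<bullet> drift) * s
      + 2 * \<rho> * (rvec j \<bullet> (mean s - mean' (- j) s))))"
proof -
  let ?h = "\<lambda>x. (norm (rvec x))\<^sup>2"
  have D: "?h (x + j) - ?h x = ?h j + 2 * (rvec j \<bullet> rvec x)" for x j :: "int^'d"
    by (simp add: power2_norm_eq_inner rvec_add inner_add_left inner_add_right inner_commute)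
  have "(\<integral>\<omega>. mean_drift ?h (X s \<omega>) \<partial>M) = (\<Sum>j\<in>J. p j *
      ((\<integral>\<omega>. ?h (fst (X s \<omega>) + j) - ?h (fst (X s \<omega>)) \<partial>M)
       - \<rho> * (\<integral>\<omega>. ?h (fst (X s \<omega>) + j) - ?h (fst (X s \<omega>)) \<partial>M' (- j))))"
  proof (rule expectation_drift[OF _ s])
    show "\<bar>?h (x + j) - ?h x\<bar> \<le> (?h j + 2 * norm (rvec j)) * weight x" for j x :: "int^'d"
    proof -
      have "\<bar>?h j + 2 * (rvec j \<bullet> rvec x)\<bar> \<le> ?h j + 2 * \<bar>rvec j \<bullet> rvec x\<bar>"
        using zero_le_power2[of "norm (rvec j)"] by linarith
      also have "\<dots> \<le> ?h j * weight x + 2 * (norm (rvec j) * weight x)"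
        using mult_left_mono[OF weight_ge_1[of x], of "?h j"] abs_inner_le_weight[of "rvec j" x] by simp
      finally show ?thesis unfolding D by (simp add: distrib_right)
    qed
  qed
  also have "\<dots> = (\<Sum>j\<in>J. p j * ((1 - \<rho>) * ?h j + 2 * (1 - \<rho>)\<^sup>2 * (rvec j \<bullet> drift) * s
      + 2 * \<rho> * (rvec j \<bullet> (mean s - mean' (- j) s))))"
  proof (intro sum.cong refl)
    fix j assume "j \<in> J"
    then have "- j \<noteq> 0" using rate_zero by auto
    then interpret B: forward_process p "M' (- j)" X by (rule forward')
    have 1: "(\<integral>\<omega>. ?h (fst (X s \<omega>) + j) - ?h (fst (X s \<omega>)) \<partial>M) = ?h j + 2 * (rvec j \<bullet> mean s)"
      unfolding D using integrable_position[OF abs_inner_le_weight s, of "rvec j"]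
      by (simp add: prob_space inner_mean[OF s])
    have 2: "(\<integral>\<omega>. ?h (fst (X s \<omega>) + j) - ?h (fst (X s \<omega>)) \<partial>M' (- j)) = ?h j + 2 * (rvec j \<bullet> mean' (- j) s)"
      unfolding D using B.integrable_position[OF abs_inner_le_weight s, of "rvec j"]
      by (simp add: B.prob_space B.inner_mean[OF s] mean'_def flip: B.mean_def)
    have "rvec j \<bullet> mean s = (1 - \<rho>) * s * (rvec j \<bullet> drift)" by (simp add: mean_eq[OF s])
    then have "(1 - \<rho>) * (2 * (rvec j \<bullet> mean s)) = 2 * (1 - \<rho>)\<^sup>2 * (rvec j \<bullet> drift) * s"
      by (simp add: power2_eq_square)
    then show "p j * ((\<integral>\<omega>. ?h (fst (X s \<omega>) + j) - ?h (fst (X s \<omega>)) \<partial>M)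
       - \<rho> * (\<integral>\<omega>. ?h (fst (X s \<omega>) + j) - ?h (fst (X s \<omega>)) \<partial>M' (- j))) =
       p j * ((1 - \<rho>) * ?h j + 2 * (1 - \<rho>)\<^sup>2 * (rvec j \<bullet> drift) * s + 2 * \<rho> * (rvec j \<bullet> (mean s - mean' (- j) s)))"
      unfolding 1 2 by (simp add: inner_diff_right algebra_simps)
  qed
  finally show ?thesis .
qed

lemma mean_difference_integrable:
  assumes "k \<noteq> 0" shows "(\<lambda>s. mean s - mean' k s) integrable_on {0..t}"
proof -
  interpret B: forward_process p "M' k" X by (rule forward'[OF assms])
  have "mean' k = B.mean" by (simp add: mean'_def B.mean_def fun_eq_iff)
  then show ?thesis
    by (simp add: integrable_continuous_real continuous_on_diff continuous_on_mean B.continuous_on_mean)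
qed

lemma integrable_norm_square: "0 \<le> t \<Longrightarrow> integrable M (\<lambda>\<omega>. (norm (rvec (fst (X t \<omega>))))\<^sup>2)"
  by (rule integrable_position[of "\<lambda>x. (norm (rvec x))\<^sup>2" 2 t]) (simp_all add: norm_square_le_weight)

text \<open>The terms linear in time of the drift integrate to the squared mean position, which cancels against
  the one subtracted in the variance.\<close>

theorem variance_eq:
  assumes t: "0 \<le> t"
  shows "(\<integral>\<omega>. (norm (rvec (fst (X t \<omega>)) - mean t))\<^sup>2 \<partial>M) =
    (1 - \<rho>) * (\<Sum>j\<in>J. (norm (rvec j))\<^sup>2 * p j) * t
    + 2 * \<rho> * (\<Sum>j\<in>J. (p j *\<^sub>R rvec j) \<bullet> integral {0..t} (\<lambda>s. mean s - mean' (- j) s))"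
proof -
  let ?h = "\<lambda>x. (norm (rvec x))\<^sup>2"
  let ?I = "\<lambda>j. integral {0..t} (\<lambda>s. mean s - mean' (- j) s)"
  let ?d = "\<lambda>s. \<Sum>j\<in>J. p j * ((1 - \<rho>) * ?h j + 2 * (1 - \<rho>)\<^sup>2 * (rvec j \<bullet> drift) * s
      + 2 * \<rho> * (rvec j \<bullet> (mean s - mean' (- j) s)))"
  have "(?d has_integral (\<Sum>j\<in>J. p j * ((1 - \<rho>) * ?h j * t + 2 * (1 - \<rho>)\<^sup>2 * (rvec j \<bullet> drift) * (t\<^sup>2 / 2)
      + 2 * \<rho> * (rvec j \<bullet> ?I j)))) {0..t}"
  proof (intro has_integral_sum finite_rate_support has_integral_mult_right has_integral_add)
    fix j assume "j \<in> J"
    then have j: "- j \<noteq> 0" using rate_zero by auto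
    show "((\<lambda>s. (1 - \<rho>) * ?h j) has_integral (1 - \<rho>) * ?h j * t) {0..t}"
      using has_integral_const_real[of "(1 - \<rho>) * ?h j" 0 t] t by (simp add: mult.commute)
    show "((\<lambda>s. s) has_integral t\<^sup>2 / 2) {0..t}"
      using ident_has_integral[OF t] by simp
    show "((\<lambda>s. rvec j \<bullet> (mean s - mean' (- j) s)) has_integral rvec j \<bullet> ?I j) {0..t}"
      using has_integral_linear[OF integrable_integral[OF mean_difference_integrable[OF j]] bounded_linear_inner_right]
      by (simp add: o_def)
  qed
  then have "integral {0..t} ?d = (\<Sum>j\<in>J. p j * ((1 - \<rho>) * ?h j * t + 2 * (1 - \<rho>)\<^sup>2 * (rvec j \<bullet> drift) * (t\<^sup>2 / 2)
      + 2 * \<rho> * (rvec j \<bullet> ?I j)))"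
    by (rule integral_unique)
  also have "\<dots> = (\<Sum>j\<in>J. (1 - \<rho>) * (?h j * p j) * t) + (\<Sum>j\<in>J. ((1 - \<rho>) * t)\<^sup>2 * (p j * (rvec j \<bullet> drift)))
      + (\<Sum>j\<in>J. 2 * \<rho> * (p j * (rvec j \<bullet> ?I j)))"
    unfolding sum.distrib[symmetric] by (intro sum.cong refl) (simp add: algebra_simps power2_eq_square)
  also have "\<dots> = (1 - \<rho>) * (\<Sum>j\<in>J. ?h j * p j) * t + ((1 - \<rho>) * t)\<^sup>2 * (drift \<bullet> drift)
      + 2 * \<rho> * (\<Sum>j\<in>J. (p j *\<^sub>R rvec j) \<bullet> ?I j)"
  proof -
    have "drift \<bullet> drift = (\<Sum>j\<in>J. p j * (rvec j \<bullet> drift))"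
      by (subst (1) drift_def) (simp add: inner_sum_left)
    then show ?thesis by (simp add: sum_distrib_left sum_distrib_right)
  qed
  also have "((1 - \<rho>) * t)\<^sup>2 * (drift \<bullet> drift) = mean t \<bullet> mean t"
    by (simp add: mean_eq[OF t] power2_eq_square)
  finally have int: "integral {0..t} ?d = (1 - \<rho>) * (\<Sum>j\<in>J. ?h j * p j) * t + mean t \<bullet> mean t
      + 2 * \<rho> * (\<Sum>j\<in>J. (p j *\<^sub>R rvec j) \<bullet> ?I j)" .
  have b: "\<bar>?h x\<bar> \<le> 2 * weight x" for x :: "int^'d" by (simp add: norm_square_le_weight)
  have "(\<integral>\<omega>. ?h (fst (X t \<omega>)) \<partial>M) = integral {0..t} (\<lambda>s. \<integral>\<omega>. mean_drift ?h (X s \<omega>) \<partial>M)"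
    using expectation_eq_integral_drift[OF b t] by simp
  also have "\<dots> = integral {0..t} ?d" by (rule integral_cong) (simp add: second_moment_drift)
  finally have m2: "(\<integral>\<omega>. ?h (fst (X t \<omega>)) \<partial>M) = integral {0..t} ?d" .
  have "(\<integral>\<omega>. (norm (rvec (fst (X t \<omega>)) - mean t))\<^sup>2 \<partial>M)
      = (\<integral>\<omega>. ?h (fst (X t \<omega>)) - 2 * (mean t \<bullet> rvec (fst (X t \<omega>))) + mean t \<bullet> mean t \<partial>M)"
    by (intro Bochner_Integration.integral_cong refl)
      (simp add: power2_norm_eq_inner inner_diff_left inner_diff_right inner_commute)
  also have "\<dots> = (\<integral>\<omega>. ?h (fst (X t \<omega>)) \<partial>M) - mean t \<bullet> mean t"
    using integrable_norm_square[OF t] integrable_position[OF abs_inner_le_weight t, of "mean t"]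
    by (simp add: prob_space inner_mean[OF t, symmetric])
  finally show ?thesis unfolding m2 int by simp
qed

end

theorem theorem1p1:
  fixes p :: "int^'d::finite \<Rightarrow> real"
    and \<rho> t :: real
    and Pr :: "'d config measure \<Rightarrow> 'w measure"
    and x :: "real \<Rightarrow> 'w \<Rightarrow> int^'d"
    and \<zeta> :: "real \<Rightarrow> 'w \<Rightarrow> 'd config"
  assumes "jump_rate p"
    and "0 < \<rho>" and "\<rho> \<le> 1"
    and "tagged_exclusion p Pr x \<zeta>"
    and "0 \<le> t"
  shows "(\<forall>s\<in>{0..t}. integrable (Pr (Q_measure \<rho>)) (\<lambda>\<omega>. (norm (rvec (x s \<omega>)))\<^sup>2)) \<and>
    (\<forall>k. k \<noteq> 0 \<longrightarrow> (\<forall>s\<in>{0..t}. integrable (Pr (mu_measure k \<rho>)) (\<lambda>\<omega>. rvec (x s \<omega>)))) \<and>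
    (\<forall>k. k \<noteq> 0 \<longrightarrow> (\<lambda>s. mean_position (Pr (Q_measure \<rho>)) x s
                        - mean_position (Pr (mu_measure k \<rho>)) x s) integrable_on {0..t}) \<and>
    position_variance (Pr (Q_measure \<rho>)) x t
      = (1 - \<rho>) * (\<Sum>\<^sub>\<infinity>j. (norm (rvec j))\<^sup>2 * p j) * t
        + 2 * \<rho> * (\<Sum>\<^sub>\<infinity>j. (p j *\<^sub>R rvec j) \<bullet>
            integral {0..t} (\<lambda>s. mean_position (Pr (Q_measure \<rho>)) x s
                               - mean_position (Pr (mu_measure (- j) \<rho>)) x s))"
proof -
  let ?X = "\<lambda>t \<omega>. (x t \<omega>, \<zeta> t \<omega>)"
  have p: "finite_range_rate p" by (rule jump_rate_finite_range[OF assms(1)])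
  obtain S where S: "tagged_transition p S"
    and proc: "\<And>\<nu>. prob_space \<nu> \<Longrightarrow> sets \<nu> = sets config_space \<Longrightarrow>
         markov_process (Pr \<nu>) state_space ?X S \<and> (AE \<omega> in Pr \<nu>. x 0 \<omega> = 0) \<and> distr (Pr \<nu>) config_space (\<zeta> 0) = \<nu>"
    using assms(4) unfolding tagged_exclusion_def by blast
  have fwd: "forward_process p (Pr \<nu>) ?X" "distr (Pr \<nu>) config_space (\<lambda>\<omega>. snd (?X 0 \<omega>)) = \<nu>"
    if "prob_space \<nu>" "sets \<nu> = sets config_space" for \<nu>
    using proc[OF that] markov_process_forward[OF p S, of "Pr \<nu>" ?X] by auto
  note Q = fwd[OF prob_space_Q[OF assms(2,3)] sets_Q]
  note mu = fwd[OF prob_space_mu[OF assms(2,3)] sets_mu]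
  interpret forward_process p "Pr (Q_measure \<rho>)" ?X by (rule Q(1))
  interpret E: equilibrium p "Pr (Q_measure \<rho>)" ?X \<rho> "\<lambda>k. Pr (mu_measure k \<rho>)"
    by (intro equilibrium.intro equilibrium_axioms.intro Q mu assms(2,3))
  have mean: "mean_position (Pr (Q_measure \<rho>)) x = mean"
    "mean_position (Pr (mu_measure k \<rho>)) x = E.mean' k" for k
    by (auto simp: mean_position_def mean_def E.mean'_def fun_eq_iff)
  have "(\<Sum>\<^sub>\<infinity>j. (norm (rvec j))\<^sup>2 * p j) = (\<Sum>\<^sub>\<infinity>j\<in>J. (norm (rvec j))\<^sup>2 * p j)"
    by (rule infsum_cong_neutral) auto
  moreover have "(\<Sum>\<^sub>\<infinity>j. (p j *\<^sub>R rvec j) \<bullet> integral {0..t} (\<lambda>s. mean s - E.mean' (- j) s))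
     = (\<Sum>\<^sub>\<infinity>j\<in>J. (p j *\<^sub>R rvec j) \<bullet> integral {0..t} (\<lambda>s. mean s - E.mean' (- j) s))"
    by (rule infsum_cong_neutral) auto
  moreover have "\<forall>s\<in>{0..t}. integrable (Pr (Q_measure \<rho>)) (\<lambda>\<omega>. (norm (rvec (x s \<omega>)))\<^sup>2)"
    using E.integrable_norm_square by simp
  moreover have "\<forall>k. k \<noteq> 0 \<longrightarrow> (\<forall>s\<in>{0..t}. integrable (Pr (mu_measure k \<rho>)) (\<lambda>\<omega>. rvec (x s \<omega>)))"
    using forward_process.integrable_rvec[OF mu(1)] by simp
  ultimately show ?thesis
    using E.variance_eq[OF assms(5)] E.mean_difference_integrable finite_rate_support
    by (simp add: mean position_variance_def)
qed

end
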